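(* Let $S=\mathrm{NSING}_{n,m}\subseteq V=\mathrm{Mat}_n^m$. Let $\tau$ denote the linear transformation of $V$ that sends $(X_1,\dots,X_m)\mapsto(X_1^t,\dots,X_m^t)$. Then the group of symmetries of $S$ is $$\mathcal{G}_S=G_{n,m}\rtimes\mathbb{Z}/2 ,$$ where $G_{n,m}\rtimes\mathbb{Z}/2$ denotes the group $G_{n,m}\cup G_{n,m}\cdot\tau$.
   Context: The ground field is $\mathbb{C}$. $\mathrm{Mat}_n^m$ is the space of $m$-tuples of $n\times n$ complex matrices, and $X^t$ denotes the transpose of a matrix $X$. With non-commuting indeterminates $t_1,\dots,t_m$, let $F$ denote the free skew field in $t_1,\dots,t_m$ over $\mathbb{C}$ (the universal skew field of fractions of the free algebra $\mathbb{C}\langle t_1,\dots,t_m\rangle$), and $$\mathrm{NSING}_{n,m}=\{(X_1,\dots,X_m)\in\mathrm{Mat}_n^m : \textstyle\sum_{i} t_iX_i \text{ is singular over } F\}.$$ It is a known fact that $\mathrm{NSING}_{n,m}$ equals the null cone $\{X : 0\in\overline{(\mathrm{SL}_n\times\mathrm{SL}_n)\cdot X}\}$ of the left-right action of $\mathrm{SL}_n\times\mathrm{SL}_n$ on $\mathrm{Mat}_n^m$, $(P,Q)\cdot(X_1,\dots,X_m)=(PX_1Q^t,\dots,PX_mQ^t)$; in particular it is a subvariety. For a subvariety $S$ of a vector space $V$, its group of symmetries is $\mathcal{G}_S=\{g\in\mathrm{GL}(V) : gS=S\}$. The group $\mathrm{GL}_m\times\mathrm{GL}_n\times\mathrm{GL}_n$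 acts linearly on $\mathrm{Mat}_n^m$ by $$(P,Q,R)\cdot(X_1,\dots,X_m)=\Big(\sum_{j=1}^m p_{1j}QX_jR^{-1},\ \sum_{j=1}^m p_{2j}QX_jR^{-1},\ \dots,\ \sum_{j=1}^m p_{mj}QX_jR^{-1}\Big),$$ where $p_{ij}$ is the $(i,j)$ entry of $P$. $G_{n,m}$ denotes the image of the resulting homomorphism $\mathrm{GL}_m\times\mathrm{GL}_n\times\mathrm{GL}_n\to\mathrm{GL}(\mathrm{Mat}_n^m)$. The factor $\mathbb{Z}/2$ is the group generated by $\tau$. *)

theory Defs
  imports "HOL-Analysis.Analysis" "HOL-Algebra.Subrings"
begin

section \<open>Epic fields, specializations and universal fields of fractions (after P. M. Cohn)\<close>

definition skew_field :: "('a, 'b) ring_scheme \<Rightarrow> bool" where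
  "skew_field K \<longleftrightarrow> ring K \<and> \<one>\<^bsub>K\<^esub> \<noteq> \<zero>\<^bsub>K\<^esub> \<and> Units K = carrier K - {\<zero>\<^bsub>K\<^esub>}"

definition epic_field :: "('a, 'b) ring_scheme \<Rightarrow> ('k, 'c) ring_scheme \<Rightarrow> ('a \<Rightarrow> 'k) \<Rightarrow> bool" where
  "epic_field R K \<phi> \<longleftrightarrow> skew_field K \<and> \<phi> \<in> ring_hom R K \<and>
     (\<forall>H. subring H K \<and> skew_field (K\<lparr>carrier := H\<rparr>) \<and> \<phi> ` carrier R \<subseteq> H \<longrightarrow> H = carrier K)"

text \<open>
  A specialization from \<open>(K, \<phi>)\<close> to \<open>(L, \<psi>)\<close> is represented by a ring homomorphism \<open>\<alpha>\<close> over \<open>R\<close>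
  that is defined on a subring \<open>D\<close> of \<open>K\<close> containing the image of \<open>R\<close>, such that every element of \<open>D\<close>
  outside the kernel of \<open>\<alpha>\<close> is invertible in \<open>D\<close>. Specializations are identified when they agree on a
  smaller such domain; any two specializations from \<open>(K, \<phi>)\<close> to \<open>(L, \<psi>)\<close> are then identified, because
  their equalizer is again such a domain. So in the universal property below uniqueness is automatic
  and only existence has to be required.
\<close>

definition specializes ::
  "('a, 'b) ring_scheme \<Rightarrow> ('k, 'c) ring_scheme \<Rightarrow> ('a \<Rightarrow> 'k) \<Rightarrow> ('l, 'd) ring_scheme \<Rightarrow> ('a \<Rightarrow> 'l) \<Rightarrow> bool"
where
  "specializes R K \<phi> L \<psi> \<longleftrightarrow>
     (\<exists>D \<alpha>. subring D K \<and> \<phi> ` carrier R \<subseteq> D \<and> \<alpha> \<in> ring_hom (K\<lparr>carrier := D\<rparr>) L \<and>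
        (\<forall>r\<in>carrier R. \<alpha> (\<phi> r) = \<psi> r) \<and>
        (\<forall>x\<in>D. \<alpha> x \<noteq> \<zero>\<^bsub>L\<^esub> \<longrightarrow> x \<in> Units (K\<lparr>carrier := D\<rparr>)))"

text \<open>
  In the universal property, \<open>L\<close> ranges over the epic \<open>R\<close>-fields whose elements are taken from the
  element type of \<open>R\<close>. An epic \<open>R\<close>-field has at most \<open>max |R| \<aleph>\<^sub>0\<close> elements, so if the element type
  is infinite, then every epic \<open>R\<close>-field is isomorphic to one of these, and the restriction loses
  nothing.
\<close>

definition universal_field_of_fractions ::
  "'a ring \<Rightarrow> 'k ring \<Rightarrow> ('a \<Rightarrow> 'k) \<Rightarrow> bool" where
  "universal_field_of_fractions R K \<phi> \<longleftrightarrow>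
     epic_field R K \<phi> \<and> inj_on \<phi> (carrier R) \<and>
     (\<forall>(L :: 'a ring) \<psi>. epic_field R L \<psi> \<longrightarrow> specializes R K \<phi> L \<psi>)"


section \<open>The free algebra over the complex numbers\<close>

text \<open>
  A non-commutative polynomial is the function giving the coefficient of each word; the
  indeterminates are indexed by the type \<open>'m\<close>.
\<close>

definition free_algebra :: "('m list \<Rightarrow> complex) ring" where
  "free_algebra =
     \<lparr>carrier = {f. finite {w. f w \<noteq> 0}},
      mult = (\<lambda>f g w. \<Sum>(u, v)\<in>{(u, v). u @ v = w}. f u * g v),
      one = (\<lambda>w. if w = [] then 1 else 0),
      zero = (\<lambda>w. 0),
      add = (\<lambda>f g w. f w + g w)\<rparr>"

definition fa_const :: "complex \<Rightarrow> 'm list \<Rightarrow> complex" where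
  "fa_const c = (\<lambda>w. if w = [] then c else 0)"

definition fa_var :: "'m \<Rightarrow> 'm list \<Rightarrow> complex" where
  "fa_var i = (\<lambda>w. if w = [i] then 1 else 0)"

abbreviation free_skew_field :: "'f ring \<Rightarrow> (('m list \<Rightarrow> complex) \<Rightarrow> 'f) \<Rightarrow> bool" where
  "free_skew_field F \<phi> \<equiv> universal_field_of_fractions free_algebra F \<phi>"

lemma finite_splits: "finite {(u, v). u @ v = w}"
proof -
  have "p \<in> (\<lambda>i. (take i w, drop i w)) ` {..length w}" if "p \<in> {(u, v). u @ v = w}" for p
    using that by (intro image_eqI[where x = "length (fst p)"]) auto
  then have "{(u, v). u @ v = w} \<subseteq> (\<lambda>i. (take i w, drop i w)) ` {..length w}"
    by blast
  then show ?thesis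
    by (rule finite_subset) simp
qed

lemma ring_free_algebra: "ring (free_algebra :: ('m list \<Rightarrow> complex) ring)"
proof -
  let ?m = "\<lambda>f g w. \<Sum>(u, v)\<in>{(u, v). u @ v = w}. f u * g v :: complex"
  let ?C = "{f :: 'm list \<Rightarrow> complex. finite {w. f w \<noteq> 0}}"
  have closed: "?m f g \<in> ?C" if "f \<in> ?C" "g \<in> ?C" for f g
  proof -
    have "{w. ?m f g w \<noteq> 0} \<subseteq> (\<lambda>(u, v). u @ v) ` ({w. f w \<noteq> 0} \<times> {w. g w \<noteq> 0})"
    proof
      fix w assume "w \<in> {w. ?m f g w \<noteq> 0}"
      then obtain p where "p \<in> {(u, v). u @ v = w}" "(case p of (u, v) \<Rightarrow> f u * g v) \<noteq> 0"
        by (auto elim: sum.not_neutral_contains_not_neutral)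
      then show "w \<in> (\<lambda>(u, v). u @ v) ` ({w. f w \<noteq> 0} \<times> {w. g w \<noteq> 0})"
        by (auto intro!: image_eqI[where x = p])
    qed
    with that show ?thesis
      by (auto intro: finite_subset)
  qed
  have assoc: "?m (?m f g) h w = ?m f (?m g h) w" for f g h :: "'m list \<Rightarrow> complex" and w
  proof -
    have "?m (?m f g) h w =
        (\<Sum>(p, q)\<in>(SIGMA p:{(a, b). a @ b = w}. {(u, v). u @ v = fst p}). f (fst q) * g (snd q) * h (snd p))"
      by (subst sum.Sigma[symmetric])
         (auto simp: finite_splits[unfolded case_prod_unfold] sum_distrib_right case_prod_unfold)
    also have "\<dots> = (\<Sum>(p, q)\<in>(SIGMA p:{(a, b). a @ b = w}. {(u, v). u @ v = snd p}).
        f (fst p) * g (fst q) * h (snd q))"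
      by (rule sum.reindex_bij_witness
            [where j = "\<lambda>((a, b), (u, v)). ((u, v @ b), (v, b))"
               and i = "\<lambda>((a, b), (u, v)). ((a @ u, v), (a, u))"]) auto
    also have "\<dots> = ?m f (?m g h) w"
      by (subst sum.Sigma[symmetric])
         (auto simp: finite_splits[unfolded case_prod_unfold] sum_distrib_left case_prod_unfold mult.assoc)
    finally show ?thesis .
  qed
  have one_l: "?m (\<lambda>w. if w = [] then 1 else 0) f w = f w" for f :: "'m list \<Rightarrow> complex" and w
  proof -
    have "?m (\<lambda>w. if w = [] then 1 else 0) f w = (\<Sum>(u, v)\<in>{([] :: 'm list, w)}. f v)"
      by (rule sum.mono_neutral_cong_right) (auto simp: finite_splits split: if_splits)
    then show ?thesis by simp
  qed
  have one_r: "?m f (\<lambda>w. if w = [] then 1 else 0) w = f w" for f :: "'m list \<Rightarrow> complex" and w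
  proof -
    have "?m f (\<lambda>w. if w = [] then 1 else 0) w = (\<Sum>(u, v)\<in>{(w, [] :: 'm list)}. f u)"
      by (rule sum.mono_neutral_cong_right) (auto simp: finite_splits split: if_splits)
    then show ?thesis by simp
  qed
  have add_closed: "(\<lambda>w. f w + g w) \<in> ?C" if "f \<in> ?C" "g \<in> ?C" for f g
    using that by (auto intro: finite_subset[of _ "{w. f w \<noteq> 0} \<union> {w. g w \<noteq> 0}"])
  show ?thesis
  proof (rule ringI)
    show "abelian_group (free_algebra :: ('m list \<Rightarrow> complex) ring)"
    proof (rule abelian_groupI)
      fix f :: "'m list \<Rightarrow> complex" assume "f \<in> carrier free_algebra"
      then show "\<exists>g\<in>carrier free_algebra. g \<oplus>\<^bsub>free_algebra\<^esub> f = \<zero>\<^bsub>free_algebra\<^esub>"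
        by (intro bexI[where x = "\<lambda>w. - f w"]) (auto simp: free_algebra_def)
    qed (use add_closed in \<open>auto simp: free_algebra_def algebra_simps\<close>)
    show "Group.monoid (free_algebra :: ('m list \<Rightarrow> complex) ring)"
      by (rule monoidI)
         (use closed assoc one_l one_r in \<open>auto simp: free_algebra_def\<close>)
  qed (auto simp: free_algebra_def algebra_simps sum.distrib case_prod_unfold)
qed


section \<open>Singular tuples of matrices\<close>

text \<open>Square matrices over a ring that need not be commutative are functions of two indices.\<close>

definition matrix_invertible :: "('f, 'b) ring_scheme \<Rightarrow> ('n::finite \<Rightarrow> 'n \<Rightarrow> 'f) \<Rightarrow> bool" where
  "matrix_invertible K A \<longleftrightarrow>
     (\<exists>B. (\<forall>i j. B i j \<in> carrier K) \<and>
       (\<forall>i j. (\<Oplus>\<^bsub>K\<^esub>k\<in>UNIV. A i k \<otimes>\<^bsub>K\<^esub> B k j) = (if i = j then \<one>\<^bsub>K\<^esub> else \<zero>\<^bsub>K\<^esub>)) \<and>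
       (\<forall>i j. (\<Oplus>\<^bsub>K\<^esub>k\<in>UNIV. B i k \<otimes>\<^bsub>K\<^esub> A k j) = (if i = j then \<one>\<^bsub>K\<^esub> else \<zero>\<^bsub>K\<^esub>)))"

definition pencil :: "complex^'n^'n^'m \<Rightarrow> 'n \<Rightarrow> 'n \<Rightarrow> 'm list \<Rightarrow> complex" where
  "pencil X i j = (\<Oplus>\<^bsub>free_algebra\<^esub>k\<in>UNIV. fa_var k \<otimes>\<^bsub>free_algebra\<^esub> fa_const (X $ k $ i $ j))"

definition NSING :: "'f ring \<Rightarrow> (('m list \<Rightarrow> complex) \<Rightarrow> 'f) \<Rightarrow> (complex^'n^'n^'m) set" where
  "NSING F \<phi> = {X. \<not> matrix_invertible F (\<lambda>i j. \<phi> (pencil X i j))}"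


section \<open>Groups of linear symmetries\<close>

text \<open>The predefined scalar multiplication on \<open>complex^'n^'n^'m\<close> is the real one.\<close>

definition mscale :: "complex \<Rightarrow> complex^'n^'n \<Rightarrow> complex^'n^'n" where
  "mscale c M = (\<chi> i j. c * M $ i $ j)"

definition tscale :: "complex \<Rightarrow> complex^'n^'n^'m \<Rightarrow> complex^'n^'n^'m" where
  "tscale c X = (\<chi> k. mscale c (X $ k))"

lemma vector_space_tscale: "vector_space tscale"
  by unfold_locales (simp_all add: tscale_def mscale_def vec_eq_iff algebra_simps)

definition GL_tuples :: "(complex^'n^'n^'m \<Rightarrow> complex^'n^'n^'m) set" where
  "GL_tuples = {g. Vector_Spaces.linear tscale tscale g \<and> bij g}"

definition symmetries :: "(complex^'n^'n^'m) set \<Rightarrow> (complex^'n^'n^'m \<Rightarrow> complex^'n^'n^'m) set" where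
  "symmetries S = {g \<in> GL_tuples. g ` S = S}"

definition tuple_action ::
  "complex^'m^'m \<Rightarrow> complex^'n^'n \<Rightarrow> complex^'n^'n \<Rightarrow> complex^'n^'n^'m \<Rightarrow> complex^'n^'n^'m" where
  "tuple_action P Q R X = (\<chi> i. \<Sum>j\<in>UNIV. mscale (P $ i $ j) (Q ** (X $ j) ** matrix_inv R))"

definition G_group :: "(complex^'n^'n^'m \<Rightarrow> complex^'n^'n^'m) set" where
  "G_group = {tuple_action P Q R | P Q R. invertible P \<and> invertible Q \<and> invertible R}"

definition tuple_transpose :: "complex^'n^'n^'m \<Rightarrow> complex^'n^'n^'m" where
  "tuple_transpose X = (\<chi> k. transpose (X $ k))"

end

theory Submission
  imports Defs "HOL-Algebra.Weak_Morphisms" "HOL-Algebra.UnivPoly"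
begin

text \<open>
  Call \<open>Y\<close> critical if no line \<open>X + s Y\<close> through a nonsingular tuple \<open>X\<close> meets the singular locus
  more than once; a linear symmetry of the singular locus permutes the critical tuples. They are the
  tuples all of whose matrices have rank at most one with a common column or a common row. If \<open>Y\<close> has
  a common column, then \<open>X + s Y\<close> is a rank-one update of an invertible matrix over the free field, so
  it is singular for at most one \<open>s\<close>. Otherwise some linear combination of the \<open>Y\<^sub>k\<close> has two independent
  columns, and \<open>X\<close> can be chosen nonsingular such that one column of \<open>X - Y\<close> and another one of
  \<open>X - 2 Y\<close> vanish. A linear bijection that preserves these tuples permutes the maximal linear subspaces
  \<open>u \<otimes> \<complex>\<^sup>n \<otimes> \<complex>\<^sup>m\<close> and \<open>\<complex>\<^sup>n \<otimes> v \<otimes> \<complex>\<^sup>m\<close>; up to the transpose it respects the two kinds, and it is then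
  a tensor product of three linear maps.

  Two facts about the free field are needed: a pencil that becomes invertible over some epic field is
  invertible over the free field (specializations are local homomorphisms), and the singular locus is
  invariant under linear substitutions of the indeterminates and under the transpose. The invariance
  results from the first fact applied to the free field itself, twisted by an automorphism or by the
  anti-automorphism that reverses words.
\<close>

section \<open>Matrices over a ring\<close>

text \<open>Over a skew field there is no determinant whose degree along \<open>X + s Y\<close>
  could be read off, so a substitute for the rank of \<open>Y\<close> has to be expressed by
  membership in the singular locus alone; counting singular points on lines does this. Requiring
  \<open>X\<close> to be nonsingular discards the lines that lie inside the locus. For a common
  column, singularity along the line is a single equation \<open>1 + s d = 0\<close> in the free
  field, and it determines \<open>s\<close> because the constants embed injectively.

  A linear space of matrices of rank at most one has a common left factor or a common right factor.
  Flattened to matrices with row index \<open>i\<close> and column index \<open>(k, j)\<close>, the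
  image of a column space might also be of the second type; this has to be excluded by its
  dimension, except for \<open>m = 1\<close>, where that type is a row space anyway. For
  \<open>n = 1\<close> the cone is the whole space and the two kinds coincide, so this case stands
  apart.

  A linear bijection respecting the two kinds determines its action on the factors only up to
  scalars that may vary with the vector. Making these choices linear is the purpose of
  \<open>bilinear_factorization\<close>.\<close>

definition mring :: "('f, 'b) ring_scheme \<Rightarrow> ('n::finite \<Rightarrow> 'n \<Rightarrow> 'f) ring" where
  "mring K = \<lparr>carrier = {A. \<forall>i j. A i j \<in> carrier K},
     mult = (\<lambda>A B i j. \<Oplus>\<^bsub>K\<^esub>k\<in>UNIV. A i k \<otimes>\<^bsub>K\<^esub> B k j),
     one = (\<lambda>i j. if i = j then \<one>\<^bsub>K\<^esub> else \<zero>\<^bsub>K\<^esub>),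
     zero = (\<lambda>i j. \<zero>\<^bsub>K\<^esub>),
     add = (\<lambda>A B i j. A i j \<oplus>\<^bsub>K\<^esub> B i j)\<rparr>"

context ring
begin

lemma finsum_swap:
  assumes "finite A" "finite B" "\<And>i j. i \<in> A \<Longrightarrow> j \<in> B \<Longrightarrow> f i j \<in> carrier R"
  shows "(\<Oplus>i\<in>A. \<Oplus>j\<in>B. f i j) = (\<Oplus>j\<in>B. \<Oplus>i\<in>A. f i j)"
  using assms(1,3)
proof (induction A rule: finite_induct)
  case empty
  then show ?case by simp
next
  case (insert a A)
  have "(\<Oplus>j\<in>B. \<Oplus>i\<in>insert a A. f i j) = (\<Oplus>j\<in>B. f a j \<oplus> (\<Oplus>i\<in>A. f i j))"
    using insert by (intro finsum_cong') (auto intro!: finsum_closed finsum_insert)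
  also have "\<dots> = (\<Oplus>j\<in>B. f a j) \<oplus> (\<Oplus>j\<in>B. \<Oplus>i\<in>A. f i j)"
    using insert by (intro finsum_addf) (auto intro!: finsum_closed)
  also have "\<dots> = (\<Oplus>i\<in>insert a A. \<Oplus>j\<in>B. f i j)"
    using insert by (subst finsum_insert) (auto intro!: finsum_closed)
  finally show ?case by simp
qed

lemma finsum_delta_l:
  assumes "\<And>k. f k \<in> carrier R"
  shows "(\<Oplus>k\<in>(UNIV :: 'n::finite set). (if i = k then \<one> else \<zero>) \<otimes> f k) = f i"
proof -
  have "(\<Oplus>k\<in>UNIV. (if i = k then \<one> else \<zero>) \<otimes> f k) = (\<Oplus>k\<in>UNIV. if i = k then f k else \<zero>)"
    using assms by (intro finsum_cong') auto
  also have "\<dots> = f i"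
    using assms by (intro finsum_singleton) auto
  finally show ?thesis .
qed

lemma finsum_delta_r:
  assumes "\<And>k. f k \<in> carrier R"
  shows "(\<Oplus>k\<in>(UNIV :: 'n::finite set). f k \<otimes> (if k = i then \<one> else \<zero>)) = f i"
proof -
  have "(\<Oplus>k\<in>UNIV. f k \<otimes> (if k = i then \<one> else \<zero>)) = (\<Oplus>k\<in>UNIV. if i = k then f k else \<zero>)"
    using assms by (intro finsum_cong') auto
  also have "\<dots> = f i"
    using assms by (intro finsum_singleton) auto
  finally show ?thesis .
qed

lemma mring_assoc:
  fixes A B C :: "'n::finite \<Rightarrow> 'n \<Rightarrow> 'a"
  assumes "\<And>i j. A i j \<in> carrier R" "\<And>i j. B i j \<in> carrier R" "\<And>i j. C i j \<in> carrier R"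
  shows "(\<Oplus>k\<in>UNIV. (\<Oplus>l\<in>UNIV. A i l \<otimes> B l k) \<otimes> C k j) = (\<Oplus>l\<in>UNIV. A i l \<otimes> (\<Oplus>k\<in>UNIV. B l k \<otimes> C k j))"
proof -
  have "(\<Oplus>k\<in>UNIV. (\<Oplus>l\<in>UNIV. A i l \<otimes> B l k) \<otimes> C k j) = (\<Oplus>k\<in>UNIV. \<Oplus>l\<in>UNIV. A i l \<otimes> B l k \<otimes> C k j)"
    using assms by (intro finsum_cong' finsum_ldistr) (auto intro!: finsum_closed)
  also have "\<dots> = (\<Oplus>l\<in>UNIV. \<Oplus>k\<in>UNIV. A i l \<otimes> B l k \<otimes> C k j)"
    using assms by (intro finsum_swap) auto
  also have "\<dots> = (\<Oplus>l\<in>UNIV. \<Oplus>k\<in>UNIV. A i l \<otimes> (B l k \<otimes> C k j))"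
    using assms by (intro finsum_cong') (auto intro!: finsum_closed finsum_cong' simp: m_assoc)
  also have "\<dots> = (\<Oplus>l\<in>UNIV. A i l \<otimes> (\<Oplus>k\<in>UNIV. B l k \<otimes> C k j))"
    using assms by (intro finsum_cong' finsum_rdistr[symmetric]) (auto intro!: finsum_closed)
  finally show ?thesis .
qed

lemma ring_mring: "ring (mring R :: ('n::finite \<Rightarrow> 'n \<Rightarrow> 'a) ring)"
proof (rule ringI)
  let ?M = "mring R :: ('n::finite \<Rightarrow> 'n \<Rightarrow> 'a) ring"
  show "abelian_group ?M"
  proof (rule abelian_groupI)
    fix A assume "A \<in> carrier ?M"
    then show "\<exists>B\<in>carrier ?M. B \<oplus>\<^bsub>?M\<^esub> A = \<zero>\<^bsub>?M\<^esub>"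
      by (intro bexI[where x = "\<lambda>i j. \<ominus> A i j"]) (auto simp: mring_def l_neg)
  qed (auto simp: mring_def a_ac)
  show "Group.monoid ?M"
    by (rule monoidI)
      (auto simp: mring_def finsum_delta_l finsum_delta_r mring_assoc intro!: finsum_closed)
qed (auto simp: mring_def l_distr r_distr fun_eq_iff intro!: trans[OF _ finsum_addf] finsum_cong')

lemma matrix_invertible_iff_Units:
  assumes "\<And>i j. A i j \<in> carrier R"
  shows "matrix_invertible R A \<longleftrightarrow> A \<in> Units (mring R)"
  using assms unfolding matrix_invertible_def Units_def mring_def by (auto simp: fun_eq_iff)

text \<open>Expanding the inverse of \<open>1 + ab\<close> formally as
  \<open>1 - a (1 - ba + baba - ...) b\<close> suggests the candidate \<open>1 - a d b\<close>,
  where \<open>d\<close> is the inverse of \<open>1 + ba\<close>. The two equations defining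
  \<open>d\<close> confirm it from both sides.\<close>

lemma jacobson:
  assumes [simp]: "a \<in> carrier R" "b \<in> carrier R" and "\<one> \<oplus> b \<otimes> a \<in> Units R"
  shows "\<one> \<oplus> a \<otimes> b \<in> Units R"
proof -
  define d where "d = inv (\<one> \<oplus> b \<otimes> a)"
  have [simp]: "d \<in> carrier R" using assms by (simp add: d_def)
  have "d \<otimes> (\<one> \<oplus> b \<otimes> a) = \<one>" "(\<one> \<oplus> b \<otimes> a) \<otimes> d = \<one>"
    using assms by (simp_all add: d_def)
  then have d: "d \<oplus> d \<otimes> b \<otimes> a = \<one>" "d \<oplus> b \<otimes> a \<otimes> d = \<one>"
    by (simp_all add: r_distr l_distr m_assoc)
  have "(\<one> \<oplus> a \<otimes> b) \<otimes> (\<one> \<ominus> a \<otimes> d \<otimes> b) = \<one> \<oplus> a \<otimes> b \<ominus> a \<otimes> (d \<oplus> b \<otimes> a \<otimes> d) \<otimes> b"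
    by (simp add: minus_eq l_distr r_distr l_minus r_minus m_assoc a_ac minus_add)
  also have "\<dots> = \<one>" unfolding d by (simp add: minus_eq a_assoc r_neg)
  finally have 1: "(\<one> \<oplus> a \<otimes> b) \<otimes> (\<one> \<ominus> a \<otimes> d \<otimes> b) = \<one>" .
  have "(\<one> \<ominus> a \<otimes> d \<otimes> b) \<otimes> (\<one> \<oplus> a \<otimes> b) = \<one> \<oplus> a \<otimes> b \<ominus> a \<otimes> (d \<oplus> d \<otimes> b \<otimes> a) \<otimes> b"
    by (simp add: minus_eq l_distr r_distr l_minus r_minus m_assoc a_ac minus_add)
  also have "\<dots> = \<one>" unfolding d by (simp add: minus_eq a_assoc r_neg)
  finally have 2: "(\<one> \<ominus> a \<otimes> d \<otimes> b) \<otimes> (\<one> \<oplus> a \<otimes> b) = \<one>" .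
  show ?thesis
    using 1 2 by (auto simp: Units_def intro!: bexI[of _ "\<one> \<ominus> a \<otimes> d \<otimes> b"])
qed


lemma Units_mult_left_iff:
  assumes "a \<in> Units R" "x \<in> carrier R"
  shows "a \<otimes> x \<in> Units R \<longleftrightarrow> x \<in> Units R"
proof
  assume "a \<otimes> x \<in> Units R"
  then have "inv a \<otimes> (a \<otimes> x) \<in> Units R"
    using assms(1) by (metis Units_m_closed Units_inv_Units)
  moreover have "inv a \<otimes> (a \<otimes> x) = x"
    using assms m_assoc[of "inv a" a x] Units_closed by simp
  ultimately show "x \<in> Units R" by simp
qed (use assms in auto)

lemma Units_mult_right_iff:
  assumes "a \<in> Units R" "x \<in> carrier R"
  shows "x \<otimes> a \<in> Units R \<longleftrightarrow> x \<in> Units R"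
proof
  assume "x \<otimes> a \<in> Units R"
  then have "x \<otimes> a \<otimes> inv a \<in> Units R"
    using assms(1) by (metis Units_m_closed Units_inv_Units)
  moreover have "x \<otimes> a \<otimes> inv a = x"
    using assms m_assoc[of x a "inv a"] Units_closed by simp
  ultimately show "x \<in> Units R" by simp
qed (use assms in auto)

lemma jacobson_iff:
  assumes "a \<in> carrier R" "b \<in> carrier R"
  shows "\<one> \<oplus> a \<otimes> b \<in> Units R \<longleftrightarrow> \<one> \<oplus> b \<otimes> a \<in> Units R"
  using jacobson assms by blast

text \<open>The \<open>(p, p)\<close> entries of the two inverse equations exhibit an inverse of
  \<open>c\<close>. This brings a matrix that differs from the identity in one diagonal entry down
  to a scalar.\<close>

lemma unit_corner_iff:
  fixes p :: "'n::finite"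
  assumes c [simp]: "c \<in> carrier R"
  shows "(\<lambda>i j. if i = j then if i = p then c else \<one> else \<zero>) \<in> Units (mring R :: ('n \<Rightarrow> 'n \<Rightarrow> 'a) ring)
    \<longleftrightarrow> c \<in> Units R"
proof
  let ?D = "\<lambda>c i j :: 'n. if i = j then if i = p then c else \<one> else \<zero>"
  have l: "(\<Oplus>k\<in>UNIV. ?D c i k \<otimes> f k) = (if i = p then c else \<one>) \<otimes> f i"
    if "c \<in> carrier R" "\<And>k. f k \<in> carrier R" for c f i
  proof -
    have "(\<Oplus>k\<in>UNIV. ?D c i k \<otimes> f k) = (\<Oplus>k\<in>UNIV. if i = k then (if k = p then c else \<one>) \<otimes> f k else \<zero>)"
      using that by (intro finsum_cong') auto
    also have "\<dots> = (if i = p then c else \<one>) \<otimes> f i"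
      using that by (intro finsum_singleton) auto
    finally show ?thesis .
  qed
  have r: "(\<Oplus>k\<in>UNIV. f k \<otimes> ?D c k i) = f i \<otimes> (if i = p then c else \<one>)"
    if "c \<in> carrier R" "\<And>k. f k \<in> carrier R" for c f i
  proof -
    have "(\<Oplus>k\<in>UNIV. f k \<otimes> ?D c k i) = (\<Oplus>k\<in>UNIV. if i = k then f k \<otimes> (if k = p then c else \<one>) else \<zero>)"
      using that by (intro finsum_cong') auto
    also have "\<dots> = f i \<otimes> (if i = p then c else \<one>)"
      using that by (intro finsum_singleton) auto
    finally show ?thesis .
  qed
  {
    assume "?D c \<in> Units (mring R :: ('n \<Rightarrow> 'n \<Rightarrow> 'a) ring)"
    then obtain B where "\<And>i j. B i j \<in> carrier R"
      "\<And>i j. (\<Oplus>k\<in>UNIV. ?D c i k \<otimes> B k j) = (if i = j then \<one> else \<zero>)"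
      "\<And>i j. (\<Oplus>k\<in>UNIV. B i k \<otimes> ?D c k j) = (if i = j then \<one> else \<zero>)"
      unfolding Units_def mring_def by (auto simp: fun_eq_iff)
    then have "c \<otimes> B p p = \<one>" "B p p \<otimes> c = \<one>" "B p p \<in> carrier R"
      using l[OF c, of "\<lambda>k. B k p" p] r[OF c, of "\<lambda>k. B p k" p] by simp_all
    then show "c \<in> Units R" unfolding Units_def by auto
  }
  {
    assume "c \<in> Units R"
    then obtain d where d: "d \<in> carrier R" "c \<otimes> d = \<one>" "d \<otimes> c = \<one>" unfolding Units_def by auto
    show "?D c \<in> Units (mring R :: ('n \<Rightarrow> 'n \<Rightarrow> 'a) ring)"
      unfolding Units_def mring_def
      using d by (auto simp: fun_eq_iff l r intro!: exI[of _ "?D d"])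
  }
qed

text \<open>The matrix determinant lemma without determinants:
  \<open>A + u v = A (1 + (B u) v)\<close>, and exchanging the two factors by
  \<open>jacobson_iff\<close> leaves the scalar \<open>1 + v (B u)\<close>.\<close>

lemma rank_one_update:
  fixes A B :: "'n::finite \<Rightarrow> 'n \<Rightarrow> 'a"
  assumes A: "A \<in> carrier (mring R)" and B: "B \<in> carrier (mring R)"
    and AB: "A \<otimes>\<^bsub>mring R\<^esub> B = \<one>\<^bsub>mring R\<^esub>" and BA: "B \<otimes>\<^bsub>mring R\<^esub> A = \<one>\<^bsub>mring R\<^esub>"
    and u: "\<And>i. u i \<in> carrier R" and v: "\<And>i. v i \<in> carrier R"
  shows "(\<lambda>i j. A i j \<oplus> u i \<otimes> v j) \<in> Units (mring R)
    \<longleftrightarrow> \<one> \<oplus> (\<Oplus>j\<in>UNIV. v j \<otimes> (\<Oplus>k\<in>UNIV. B j k \<otimes> u k)) \<in> Units R"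
proof -
  interpret M: ring "mring R :: ('n \<Rightarrow> 'n \<Rightarrow> 'a) ring" by (rule ring_mring)
  \<comment> \<open>The column \<open>u\<close> and the row \<open>v\<close> are padded to square matrices, which makes \<open>jacobson_iff\<close> applicable.\<close>
  define p :: 'n where "p = undefined"
  let ?M = "mring R :: ('n \<Rightarrow> 'n \<Rightarrow> 'a) ring"
  define U where "U = (\<lambda>i j. if j = p then u i else \<zero>)"
  define N where "N = (\<lambda>i j. if i = p then v j else \<zero>)"
  have U: "U \<in> carrier ?M" and N: "N \<in> carrier ?M"
    using u v by (auto simp: U_def N_def mring_def)
  have AU: "A \<in> Units ?M" using A B AB BA unfolding Units_def by auto
  let ?c = "\<Oplus>j\<in>UNIV. v j \<otimes> (\<Oplus>k\<in>UNIV. B j k \<otimes> u k)"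
  have Bc: "\<And>i j. B i j \<in> carrier R" using B by (simp add: mring_def)
  have UN: "(U \<otimes>\<^bsub>?M\<^esub> N) i j = u i \<otimes> v j" for i j
  proof -
    have "(U \<otimes>\<^bsub>?M\<^esub> N) i j = (\<Oplus>k\<in>UNIV. if p = k then u i \<otimes> v j else \<zero>)"
      using u v by (auto simp: mring_def U_def N_def intro!: finsum_cong')
    also have "\<dots> = u i \<otimes> v j"
      using u v by (intro finsum_singleton) auto
    finally show ?thesis .
  qed
  have BU: "(B \<otimes>\<^bsub>?M\<^esub> U) i j = (if j = p then \<Oplus>k\<in>UNIV. B i k \<otimes> u k else \<zero>)" for i j
    using Bc by (simp add: mring_def U_def)
  have NBU: "(N \<otimes>\<^bsub>?M\<^esub> (B \<otimes>\<^bsub>?M\<^esub> U)) i j = (if i = p \<and> j = p then ?c else \<zero>)" for i j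
  proof -
    have "(N \<otimes>\<^bsub>?M\<^esub> (B \<otimes>\<^bsub>?M\<^esub> U)) i j = (\<Oplus>k\<in>UNIV. N i k \<otimes> (B \<otimes>\<^bsub>?M\<^esub> U) k j)"
      by (simp add: mring_def)
    also have "\<dots> = (if i = p \<and> j = p then ?c else \<zero>)"
      using u v Bc by (auto simp: BU N_def intro!: finsum_closed)
    finally show ?thesis .
  qed
  have c: "?c \<in> carrier R" using u v Bc by (auto intro!: finsum_closed)
  have "(\<lambda>i j. A i j \<oplus> u i \<otimes> v j) = A \<oplus>\<^bsub>?M\<^esub> U \<otimes>\<^bsub>?M\<^esub> N"
    using UN by (auto simp: fun_eq_iff mring_def)
  also have "\<dots> = A \<otimes>\<^bsub>?M\<^esub> (\<one>\<^bsub>?M\<^esub> \<oplus>\<^bsub>?M\<^esub> (B \<otimes>\<^bsub>?M\<^esub> U) \<otimes>\<^bsub>?M\<^esub> N)"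
    using A B U N AB by (simp add: M.r_distr M.m_assoc[symmetric])
  finally have "(\<lambda>i j. A i j \<oplus> u i \<otimes> v j) \<in> Units ?M
      \<longleftrightarrow> \<one>\<^bsub>?M\<^esub> \<oplus>\<^bsub>?M\<^esub> (B \<otimes>\<^bsub>?M\<^esub> U) \<otimes>\<^bsub>?M\<^esub> N \<in> Units ?M"
    using M.Units_mult_left_iff[OF AU] B U N by simp
  also have "\<dots> \<longleftrightarrow> \<one>\<^bsub>?M\<^esub> \<oplus>\<^bsub>?M\<^esub> N \<otimes>\<^bsub>?M\<^esub> (B \<otimes>\<^bsub>?M\<^esub> U) \<in> Units ?M"
    using B U N by (intro M.jacobson_iff) auto
  also have "\<one>\<^bsub>?M\<^esub> \<oplus>\<^bsub>?M\<^esub> N \<otimes>\<^bsub>?M\<^esub> (B \<otimes>\<^bsub>?M\<^esub> U)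
      = (\<lambda>i j. if i = j then if i = p then \<one> \<oplus> ?c else \<one> else \<zero>)"
  proof (intro ext)
    fix i j
    have "(\<one>\<^bsub>?M\<^esub> \<oplus>\<^bsub>?M\<^esub> N \<otimes>\<^bsub>?M\<^esub> (B \<otimes>\<^bsub>?M\<^esub> U)) i j
      = (if i = j then \<one> else \<zero>) \<oplus> (N \<otimes>\<^bsub>?M\<^esub> (B \<otimes>\<^bsub>?M\<^esub> U)) i j"
      by (simp add: mring_def)
    also have "\<dots> = (if i = j then if i = p then \<one> \<oplus> ?c else \<one> else \<zero>)"
      unfolding NBU using c by auto
    finally show "(\<one>\<^bsub>?M\<^esub> \<oplus>\<^bsub>?M\<^esub> N \<otimes>\<^bsub>?M\<^esub> (B \<otimes>\<^bsub>?M\<^esub> U)) i j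
      = (if i = j then if i = p then \<one> \<oplus> ?c else \<one> else \<zero>)" .
  qed
  also have "\<dots> \<in> Units ?M \<longleftrightarrow> \<one> \<oplus> ?c \<in> Units R"
    using c by (intro unit_corner_iff) auto
  finally show ?thesis .
qed

end

section \<open>Epic fields and specializations\<close>

text \<open>\<open>b (ab)^-1\<close> is a right inverse of \<open>a\<close> and
  \<open>(ba)^-1 b\<close> a left one, so they agree. The intended \<open>b\<close> is an entrywise
  lift of an inverse matrix, whose products with \<open>a\<close> are units but need not be the
  identity.\<close>

lemma (in monoid) Units_if_mult_Units:
  assumes a: "a \<in> carrier G" and b: "b \<in> carrier G" and ab: "a \<otimes> b \<in> Units G" and ba: "b \<otimes> a \<in> Units G"
  shows "a \<in> Units G"
proof -
  define r where "r = b \<otimes> inv (a \<otimes> b)"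
  define l where "l = inv (b \<otimes> a) \<otimes> b"
  have r: "r \<in> carrier G" and l: "l \<in> carrier G" using assms by (simp_all add: r_def l_def)
  have ar: "a \<otimes> r = \<one>" using a b Units_inv_closed[OF ab] Units_r_inv[OF ab] by (simp add: r_def m_assoc[symmetric])
  have la: "l \<otimes> a = \<one>" using a b Units_inv_closed[OF ba] Units_l_inv[OF ba] by (simp add: l_def m_assoc)
  have "l = r" using inv_unique[OF la ar] a l r by simp
  then show ?thesis using a r ar la unfolding Units_def by auto
qed

lemma matrix_invertible_hom:
  fixes A :: "'n::finite \<Rightarrow> 'n \<Rightarrow> 'a"
  assumes "ring K" "ring L" "h \<in> ring_hom K L" "\<And>i j. A i j \<in> carrier K" "matrix_invertible K A"
  shows "matrix_invertible L (\<lambda>i j. h (A i j))"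
proof -
  interpret h: ring_hom_ring K L h using assms by (intro ring_hom_ringI2)
  obtain B where B: "\<And>i j. B i j \<in> carrier K"
      "\<And>i j. (\<Oplus>\<^bsub>K\<^esub>k\<in>UNIV. A i k \<otimes>\<^bsub>K\<^esub> B k j) = (if i = j then \<one>\<^bsub>K\<^esub> else \<zero>\<^bsub>K\<^esub>)"
      "\<And>i j. (\<Oplus>\<^bsub>K\<^esub>k\<in>UNIV. B i k \<otimes>\<^bsub>K\<^esub> A k j) = (if i = j then \<one>\<^bsub>K\<^esub> else \<zero>\<^bsub>K\<^esub>)"
    using assms(5) unfolding matrix_invertible_def by blast
  have s: "(\<Oplus>\<^bsub>L\<^esub>k\<in>UNIV. h (A' i k) \<otimes>\<^bsub>L\<^esub> h (B' k j)) = h (\<Oplus>\<^bsub>K\<^esub>k\<in>UNIV. A' i k \<otimes>\<^bsub>K\<^esub> B' k j)"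
    if "\<And>i j. A' i j \<in> carrier K" "\<And>i j. B' i j \<in> carrier K" for A' B' :: "'n \<Rightarrow> 'n \<Rightarrow> 'a" and i j
    using that by (subst h.hom_finsum) (auto intro!: h.S.finsum_cong')
  show ?thesis
    unfolding matrix_invertible_def
    using B(1) assms(4) by (intro exI[of _ "\<lambda>i j. h (B i j)"]) (simp add: s B)
qed

text \<open>The rows of the identity are replaced by those of \<open>M\<close> one at a time. Each
  replacement is a rank-one update whose row \<open>?v\<close> is killed by \<open>\<alpha>\<close>,
  so the scalar that decides invertibility is mapped to \<open>1\<close> and is a unit of
  \<open>D\<close>.\<close>

lemma local_matrix_Units:
  fixes M :: "'n::finite \<Rightarrow> 'n \<Rightarrow> 'a"
  assumes "ring D" "ring L" "\<alpha> \<in> ring_hom D L" "\<one>\<^bsub>L\<^esub> \<noteq> \<zero>\<^bsub>L\<^esub>"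
    and units: "\<And>x. x \<in> carrier D \<Longrightarrow> \<alpha> x \<noteq> \<zero>\<^bsub>L\<^esub> \<Longrightarrow> x \<in> Units D"
    and M: "\<And>i j. M i j \<in> carrier D"
    and \<alpha>M: "\<And>i j. \<alpha> (M i j) = (if i = j then \<one>\<^bsub>L\<^esub> else \<zero>\<^bsub>L\<^esub>)"
  shows "M \<in> Units (mring D)"
proof -
  interpret \<alpha>: ring_hom_ring D L \<alpha> using assms by (intro ring_hom_ringI2)
  interpret MD: ring "mring D :: ('n \<Rightarrow> 'n \<Rightarrow> 'a) ring" by (rule \<alpha>.R.ring_mring)
  have "(\<lambda>i j. if i \<in> S then M i j else if i = j then \<one>\<^bsub>D\<^esub> else \<zero>\<^bsub>D\<^esub>) \<in> Units (mring D)" (is "?N S \<in> _")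
    if "finite S" for S
    using that
  proof (induction S rule: finite_induct)
    case empty
    have "\<one>\<^bsub>mring D\<^esub> \<in> Units (mring D :: ('n \<Rightarrow> 'n \<Rightarrow> 'a) ring)" by simp
    then show ?case by (simp add: mring_def)
  next
    case (insert a S)
    let ?u = "\<lambda>i. if i = a then \<one>\<^bsub>D\<^esub> else \<zero>\<^bsub>D\<^esub>"
    let ?v = "\<lambda>j. M a j \<ominus>\<^bsub>D\<^esub> (if a = j then \<one>\<^bsub>D\<^esub> else \<zero>\<^bsub>D\<^esub>)"
    obtain B where B: "B \<in> carrier (mring D)" "?N S \<otimes>\<^bsub>mring D\<^esub> B = \<one>\<^bsub>mring D\<^esub>"
        "B \<otimes>\<^bsub>mring D\<^esub> ?N S = \<one>\<^bsub>mring D\<^esub>"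
      using insert.IH unfolding Units_def by blast
    have Bc: "\<And>i j. B i j \<in> carrier D" using B by (simp add: mring_def)
    have v: "?v j \<in> carrier D" for j using M by simp
    have \<alpha>v: "\<alpha> (?v j) = \<zero>\<^bsub>L\<^esub>" for j
      using M \<alpha>M by (simp add: \<alpha>.R.minus_eq \<alpha>.S.r_neg)
    let ?c = "\<Oplus>\<^bsub>D\<^esub>j\<in>UNIV. ?v j \<otimes>\<^bsub>D\<^esub> (\<Oplus>\<^bsub>D\<^esub>k\<in>UNIV. B j k \<otimes>\<^bsub>D\<^esub> ?u k)"
    have inner: "(\<Oplus>\<^bsub>D\<^esub>k\<in>UNIV. B j k \<otimes>\<^bsub>D\<^esub> ?u k) \<in> carrier D" for j
      using Bc by (auto intro!: \<alpha>.R.finsum_closed)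
    have c: "?c \<in> carrier D"
      using v inner by (auto intro!: \<alpha>.R.finsum_closed simp del: \<alpha>.R.minus_closed)
    have "\<alpha> ?c = (\<Oplus>\<^bsub>L\<^esub>j\<in>UNIV. \<alpha> (?v j \<otimes>\<^bsub>D\<^esub> (\<Oplus>\<^bsub>D\<^esub>k\<in>UNIV. B j k \<otimes>\<^bsub>D\<^esub> ?u k)))"
      using v inner by (subst \<alpha>.hom_finsum) (auto simp: o_def)
    also have "\<dots> = (\<Oplus>\<^bsub>L\<^esub>j\<in>(UNIV::'n set). \<zero>\<^bsub>L\<^esub>)"
      using v inner by (intro \<alpha>.S.finsum_cong') (simp_all only: \<alpha>.hom_mult \<alpha>v, auto)
    also have "\<dots> = \<zero>\<^bsub>L\<^esub>" by simp
    finally have "\<alpha> (\<one>\<^bsub>D\<^esub> \<oplus>\<^bsub>D\<^esub> ?c) = \<one>\<^bsub>L\<^esub>"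
      using c by simp
    then have "\<one>\<^bsub>D\<^esub> \<oplus>\<^bsub>D\<^esub> ?c \<in> Units D"
      using c assms(4) units by simp
    moreover have "?N S \<in> carrier (mring D)" using M by (simp add: mring_def)
    ultimately have "(\<lambda>i j. ?N S i j \<oplus>\<^bsub>D\<^esub> ?u i \<otimes>\<^bsub>D\<^esub> ?v j) \<in> Units (mring D)"
      using B v by (subst \<alpha>.R.rank_one_update[of _ B]) auto
    also have "(\<lambda>i j. ?N S i j \<oplus>\<^bsub>D\<^esub> ?u i \<otimes>\<^bsub>D\<^esub> ?v j) = ?N (insert a S)"
      using M insert.hyps by (auto simp: fun_eq_iff \<alpha>.R.minus_eq \<alpha>.R.a_ac \<alpha>.R.r_neg)
    finally show ?case .
  qed
  from this[of UNIV] show ?thesis by simp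
qed

lemma skew_field_subringI:
  assumes K: "skew_field K" and H: "subring H K" and inv: "\<And>x. x \<in> H \<Longrightarrow> x \<noteq> \<zero>\<^bsub>K\<^esub> \<Longrightarrow> inv\<^bsub>K\<^esub> x \<in> H"
  shows "skew_field (K\<lparr>carrier := H\<rparr>)"
proof -
  interpret ring K using K by (simp add: skew_field_def)
  have Hc: "H \<subseteq> carrier K" using H by (rule subringE)
  have "x \<in> Units (K\<lparr>carrier := H\<rparr>)" if "x \<in> H" "x \<noteq> \<zero>\<^bsub>K\<^esub>" for x
  proof -
    have "x \<in> Units K" using K that Hc by (auto simp: skew_field_def)
    then show ?thesis using inv[OF that] that unfolding Units_def[of "K\<lparr>carrier := H\<rparr>"]
      by (auto intro!: bexI[of _ "inv\<^bsub>K\<^esub> x"])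
  qed
  moreover have "x \<in> H \<and> x \<noteq> \<zero>\<^bsub>K\<^esub>" if "x \<in> Units (K\<lparr>carrier := H\<rparr>)" for x
    using that Hc K by (auto simp: Units_def skew_field_def)
  ultimately show ?thesis
    using K subring_is_ring[OF H] by (auto simp: skew_field_def)
qed

lemma skew_field_subringD:
  assumes K: "skew_field K" and H: "subring H K" and "skew_field (K\<lparr>carrier := H\<rparr>)"
    and x: "x \<in> H" "x \<noteq> \<zero>\<^bsub>K\<^esub>"
  shows "inv\<^bsub>K\<^esub> x \<in> H"
proof -
  interpret ring K using K by (simp add: skew_field_def)
  have Hc: "H \<subseteq> carrier K" using H by (rule subringE)
  have "x \<in> Units (K\<lparr>carrier := H\<rparr>)" using assms by (auto simp: skew_field_def)
  then obtain y where y: "y \<in> H" "y \<otimes>\<^bsub>K\<^esub> x = \<one>\<^bsub>K\<^esub>" "x \<otimes>\<^bsub>K\<^esub> y = \<one>\<^bsub>K\<^esub>" by (auto simp: Units_def)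
  then have "inv\<^bsub>K\<^esub> x = y" using x Hc by (intro inv_char) auto
  then show ?thesis using y by simp
qed

text \<open>Closure under the inverses of \<open>K\<close> is easier to check and to use than the
  skew field property of a record with restricted carrier.\<close>

lemma epic_field_iff:
  "epic_field R K \<phi> \<longleftrightarrow> skew_field K \<and> \<phi> \<in> ring_hom R K \<and>
     (\<forall>H. subring H K \<and> (\<forall>x\<in>H. x \<noteq> \<zero>\<^bsub>K\<^esub> \<longrightarrow> inv\<^bsub>K\<^esub> x \<in> H) \<and> \<phi> ` carrier R \<subseteq> H \<longrightarrow> H = carrier K)"
  unfolding epic_field_def using skew_field_subringI skew_field_subringD by metis

text \<open>The image of \<open>D\<close> under \<open>\<alpha>\<close> contains the image of
  \<open>R\<close> and is closed under inverses, hence is all of \<open>L\<close> because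
  \<open>L\<close> is epic. So the inverse over \<open>L\<close> lifts entrywise to
  \<open>D\<close>; its products with the given matrix reduce to the identity and are units by
  \<open>local_matrix_Units\<close>.\<close>

lemma specializes_invertible:
  fixes A :: "'n::finite \<Rightarrow> 'n \<Rightarrow> 'a"
  assumes F: "skew_field F" and epic: "epic_field R L \<psi>" and spec: "specializes R F \<phi> L \<psi>"
    and A: "\<And>i j. A i j \<in> carrier R" and inv: "matrix_invertible L (\<lambda>i j. \<psi> (A i j))"
  shows "matrix_invertible F (\<lambda>i j. \<phi> (A i j))"
proof -
  obtain D \<alpha> where D: "subring D F" "\<phi> ` carrier R \<subseteq> D" and \<alpha>: "\<alpha> \<in> ring_hom (F\<lparr>carrier := D\<rparr>) L"
    and \<alpha>\<phi>: "\<And>r. r \<in> carrier R \<Longrightarrow> \<alpha> (\<phi> r) = \<psi> r"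
    and units: "\<And>x. x \<in> D \<Longrightarrow> \<alpha> x \<noteq> \<zero>\<^bsub>L\<^esub> \<Longrightarrow> x \<in> Units (F\<lparr>carrier := D\<rparr>)"
    using spec unfolding specializes_def by blast
  have L: "skew_field L" using epic by (simp add: epic_field_def)
  interpret F: ring F using F by (simp add: skew_field_def)
  interpret L: ring L using L by (simp add: skew_field_def)
  let ?D = "F\<lparr>carrier := D\<rparr>"
  interpret D: ring ?D using D(1) by (rule F.subring_is_ring)
  interpret \<alpha>: ring_hom_ring ?D L \<alpha> using \<alpha> by (intro ring_hom_ringI2) unfold_locales
  have onto: "\<alpha> ` D = carrier L"
  proof -
    have "subring (\<alpha> ` carrier ?D) L"
      by (intro \<alpha>.img_is_subring D.carrier_is_subring)
    moreover have "inv\<^bsub>L\<^esub> y \<in> \<alpha> ` D" if y: "y \<in> \<alpha> ` D" "y \<noteq> \<zero>\<^bsub>L\<^esub>" for y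
    proof -
      obtain x where x: "x \<in> D" "y = \<alpha> x" using y by auto
      then have "x \<in> Units ?D" using units y by auto
      then obtain z where z: "z \<in> carrier ?D" "z \<otimes>\<^bsub>?D\<^esub> x = \<one>\<^bsub>?D\<^esub>" "x \<otimes>\<^bsub>?D\<^esub> z = \<one>\<^bsub>?D\<^esub>"
        unfolding Units_def by blast
      have "\<alpha> z \<otimes>\<^bsub>L\<^esub> \<alpha> x = \<one>\<^bsub>L\<^esub>" "\<alpha> x \<otimes>\<^bsub>L\<^esub> \<alpha> z = \<one>\<^bsub>L\<^esub>"
        using x z \<alpha>.hom_mult[of z x] \<alpha>.hom_mult[of x z] \<alpha>.hom_one by simp_all
      then have "inv\<^bsub>L\<^esub> y = \<alpha> z" using x z \<alpha>.hom_closed[of x] \<alpha>.hom_closed[of z]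
        by (intro L.inv_char) auto
      then show ?thesis using z by auto
    qed
    moreover have "\<psi> ` carrier R \<subseteq> \<alpha> ` D"
      using D(2) \<alpha>\<phi> by (force simp: image_iff)
    ultimately show ?thesis using epic unfolding epic_field_iff by auto
  qed
  obtain B where B: "\<And>i j. B i j \<in> carrier L"
      "\<And>i j. (\<Oplus>\<^bsub>L\<^esub>k\<in>UNIV. \<psi> (A i k) \<otimes>\<^bsub>L\<^esub> B k j) = (if i = j then \<one>\<^bsub>L\<^esub> else \<zero>\<^bsub>L\<^esub>)"
      "\<And>i j. (\<Oplus>\<^bsub>L\<^esub>k\<in>UNIV. B i k \<otimes>\<^bsub>L\<^esub> \<psi> (A k j)) = (if i = j then \<one>\<^bsub>L\<^esub> else \<zero>\<^bsub>L\<^esub>)"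
    using inv unfolding matrix_invertible_def by blast
  define B' where "B' = (\<lambda>i j. SOME x. x \<in> D \<and> \<alpha> x = B i j)"
  have B': "B' i j \<in> D" "\<alpha> (B' i j) = B i j" for i j
  proof -
    have "\<exists>x. x \<in> D \<and> \<alpha> x = B i j" using B(1)[of i j] unfolding onto[symmetric] by auto
    from someI_ex[OF this] show "B' i j \<in> D" "\<alpha> (B' i j) = B i j" by (simp_all add: B'_def)
  qed
  let ?A = "\<lambda>i j. \<phi> (A i j)"
  have A': "?A i j \<in> D" for i j using A D by auto
  let ?M = "mring ?D :: ('n \<Rightarrow> 'n \<Rightarrow> 'b) ring"
  interpret M: ring ?M by (rule D.ring_mring)
  have carr: "?A \<in> carrier ?M" "B' \<in> carrier ?M"
    using A' B' by (auto simp: mring_def)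
  have s: "\<alpha> (\<Oplus>\<^bsub>?D\<^esub>k\<in>UNIV. P i k \<otimes>\<^bsub>?D\<^esub> Q k j) = (\<Oplus>\<^bsub>L\<^esub>k\<in>UNIV. \<alpha> (P i k) \<otimes>\<^bsub>L\<^esub> \<alpha> (Q k j))"
    if "\<And>i j. P i j \<in> carrier ?D" "\<And>i j. Q i j \<in> carrier ?D" for P Q :: "'n \<Rightarrow> 'n \<Rightarrow> 'b" and i j
    using that \<alpha>.hom_mult subringE(6)[OF D(1)] by (subst \<alpha>.hom_finsum) (auto intro!: L.finsum_cong' simp del: monoid_record_simps)
  have U: "P \<otimes>\<^bsub>?M\<^esub> Q \<in> Units ?M"
    if "P \<in> carrier ?M" "Q \<in> carrier ?M"
      "\<And>i j. (\<Oplus>\<^bsub>L\<^esub>k\<in>UNIV. \<alpha> (P i k) \<otimes>\<^bsub>L\<^esub> \<alpha> (Q k j)) = (if i = j then \<one>\<^bsub>L\<^esub> else \<zero>\<^bsub>L\<^esub>)" for P Q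
  proof (rule local_matrix_Units[OF D.ring_axioms L.ring_axioms \<alpha>])
    show "\<one>\<^bsub>L\<^esub> \<noteq> \<zero>\<^bsub>L\<^esub>" using L by (simp add: skew_field_def)
    show "x \<in> Units ?D" if "x \<in> carrier ?D" "\<alpha> x \<noteq> \<zero>\<^bsub>L\<^esub>" for x
      using that units by simp
    have "P \<otimes>\<^bsub>?M\<^esub> Q \<in> carrier ?M" using that by (intro M.m_closed)
    then show "(P \<otimes>\<^bsub>?M\<^esub> Q) i j \<in> carrier ?D" for i j by (simp add: mring_def)
    show "\<alpha> ((P \<otimes>\<^bsub>?M\<^esub> Q) i j) = (if i = j then \<one>\<^bsub>L\<^esub> else \<zero>\<^bsub>L\<^esub>)" for i j
      using that s[of P Q i j] unfolding mring_def by simp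
  qed
  have "(\<Oplus>\<^bsub>L\<^esub>k\<in>UNIV. \<alpha> (?A i k) \<otimes>\<^bsub>L\<^esub> \<alpha> (B' k j)) = (if i = j then \<one>\<^bsub>L\<^esub> else \<zero>\<^bsub>L\<^esub>)"
    "(\<Oplus>\<^bsub>L\<^esub>k\<in>UNIV. \<alpha> (B' i k) \<otimes>\<^bsub>L\<^esub> \<alpha> (?A k j)) = (if i = j then \<one>\<^bsub>L\<^esub> else \<zero>\<^bsub>L\<^esub>)" for i j
    unfolding \<alpha>\<phi>[OF A] B'(2) by (fact B)+
  note U[OF carr this(1)] U[OF carr(2,1) this(2)]
  then have "?A \<in> Units ?M" by (rule M.Units_if_mult_Units[OF carr])
  then have "matrix_invertible ?D ?A"
    using A' by (subst D.matrix_invertible_iff_Units) auto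
  moreover have "(\<lambda>x. x) \<in> ring_hom ?D F"
    using subringE(1)[OF D(1)] by (auto simp: ring_hom_def)
  ultimately show ?thesis
    using matrix_invertible_hom[of ?D F "\<lambda>x. x" ?A] A' D.ring_axioms F.ring_axioms by auto
qed

lemma epic_field_iso:
  assumes epic: "epic_field R K \<psi>" and \<eta>: "\<eta> \<in> ring_iso K L" and L: "ring L"
  shows "epic_field R L (\<lambda>x. \<eta> (\<psi> x))"
proof -
  have K: "skew_field K" and \<psi>: "\<psi> \<in> ring_hom R K" using epic by (simp_all add: epic_field_def)
  have hom: "\<eta> \<in> ring_hom K L" and bij: "bij_betw \<eta> (carrier K) (carrier L)"
    using \<eta> by (simp_all add: ring_iso_def)
  interpret K: ring K using K by (simp add: skew_field_def)
  interpret L: ring L by fact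
  interpret \<eta>: ring_hom_ring K L \<eta> using hom by (intro ring_hom_ringI2) unfold_locales
  have inj: "inj_on \<eta> (carrier K)" and onto: "\<eta> ` carrier K = carrier L" using bij by (auto simp: bij_betw_def)
  have eta0: "x = \<zero>\<^bsub>K\<^esub>" if "x \<in> carrier K" "\<eta> x = \<zero>\<^bsub>L\<^esub>" for x
    using inj_onD[OF inj, of x "\<zero>\<^bsub>K\<^esub>"] that by simp
  have inv: "\<eta> (inv\<^bsub>K\<^esub> x) = inv\<^bsub>L\<^esub> (\<eta> x)" "\<eta> x \<in> Units L" "x \<in> Units K" if "x \<in> carrier K" "x \<noteq> \<zero>\<^bsub>K\<^esub>" for x
  proof -
    show x: "x \<in> Units K" using K that by (simp add: skew_field_def)
    have "\<eta> x \<otimes>\<^bsub>L\<^esub> \<eta> (inv\<^bsub>K\<^esub> x) = \<one>\<^bsub>L\<^esub>" "\<eta> (inv\<^bsub>K\<^esub> x) \<otimes>\<^bsub>L\<^esub> \<eta> x = \<one>\<^bsub>L\<^esub>"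
      using x that by (simp_all flip: \<eta>.hom_mult)
    moreover have "\<eta> x \<in> carrier L" "\<eta> (inv\<^bsub>K\<^esub> x) \<in> carrier L"
      using x that by (simp_all add: K.Units_inv_closed)
    ultimately show "\<eta> (inv\<^bsub>K\<^esub> x) = inv\<^bsub>L\<^esub> (\<eta> x)" "\<eta> x \<in> Units L"
      unfolding Units_def[of L] by (auto intro!: L.inv_char[symmetric])
  qed
  have one: "\<one>\<^bsub>L\<^esub> \<noteq> \<zero>\<^bsub>L\<^esub>" using eta0[of "\<one>\<^bsub>K\<^esub>"] K by (auto simp: skew_field_def)
  have sk: "skew_field L"
  proof -
    have "y \<in> Units L" if "y \<in> carrier L" "y \<noteq> \<zero>\<^bsub>L\<^esub>" for y
    proof -
      obtain x where "x \<in> carrier K" "y = \<eta> x" using \<open>y \<in> carrier L\<close> onto by blast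
      then show ?thesis using that inv(2)[of x] by (cases "x = \<zero>\<^bsub>K\<^esub>") auto
    qed
    moreover have "y \<noteq> \<zero>\<^bsub>L\<^esub>" if "y \<in> Units L" for y
      using that one by (auto simp: Units_def)
    ultimately show ?thesis using one L by (auto simp: skew_field_def)
  qed
  have "H = carrier L"
    if H: "subring H L" "\<forall>x\<in>H. x \<noteq> \<zero>\<^bsub>L\<^esub> \<longrightarrow> inv\<^bsub>L\<^esub> x \<in> H" "(\<lambda>x. \<eta> (\<psi> x)) ` carrier R \<subseteq> H" for H
  proof -
    note HE = subringE[OF H(1)]
    let ?H = "{x \<in> carrier K. \<eta> x \<in> H}"
    have "subring ?H K"
      using HE by (intro K.subringI) auto
    moreover have "\<forall>x\<in>?H. x \<noteq> \<zero>\<^bsub>K\<^esub> \<longrightarrow> inv\<^bsub>K\<^esub> x \<in> ?H"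
      using inv H(2) eta0 by auto
    moreover have "\<psi> ` carrier R \<subseteq> ?H"
      using H(3) \<psi> by (auto simp: ring_hom_def)
    ultimately have "?H = carrier K" using epic unfolding epic_field_iff by blast
    then have "\<eta> ` carrier K \<subseteq> H" by blast
    then show ?thesis using onto HE(1) by auto
  qed
  moreover have "(\<lambda>x. \<eta> (\<psi> x)) \<in> ring_hom R L"
    using ring_hom_trans[OF \<psi> hom] by (simp add: o_def)
  ultimately show ?thesis using sk unfolding epic_field_iff by blast
qed

text \<open>
  The universal property only mentions fields on the element type of the ring, so epic fields of other
  types have to be copied there.
\<close>

lemma epic_field_embedding:
  includes cardinal_syntax
  assumes epic: "epic_field (R :: ('a, 'c) ring_scheme) K \<psi>" and inf: "infinite (UNIV :: 'a set)"
  shows "\<exists>h :: 'k \<Rightarrow> 'a. inj_on h (carrier K)"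
proof -
  have K: "skew_field K" and \<psi>: "\<psi> \<in> ring_hom R K" using epic by (simp_all add: epic_field_def)
  interpret K: ring K using K by (simp add: skew_field_def)
  \<comment> \<open>\<open>K\<close> is exhausted by iterating the field operations on the image of
    \<open>R\<close>. As the element type of \<open>R\<close> is infinite, every stage and the
    countable union embed into it. Zero is left out under \<open>inv\<close> since its inverse is
    unspecified and might lie outside the carrier.\<close>
  define step where "step X = X \<union> (\<lambda>(x, y). x \<oplus>\<^bsub>K\<^esub> y) ` (X \<times> X) \<union> (\<lambda>(x, y). x \<otimes>\<^bsub>K\<^esub> y) ` (X \<times> X) \<union>
      (\<lambda>x. \<ominus>\<^bsub>K\<^esub> x) ` X \<union> (\<lambda>x. inv\<^bsub>K\<^esub> x) ` (X - {\<zero>\<^bsub>K\<^esub>})" for X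
  define X where "X n = (step ^^ n) (insert \<one>\<^bsub>K\<^esub> (\<psi> ` carrier R))" for n
  have X_Suc: "X (Suc n) = step (X n)" for n by (simp add: X_def)
  have mono: "X m \<subseteq> X n" if "m \<le> n" for m n
    using that by (rule lift_Suc_mono_le[rotated]) (auto simp: X_Suc step_def)
  have carr: "X n \<subseteq> carrier K" for n
  proof (induction n)
    case 0
    then show ?case using \<psi> by (auto simp: X_def ring_hom_def)
  next
    case (Suc n)
    have "inv\<^bsub>K\<^esub> x \<in> carrier K" if "x \<in> X n" "x \<noteq> \<zero>\<^bsub>K\<^esub>" for x
      using K that Suc by (intro K.Units_inv_closed) (auto simp: skew_field_def)
    then show ?case using Suc by (auto simp: X_Suc step_def)
  qed
  let ?H = "\<Union>n. X n"
  have common: "\<exists>n. x \<in> X n \<and> y \<in> X n" if "x \<in> ?H" "y \<in> ?H" for x y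
  proof -
    obtain m n where "x \<in> X m" "y \<in> X n" using \<open>x \<in> ?H\<close> \<open>y \<in> ?H\<close> by auto
    then show ?thesis using mono[of m "max m n"] mono[of n "max m n"] by (intro exI[of _ "max m n"]) auto
  qed
  have "subring ?H K"
  proof (rule K.subringI)
    show "?H \<subseteq> carrier K" using carr by auto
    show "\<one>\<^bsub>K\<^esub> \<in> ?H" by (auto simp: X_def intro!: exI[of _ 0])
    show "\<ominus>\<^bsub>K\<^esub> x \<in> ?H" if "x \<in> ?H" for x
    proof -
      obtain n where "x \<in> X n" using \<open>x \<in> ?H\<close> by auto
      then have "\<ominus>\<^bsub>K\<^esub> x \<in> X (Suc n)" by (auto simp: X_Suc step_def)
      then show ?thesis by blast
    qed
    fix x y assume "x \<in> ?H" "y \<in> ?H"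
    then obtain n where "x \<in> X n" "y \<in> X n" using common by blast
    then have "x \<otimes>\<^bsub>K\<^esub> y \<in> X (Suc n)" "x \<oplus>\<^bsub>K\<^esub> y \<in> X (Suc n)" by (force simp: X_Suc step_def)+
    then show "x \<otimes>\<^bsub>K\<^esub> y \<in> ?H" "x \<oplus>\<^bsub>K\<^esub> y \<in> ?H" by blast+
  qed
  moreover have "inv\<^bsub>K\<^esub> x \<in> ?H" if "x \<in> ?H" "x \<noteq> \<zero>\<^bsub>K\<^esub>" for x
  proof -
    obtain n where "x \<in> X n" using \<open>x \<in> ?H\<close> by auto
    then have "inv\<^bsub>K\<^esub> x \<in> X (Suc n)" using that by (auto simp: X_Suc step_def)
    then show ?thesis by blast
  qed
  moreover have "\<psi> ` carrier R \<subseteq> ?H"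
  proof -
    have "\<psi> ` carrier R \<subseteq> X 0" by (auto simp: X_def)
    then show ?thesis by blast
  qed
  ultimately have H: "?H = carrier K" using epic unfolding epic_field_iff by blast
  let ?U = "UNIV :: 'a set"
  have Un: "|A \<union> B| \<le>o |?U|" if "|A| \<le>o |?U|" "|B| \<le>o |?U|" for A B :: "'k set"
    using inf that
    by (intro card_of_Un_ordLeq_infinite_Field) (simp_all add: Field_card_of card_of_card_order_on)
  have sq: "|f ` (A \<times> A)| \<le>o |?U|" if "|A| \<le>o |?U|" for A :: "'k set" and f :: "'k \<times> 'k \<Rightarrow> 'k"
    using inf that
    by (intro ordLeq_transitive[OF card_of_image] card_of_Times_ordLeq_infinite_Field)
      (simp_all add: Field_card_of card_of_card_order_on)
  have im: "|f ` A| \<le>o |?U|" if "|A| \<le>o |?U|" for A :: "'k set" and f :: "'k \<Rightarrow> 'k"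
    using card_of_image that by (rule ordLeq_transitive)
  have "|X n| \<le>o |?U|" for n
  proof (induction n)
    case 0
    have "|\<psi> ` carrier R| \<le>o |?U|"
      using card_of_image card_of_mono1[OF subset_UNIV] by (rule ordLeq_transitive)
    moreover have "|{\<one>\<^bsub>K\<^esub>}| \<le>o |?U|"
      using inf by (simp add: card_of_singl_ordLeq)
    ultimately have "|{\<one>\<^bsub>K\<^esub>} \<union> \<psi> ` carrier R| \<le>o |?U|" by (rule Un[rotated])
    then show ?case by (simp add: X_def)
  next
    case (Suc n)
    have "|X n - {\<zero>\<^bsub>K\<^esub>}| \<le>o |?U|"
      using card_of_mono1[OF Diff_subset] Suc by (rule ordLeq_transitive)
    then show ?case unfolding X_Suc step_def by (intro Un sq im Suc)
  qed
  moreover have "|UNIV :: nat set| \<le>o |?U|" using inf by (simp add: infinite_iff_card_of_nat)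
  ultimately have "|?H| \<le>o |?U|" using inf by (intro card_of_UNION_ordLeq_infinite) auto
  then show ?thesis unfolding H using card_of_ordLeq[of "carrier K" ?U] by auto
qed

lemma universal_specializes:
  fixes R :: "'a ring" and K :: "'k ring"
  assumes univ: "universal_field_of_fractions R F \<phi>" and epic: "epic_field R K \<psi>"
    and inf: "infinite (UNIV :: 'a set)"
    and A: "\<And>i j. A i j \<in> carrier R" and inv: "matrix_invertible K (\<lambda>i j. \<psi> (A i j))"
  shows "matrix_invertible F (\<lambda>i j. \<phi> (A i j))"
proof -
  obtain h :: "'k \<Rightarrow> 'a" where h: "inj_on h (carrier K)" using epic_field_embedding[OF epic inf] by blast
  have K: "ring K" "\<psi> \<in> ring_hom R K" using epic by (auto simp: epic_field_def skew_field_def)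
  interpret K: ring K by fact
  let ?L = "image_ring h K"
  have L: "ring ?L" using h by (rule K.inj_imp_image_ring_is_ring)
  have iso: "h \<in> ring_iso K ?L" using h by (rule inj_imp_image_ring_iso)
  have epicL: "epic_field R ?L (\<lambda>x. h (\<psi> x))" by (rule epic_field_iso[OF epic iso L])
  have sk: "skew_field F"
    using univ by (simp add: universal_field_of_fractions_def epic_field_def)
  have "\<forall>(L :: 'a ring) \<psi>. epic_field R L \<psi> \<longrightarrow> specializes R F \<phi> L \<psi>"
    using univ by (simp add: universal_field_of_fractions_def)
  then have spec: "specializes R F \<phi> ?L (\<lambda>x. h (\<psi> x))"
    using epicL by simp
  have "matrix_invertible ?L (\<lambda>i j. h (\<psi> (A i j)))"
  proof (rule matrix_invertible_hom[OF K(1) L _ _ inv])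
    show "h \<in> ring_hom K ?L" using iso by (simp add: ring_iso_def)
    show "\<psi> (A i j) \<in> carrier K" for i j using A K by (simp add: ring_hom_closed)
  qed
  then show ?thesis
    by (rule specializes_invertible[where A = A, OF sk epicL spec A])
qed

section \<open>Opposite rings and transposed matrices\<close>

definition opposite_ring :: "'a ring \<Rightarrow> 'a ring" where
  "opposite_ring K = K\<lparr>mult := (\<lambda>x y. y \<otimes>\<^bsub>K\<^esub> x)\<rparr>"

lemma opposite_ring_simps [simp]:
  "carrier (opposite_ring K) = carrier K" "\<one>\<^bsub>opposite_ring K\<^esub> = \<one>\<^bsub>K\<^esub>" "\<zero>\<^bsub>opposite_ring K\<^esub> = \<zero>\<^bsub>K\<^esub>"
  "(\<oplus>\<^bsub>opposite_ring K\<^esub>) = (\<oplus>\<^bsub>K\<^esub>)" "x \<otimes>\<^bsub>opposite_ring K\<^esub> y = y \<otimes>\<^bsub>K\<^esub> x"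
  "add_monoid (opposite_ring K) = add_monoid K" "finsum (opposite_ring K) = finsum K"
  "a_inv (opposite_ring K) = a_inv K"
  "inv\<^bsub>opposite_ring K\<^esub> x = inv\<^bsub>K\<^esub> x" "Units (opposite_ring K) = Units K"
  by (auto simp: opposite_ring_def finsum_def a_inv_def m_inv_def Units_def fun_eq_iff conj_commute)

lemma ring_opposite_ring:
  assumes "ring K" shows "ring (opposite_ring K)"
proof -
  interpret ring K by fact
  show ?thesis
  proof (rule ringI)
    show "abelian_group (opposite_ring K)"
      using abelian_group_axioms unfolding abelian_group_def abelian_monoid_def abelian_group_axioms_def by simp
    show "Group.monoid (opposite_ring K)" by (rule monoidI) (auto simp: m_assoc)
  qed (auto simp: l_distr r_distr)
qed

text \<open>A ring and its opposite have the same subrings and the same inverses, and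
  \<open>\<rho>\<close> maps the carrier of \<open>R\<close> onto itself, so the subfield generated
  by the image does not change.\<close>

lemma epic_field_opposite:
  assumes epic: "epic_field R K \<psi>" and \<rho>: "\<rho> ` carrier R = carrier R"
    and hom: "(\<lambda>x. \<psi> (\<rho> x)) \<in> ring_hom R (opposite_ring K)"
  shows "epic_field R (opposite_ring K) (\<lambda>x. \<psi> (\<rho> x))"
proof -
  have K: "skew_field K" using epic by (simp add: epic_field_def)
  interpret K: ring K using K by (simp add: skew_field_def)
  interpret O: ring "opposite_ring K" by (rule ring_opposite_ring[OF K.ring_axioms])
  have "skew_field (opposite_ring K)"
    using K O.ring_axioms by (simp add: skew_field_def)
  moreover have "subring H K" if "subring H (opposite_ring K)" for H
    using subringE[OF that] by (intro K.subringI) auto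
  moreover have "(\<lambda>x. \<psi> (\<rho> x)) ` carrier R = \<psi> ` carrier R"
    using \<rho> by (metis image_image)
  ultimately show ?thesis using epic hom unfolding epic_field_iff by simp
qed

text \<open>Over a noncommutative ring the transpose of an invertible matrix can be singular.
  Transposition reverses matrix products only if the entries are multiplied in reverse order as
  well, hence the opposite ring.\<close>

lemma matrix_invertible_opposite:
  assumes "matrix_invertible K (\<lambda>i j. A j i)"
  shows "matrix_invertible (opposite_ring K) A"
proof -
  obtain B where B: "\<And>i j. B i j \<in> carrier K"
      "\<And>i j. (\<Oplus>\<^bsub>K\<^esub>k\<in>UNIV. A k i \<otimes>\<^bsub>K\<^esub> B k j) = (if i = j then \<one>\<^bsub>K\<^esub> else \<zero>\<^bsub>K\<^esub>)"
      "\<And>i j. (\<Oplus>\<^bsub>K\<^esub>k\<in>UNIV. B i k \<otimes>\<^bsub>K\<^esub> A j k) = (if i = j then \<one>\<^bsub>K\<^esub> else \<zero>\<^bsub>K\<^esub>)"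
    using assms unfolding matrix_invertible_def by blast
  show ?thesis unfolding matrix_invertible_def
    using B by (intro exI[of _ "\<lambda>i j. B j i"]) auto
qed

section \<open>Homomorphisms out of the free algebra\<close>

lemma free_algebra_simps [simp]:
  "f \<in> carrier free_algebra \<longleftrightarrow> finite {w. f w \<noteq> 0}"
  "\<one>\<^bsub>free_algebra\<^esub> = fa_const 1" "\<zero>\<^bsub>free_algebra\<^esub> = (\<lambda>w. 0)"
  "f \<oplus>\<^bsub>free_algebra\<^esub> g = (\<lambda>w. f w + g w)"
  by (simp_all add: free_algebra_def fa_const_def)

lemma free_algebra_mult:
  "f \<otimes>\<^bsub>free_algebra\<^esub> g = (\<lambda>w. \<Sum>(u, v)\<in>{(u, v). u @ v = w}. f u * g v)"
  by (simp add: free_algebra_def)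

lemma fa_const_closed [simp]: "finite {w. fa_const c w \<noteq> 0}"
  by (rule finite_subset[of _ "{[]}"]) (auto simp: fa_const_def)

lemma mult_fa_const:
  fixes f :: "'m list \<Rightarrow> complex"
  shows "f \<otimes>\<^bsub>free_algebra\<^esub> fa_const c = (\<lambda>w. f w * c)"
proof
  fix w
  have "(f \<otimes>\<^bsub>free_algebra\<^esub> fa_const c) w = (\<Sum>(u, v)\<in>{(w, [] :: 'm list)}. f u * c)"
    unfolding free_algebra_mult fa_const_def
    by (rule sum.mono_neutral_cong_right) (auto simp: finite_splits split: if_splits)
  then show "(f \<otimes>\<^bsub>free_algebra\<^esub> fa_const c) w = f w * c" by simp
qed

lemma fa_const_mult:
  fixes f :: "'m list \<Rightarrow> complex"
  shows "fa_const c \<otimes>\<^bsub>free_algebra\<^esub> f = (\<lambda>w. c * f w)"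
proof
  fix w
  have "(fa_const c \<otimes>\<^bsub>free_algebra\<^esub> f) w = (\<Sum>(u, v)\<in>{([] :: 'm list, w)}. c * f v)"
    unfolding free_algebra_mult fa_const_def
    by (rule sum.mono_neutral_cong_right) (auto simp: finite_splits split: if_splits)
  then show "(fa_const c \<otimes>\<^bsub>free_algebra\<^esub> f) w = c * f w" by simp
qed

lemma finsum_free_algebra:
  assumes "finite A" "\<And>a. a \<in> A \<Longrightarrow> finite {w. f a w \<noteq> 0}"
  shows "(\<Oplus>\<^bsub>free_algebra\<^esub>a\<in>A. f a) w = (\<Sum>a\<in>A. f a w)"
proof -
  interpret R: ring free_algebra by (rule ring_free_algebra)
  show ?thesis using assms
  proof (induction A rule: finite_induct)
    case (insert a A)
    then have "(\<Oplus>\<^bsub>free_algebra\<^esub>a\<in>insert a A. f a) = f a \<oplus>\<^bsub>free_algebra\<^esub> (\<Oplus>\<^bsub>free_algebra\<^esub>a\<in>A. f a)"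
      by (intro R.finsum_insert) auto
    then show ?case using insert by simp
  qed simp
qed

lemma finite_words [simp]: "finite {w :: 'm::finite list. length w = n}"
  using finite_lists_length_eq[of "UNIV :: 'm set" n] by simp

lemma pencil_apply:
  fixes X :: "complex^'n^'n^'m"
  shows "pencil X i j w = (if length w = 1 then X $ hd w $ i $ j else 0)"
proof -
  have *: "fa_var k \<otimes>\<^bsub>free_algebra\<^esub> fa_const c = (\<lambda>w. if w = [k] then c else 0)" for k :: 'm and c
    by (auto simp: mult_fa_const fa_var_def)
  have "finite {w. (if w = [k] then c else 0) \<noteq> (0::complex)}" for k :: 'm and c
    by (rule finite_subset[of _ "{[k]}"]) auto
  then have "pencil X i j w = (\<Sum>k\<in>UNIV. if w = [k] then X $ k $ i $ j else 0)"
    unfolding pencil_def * by (subst finsum_free_algebra) auto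
  also have "\<dots> = (\<Sum>k\<in>UNIV. if k = hd w then if length w = 1 then X $ hd w $ i $ j else 0 else 0)"
    by (rule sum.cong) (auto simp: length_Suc_conv)
  finally show ?thesis by simp
qed

lemma pencil_closed [simp]: "finite {w. pencil X i j w \<noteq> 0}"
  by (rule finite_subset[OF _ finite_words[of 1]]) (auto simp: pencil_apply split: if_splits)

section \<open>Linear substitutions of the indeterminates\<close>

fun word_weight :: "complex^'m^'m \<Rightarrow> 'm list \<Rightarrow> 'm list \<Rightarrow> complex" where
  "word_weight P (i # w) (j # v) = P $ i $ j * word_weight P w v"
| "word_weight P _ _ = 1"

text \<open>The endomorphism that replaces \<open>t_l\<close> by the sum of all
  \<open>P_kl t_k\<close>, written on coefficients: in degree \<open>n\<close> it is the
  \<open>n\<close>-th tensor power of \<open>P\<close>, whose entries are given by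
  \<open>word_weight\<close>. The default value \<open>1\<close> of \<open>word_weight\<close> is
  the empty product for two empty words; pairs of different lengths do not occur in the sum.\<close>

definition fa_subst :: "complex^'m^'m \<Rightarrow> ('m::finite list \<Rightarrow> complex) \<Rightarrow> 'm list \<Rightarrow> complex" where
  "fa_subst P f w = (\<Sum>v | length v = length w. word_weight P w v * f v)"

lemma word_weight_append:
  "length w = length v \<Longrightarrow> word_weight P (w @ w') (v @ v') = word_weight P w v * word_weight P w' v'"
  by (induction w v rule: list_induct2) auto

lemma fa_subst_mult:
  "fa_subst P (f \<otimes>\<^bsub>free_algebra\<^esub> g) = fa_subst P f \<otimes>\<^bsub>free_algebra\<^esub> fa_subst P g"
proof
  fix w
  have "fa_subst P (f \<otimes>\<^bsub>free_algebra\<^esub> g) w =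
      (\<Sum>(v, p)\<in>(SIGMA v:{v. length v = length w}. {(a, b). a @ b = v}). word_weight P w v * (f (fst p) * g (snd p)))"
    unfolding fa_subst_def free_algebra_mult
    by (subst sum.Sigma[symmetric]) (auto simp: finite_splits[unfolded case_prod_unfold] sum_distrib_left case_prod_unfold)
  also have "\<dots> = (\<Sum>(q, p)\<in>(SIGMA q:{(x, y). x @ y = w}. {a. length a = length (fst q)} \<times> {b. length b = length (snd q)}).
      word_weight P (fst q) (fst p) * f (fst p) * (word_weight P (snd q) (snd p) * g (snd p)))"
    \<comment> \<open>A factorization of \<open>v\<close> as \<open>a @ b\<close> cuts
      \<open>w\<close> at position \<open>length a\<close>, and the weight splits along this
      cut.\<close>
    by (rule sum.reindex_bij_witness
          [where j = "\<lambda>(v, (a, b)). ((take (length a) w, drop (length a) w), (a, b))"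
             and i = "\<lambda>((x, y), (a, b)). (a @ b, (a, b))"])
      (auto simp flip: word_weight_append simp: word_weight_append)
  also have "\<dots> = (fa_subst P f \<otimes>\<^bsub>free_algebra\<^esub> fa_subst P g) w"
    unfolding fa_subst_def free_algebra_mult
    by (subst sum.Sigma[symmetric])
      (auto simp: finite_splits[unfolded case_prod_unfold] sum_product sum.cartesian_product case_prod_unfold)
  finally show "fa_subst P (f \<otimes>\<^bsub>free_algebra\<^esub> g) w = (fa_subst P f \<otimes>\<^bsub>free_algebra\<^esub> fa_subst P g) w" .
qed

lemma finite_support_bounded:
  fixes f :: "'m::finite list \<Rightarrow> complex"
  assumes "\<And>w. length w > n \<Longrightarrow> f w = 0"
  shows "finite {w. f w \<noteq> 0}"
proof (rule finite_subset)
  show "{w. f w \<noteq> 0} \<subseteq> {w. set w \<subseteq> UNIV \<and> length w \<le> n}" using assms by (auto simp: not_less[symmetric])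
  show "finite {w. set w \<subseteq> (UNIV :: 'm set) \<and> length w \<le> n}" by (rule finite_lists_length_le) simp
qed

lemma fa_subst_closed:
  fixes f :: "'m::finite list \<Rightarrow> complex"
  assumes "finite {w. f w \<noteq> 0}"
  shows "finite {w. fa_subst P f w \<noteq> 0}"
proof -
  obtain n where n: "\<And>w. f w \<noteq> 0 \<Longrightarrow> length w \<le> n"
    using finite_imageI[OF assms, of length] by (auto simp: finite_nat_set_iff_bounded_le)
  show ?thesis
  proof (rule finite_support_bounded)
    show "fa_subst P f w = 0" if "n < length w" for w
      using n that unfolding fa_subst_def by (intro sum.neutral) fastforce
  qed
qed

lemma fa_subst_const: "fa_subst P (fa_const c) = fa_const c"
  by (rule ext) (auto simp: fa_subst_def fa_const_def intro!: sum.neutral)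

lemma fa_subst_hom: "fa_subst P \<in> ring_hom free_algebra (free_algebra :: ('m::finite list \<Rightarrow> complex) ring)"
proof (rule ring_hom_memI)
  show "fa_subst P (f \<oplus>\<^bsub>free_algebra\<^esub> g) = fa_subst P f \<oplus>\<^bsub>free_algebra\<^esub> fa_subst P g" for f g
    by (auto simp: fa_subst_def distrib_left sum.distrib)
qed (auto simp: fa_subst_closed fa_subst_mult fa_subst_const)

lemma sum_words_Suc:
  "(\<Sum>v | length v = Suc n. h v) = (\<Sum>i\<in>(UNIV::'m::finite set). \<Sum>v | length v = n. h (i # v))"
proof -
  have "(\<Sum>v | length v = Suc n. h v) = (\<Sum>(i, v)\<in>UNIV \<times> {v. length v = n}. h (i # v))"
    by (rule sum.reindex_bij_witness[where j = "\<lambda>v. (hd v, tl v)" and i = "\<lambda>(i, v). i # v"])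
      (auto simp: length_Suc_conv)
  then show ?thesis by (simp add: sum.cartesian_product)
qed

text \<open>Functoriality of tensor powers. Together with \<open>word_weight_mat\<close> it turns
  invertible matrices into automorphisms of the free algebra.\<close>

lemma word_weight_matrix_mult:
  "length w = length u \<Longrightarrow>
    (\<Sum>v | length v = length w. word_weight P w v * word_weight Q v u) = word_weight (P ** Q) w u"
proof (induction w u rule: list_induct2)
  case (Cons i w k u)
  have "(\<Sum>v | length v = length (i # w). word_weight P (i # w) v * word_weight Q v (k # u)) =
      (\<Sum>j\<in>UNIV. \<Sum>v | length v = length w. (P $ i $ j * Q $ j $ k) * (word_weight P w v * word_weight Q v u))"
    unfolding length_Cons sum_words_Suc by (simp add: mult_ac)
  also have "\<dots> = word_weight (P ** Q) (i # w) (k # u)"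
    by (simp add: Cons.IH matrix_matrix_mult_def flip: sum_distrib_left sum_distrib_right)
  finally show ?case .
qed simp

lemma fa_subst_compose: "fa_subst P (fa_subst Q f) = fa_subst (P ** Q) f"
proof
  fix w
  have "fa_subst P (fa_subst Q f) w =
     (\<Sum>v | length v = length w. \<Sum>u | length u = length w. word_weight P w v * word_weight Q v u * f u)"
    by (auto simp: fa_subst_def sum_distrib_left mult_ac intro!: sum.cong)
  also have "\<dots> = (\<Sum>u | length u = length w. (\<Sum>v | length v = length w. word_weight P w v * word_weight Q v u) * f u)"
    by (subst sum.swap) (simp add: sum_distrib_right)
  also have "\<dots> = fa_subst (P ** Q) f w"
    unfolding fa_subst_def by (intro sum.cong) (auto simp: word_weight_matrix_mult)
  finally show "fa_subst P (fa_subst Q f) w = fa_subst (P ** Q) f w" .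
qed

lemma word_weight_mat: "length w = length v \<Longrightarrow> word_weight (mat 1) w v = (if w = v then 1 else 0)"
  by (induction w v rule: list_induct2) (auto simp: mat_def)

lemma fa_subst_mat: "fa_subst (mat 1) f = f"
proof
  fix w
  have "fa_subst (mat 1) f w = (\<Sum>v | length v = length w. if v = w then f w else 0)"
    unfolding fa_subst_def by (intro sum.cong) (auto simp: word_weight_mat)
  then show "fa_subst (mat 1) f w = f w" by simp
qed

text \<open>Regrouping \<open>sum_l (sum_k P_kl t_k) X_l\<close> by \<open>t_k\<close> moves the
  substitution from the indeterminates to the matrices.\<close>

lemma fa_subst_pencil:
  "fa_subst P (pencil X i j) = pencil (\<chi> k. \<Sum>l\<in>UNIV. mscale (P $ k $ l) (X $ l)) i j"
proof
  fix w
  show "fa_subst P (pencil X i j) w = pencil (\<chi> k. \<Sum>l\<in>UNIV. mscale (P $ k $ l) (X $ l)) i j w"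
  proof (cases "length w = 1")
    case True
    then obtain k where w: "w = [k]" by (auto simp: length_Suc_conv)
    have "fa_subst P (pencil X i j) w = (\<Sum>l\<in>UNIV. P $ k $ l * X $ l $ i $ j)"
      by (simp add: fa_subst_def w sum_words_Suc pencil_apply)
    then show ?thesis by (simp add: pencil_apply w mscale_def)
  qed (auto simp: fa_subst_def pencil_apply intro!: sum.neutral)
qed

section \<open>Evaluation at complex points\<close>

definition fa_eval :: "('m \<Rightarrow> complex) \<Rightarrow> ('m list \<Rightarrow> complex) \<Rightarrow> complex" where
  "fa_eval c f = (\<Sum>w | f w \<noteq> 0. f w * prod_list (map c w))"

lemma fa_eval_eq:
  assumes "finite W" "{w. f w \<noteq> 0} \<subseteq> W"
  shows "fa_eval c f = (\<Sum>w\<in>W. f w * prod_list (map c w))"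
  unfolding fa_eval_def using assms by (intro sum.mono_neutral_left) auto

text \<open>Both sides are sums over the pairs of words in the two supports; on the left they are
  grouped by their concatenation.\<close>

lemma fa_eval_mult:
  fixes f g :: "'m list \<Rightarrow> complex"
  assumes f: "finite {w. f w \<noteq> 0}" and g: "finite {w. g w \<noteq> 0}"
  shows "fa_eval c (f \<otimes>\<^bsub>free_algebra\<^esub> g) = fa_eval c f * fa_eval c g"
proof -
  let ?A = "{w. f w \<noteq> 0} \<times> {w. g w \<noteq> 0}" and ?a = "\<lambda>p. fst p @ snd p :: 'm list"
  let ?h = "\<lambda>p. f (fst p) * g (snd p)"
  have A: "finite ?A" using f g by simp
  have prod: "(f \<otimes>\<^bsub>free_algebra\<^esub> g) w = (\<Sum>p | p \<in> ?A \<and> ?a p = w. ?h p)" for w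
    unfolding free_algebra_mult case_prod_unfold
    using finite_splits[of w] by (intro sum.mono_neutral_right) (auto simp: case_prod_unfold)
  have "(f \<otimes>\<^bsub>free_algebra\<^esub> g) w = 0" if "w \<notin> ?a ` ?A" for w
  proof -
    have "{p. p \<in> ?A \<and> ?a p = w} = {}" using that by blast
    then show ?thesis unfolding prod by (metis sum.empty)
  qed
  then have "fa_eval c (f \<otimes>\<^bsub>free_algebra\<^esub> g) =
      (\<Sum>w\<in>?a ` ?A. (f \<otimes>\<^bsub>free_algebra\<^esub> g) w * prod_list (map c w))"
    using A by (intro fa_eval_eq) auto
  also have "\<dots> = (\<Sum>w\<in>?a ` ?A. \<Sum>p | p \<in> ?A \<and> ?a p = w. ?h p * prod_list (map c (?a p)))"
    unfolding prod sum_distrib_right by (intro sum.cong) auto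
  also have "\<dots> = (\<Sum>p\<in>?A. ?h p * prod_list (map c (?a p)))"
    using A by (rule sum.image_gen[symmetric])
  also have "\<dots> = fa_eval c f * fa_eval c g"
    unfolding fa_eval_def sum_product sum.cartesian_product by (simp add: case_prod_unfold mult_ac)
  finally show ?thesis .
qed

lemma fa_eval_add:
  assumes f: "finite {w. f w \<noteq> 0}" and g: "finite {w. g w \<noteq> 0}"
  shows "fa_eval c (\<lambda>w. f w + g w) = fa_eval c f + fa_eval c g"
proof -
  let ?W = "{w. f w \<noteq> 0} \<union> {w. g w \<noteq> 0}"
  have "finite ?W" using f g by simp
  then have "fa_eval c h = (\<Sum>w\<in>?W. h w * prod_list (map c w))" if "{w. h w \<noteq> 0} \<subseteq> ?W" for h
    using that by (rule fa_eval_eq)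
  moreover have "{w. f w + g w \<noteq> 0} \<subseteq> ?W" "{w. f w \<noteq> 0} \<subseteq> ?W" "{w. g w \<noteq> 0} \<subseteq> ?W" by auto
  ultimately show ?thesis by (simp add: distrib_right sum.distrib)
qed

lemma fa_eval_const: "fa_eval c (fa_const x) = x"
proof -
  have "fa_eval c (fa_const x) = (\<Sum>w\<in>{[]}. fa_const x w * prod_list (map c w))"
    by (rule fa_eval_eq) (auto simp: fa_const_def)
  then show ?thesis by (simp add: fa_const_def)
qed

definition complex_ring :: "complex ring" where
  "complex_ring = \<lparr>carrier = UNIV, mult = (*), one = 1, zero = 0, add = (+)\<rparr>"

lemma complex_ring_simps [simp]:
  "carrier complex_ring = UNIV" "x \<otimes>\<^bsub>complex_ring\<^esub> y = x * y" "\<one>\<^bsub>complex_ring\<^esub> = 1"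
  "\<zero>\<^bsub>complex_ring\<^esub> = 0" "x \<oplus>\<^bsub>complex_ring\<^esub> y = x + y"
  by (simp_all add: complex_ring_def)

lemma ring_complex_ring: "ring complex_ring"
proof (rule ringI)
  show "abelian_group complex_ring"
    by (rule abelian_groupI) (auto simp: algebra_simps intro: exI[of _ "- x" for x])
  show "Group.monoid complex_ring" by (rule monoidI) auto
qed (auto simp: algebra_simps)

lemma finsum_complex_ring: "finite A \<Longrightarrow> (\<Oplus>\<^bsub>complex_ring\<^esub>a\<in>A. f a) = (\<Sum>a\<in>A. f a)"
proof (induction A rule: finite_induct)
  case (insert a A)
  interpret ring complex_ring by (rule ring_complex_ring)
  show ?case using insert by (subst finsum_insert) auto
next
  case empty
  interpret ring complex_ring by (rule ring_complex_ring)
  show ?case by simp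
qed

lemma skew_field_complex_ring: "skew_field complex_ring"
proof -
  have "x \<in> Units complex_ring" if "x \<noteq> 0" for x
    using that by (auto simp: Units_def intro!: exI[of _ "inverse x"])
  then show ?thesis using ring_complex_ring by (auto simp: skew_field_def Units_def)
qed

text \<open>The constants already reach every complex number. Through these epic fields, one
  invertible complex matrix certifies that a pencil is invertible over the free field.\<close>

lemma epic_field_fa_eval: "epic_field (free_algebra :: ('m list \<Rightarrow> complex) ring) complex_ring (fa_eval c)"
proof -
  have "fa_eval c \<in> ring_hom free_algebra complex_ring"
    by (rule ring_hom_memI) (auto simp: fa_eval_mult fa_eval_add fa_eval_const)
  moreover have "x \<in> fa_eval c ` carrier free_algebra" for x
    using imageI[of "fa_const x" "carrier free_algebra" "fa_eval c"] by (simp add: fa_eval_const)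
  ultimately show ?thesis
    using skew_field_complex_ring unfolding epic_field_def complex_ring_simps by blast
qed

lemma matrix_invertible_complex_ring:
  fixes A :: "complex^'n::finite^'n"
  assumes "invertible A"
  shows "matrix_invertible complex_ring (\<lambda>i j. A $ i $ j)"
proof -
  obtain B where "A ** B = mat 1" "B ** A = mat 1" using assms unfolding invertible_def by blast
  then show ?thesis
    unfolding matrix_invertible_def
    by (intro exI[of _ "\<lambda>i j. B $ i $ j"])
      (auto simp: finsum_complex_ring matrix_matrix_mult_def mat_def vec_eq_iff)
qed

section \<open>Reversal of words; infinitude of the free algebra\<close>

lemma free_algebra_rev_mult:
  "(\<lambda>w. (f \<otimes>\<^bsub>free_algebra\<^esub> g) (rev w)) = (\<lambda>w. g (rev w)) \<otimes>\<^bsub>free_algebra\<^esub> (\<lambda>w. f (rev w))"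
  unfolding free_algebra_mult
  by (rule ext, rule sum.reindex_bij_witness
        [where i = "\<lambda>(u, v). (rev v, rev u)" and j = "\<lambda>(u, v). (rev v, rev u)"])
    (auto simp flip: rev_append)

lemma free_algebra_rev_closed: "finite {w. f w \<noteq> (0::complex)} \<Longrightarrow> finite {w. f (rev w) \<noteq> 0}"
  using finite_vimageI[of "{w. f w \<noteq> 0}" rev] by (simp add: vimage_def)

lemma infinite_free_algebra: "infinite (UNIV :: ('m list \<Rightarrow> complex) set)"
proof -
  have "inj (fa_const :: complex \<Rightarrow> 'm list \<Rightarrow> complex)"
    by (rule injI) (metis fa_eval_const)
  then show ?thesis
    using infinite_UNIV_char_0[where 'a = complex] by (metis finite_imageD finite_subset subset_UNIV)
qed

section \<open>Singular pencils over the free skew field\<close>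

lemma (in ring) mring_mult_closed:
  fixes A B :: "'n::finite \<Rightarrow> 'n \<Rightarrow> 'a"
  assumes "A \<in> carrier (mring R)" "B \<in> carrier (mring R)"
  shows "(A \<otimes>\<^bsub>mring R\<^esub> B) i j \<in> carrier R"
proof -
  interpret M: ring "mring R :: ('n \<Rightarrow> 'n \<Rightarrow> 'a) ring" by (rule ring_mring)
  show ?thesis using M.m_closed[OF assms] by (simp add: mring_def)
qed

lemma mring_hom_mult:
  fixes A B :: "'n::finite \<Rightarrow> 'n \<Rightarrow> 'a"
  assumes "ring K" "ring L" "h \<in> ring_hom K L" "A \<in> carrier (mring K)" "B \<in> carrier (mring K)"
  shows "(\<lambda>i j. h ((A \<otimes>\<^bsub>mring K\<^esub> B) i j)) = (\<lambda>i j. h (A i j)) \<otimes>\<^bsub>mring L\<^esub> (\<lambda>i j. h (B i j))"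
proof (intro ext)
  fix i j
  interpret h: ring_hom_ring K L h using assms by (intro ring_hom_ringI2)
  have "h (\<Oplus>\<^bsub>K\<^esub>k\<in>UNIV. A i k \<otimes>\<^bsub>K\<^esub> B k j) = (\<Oplus>\<^bsub>L\<^esub>k\<in>UNIV. h (A i k) \<otimes>\<^bsub>L\<^esub> h (B k j))"
    using assms(4,5) by (subst h.hom_finsum) (auto simp: mring_def intro!: h.S.finsum_cong')
  then show "h ((A \<otimes>\<^bsub>mring K\<^esub> B) i j) = ((\<lambda>i j. h (A i j)) \<otimes>\<^bsub>mring L\<^esub> (\<lambda>i j. h (B i j))) i j"
    by (simp add: mring_def)
qed

locale free_field =
  fixes F :: "'f ring" and \<phi> :: "('m::finite list \<Rightarrow> complex) \<Rightarrow> 'f"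
  assumes free_skew_field: "free_skew_field F \<phi>"
begin

lemma epic: "epic_field free_algebra F \<phi>" and skew_field: "skew_field F" and hom: "\<phi> \<in> ring_hom free_algebra F"
  and inj: "inj_on \<phi> (carrier free_algebra)"
  using free_skew_field by (simp_all add: universal_field_of_fractions_def epic_field_def)

sublocale R: ring "free_algebra :: ('m list \<Rightarrow> complex) ring" by (rule ring_free_algebra)
sublocale F: ring F using skew_field by (simp add: skew_field_def)
sublocale \<phi>: ring_hom_ring free_algebra F \<phi> using hom by (intro ring_hom_ringI2) unfold_locales

lemma phi_closed [simp]: "finite {w. f w \<noteq> 0} \<Longrightarrow> \<phi> f \<in> carrier F"
  using \<phi>.hom_closed[of f] by simp

lemma not_NSING_iff: "X \<notin> NSING F \<phi> \<longleftrightarrow> matrix_invertible F (\<lambda>i j. \<phi> (pencil X i j))"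
  by (simp add: NSING_def)

lemma not_NSING_iff_Units: "X \<notin> NSING F \<phi> \<longleftrightarrow> (\<lambda>i j. \<phi> (pencil X i j)) \<in> Units (mring F)"
  unfolding not_NSING_iff by (rule F.matrix_invertible_iff_Units) simp

text \<open>This is how the universal property enters: to show that a tuple is nonsingular, it
  suffices to find one epic field, on any type, over which its pencil is invertible.\<close>

lemma not_NSING_specialize:
  fixes K :: "'k ring"
  assumes "epic_field free_algebra K \<psi>" "matrix_invertible K (\<lambda>i j. \<psi> (pencil X i j))"
  shows "X \<notin> NSING F \<phi>"
  unfolding not_NSING_iff
  by (rule universal_specializes[where A = "pencil X", OF free_skew_field assms(1) infinite_free_algebra _ assms(2)]) simp

lemma not_NSING_if_invertible_combination:
  fixes X :: "complex^'n::finite^'n^'m"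
  assumes "invertible (\<chi> i j. \<Sum>k\<in>UNIV. c k * X $ k $ i $ j)"
  shows "X \<notin> NSING F \<phi>"
proof (rule not_NSING_specialize[OF epic_field_fa_eval[of c]])
  have "fa_eval c (pencil X i j) = (\<Sum>k\<in>UNIV. c k * X $ k $ i $ j)" for i j
  proof -
    have "fa_eval c (pencil X i j) = (\<Sum>w | length w = 1. pencil X i j w * prod_list (map c w))"
      by (rule fa_eval_eq) (auto simp: pencil_apply split: if_splits)
    also have "\<dots> = (\<Sum>k\<in>UNIV. c k * X $ k $ i $ j)"
      unfolding One_nat_def sum_words_Suc by (simp add: pencil_apply mult_ac)
    finally show ?thesis .
  qed
  then show "matrix_invertible complex_ring (\<lambda>i j. fa_eval c (pencil X i j))"
    using matrix_invertible_complex_ring[OF assms] by simp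
qed

lemma NSING_if_zero_column:
  assumes "\<And>k i. X $ k $ i $ j = 0"
  shows "X \<in> NSING F \<phi>"
proof (rule ccontr)
  assume "X \<notin> NSING F \<phi>"
  then obtain B where B: "\<And>i j. B i j \<in> carrier F"
      "\<And>i j. (\<Oplus>\<^bsub>F\<^esub>k\<in>UNIV. B i k \<otimes>\<^bsub>F\<^esub> \<phi> (pencil X k j)) = (if i = j then \<one>\<^bsub>F\<^esub> else \<zero>\<^bsub>F\<^esub>)"
    unfolding not_NSING_iff matrix_invertible_def by blast
  have "pencil X k j = (\<lambda>w. 0)" for k
    using assms by (auto simp: pencil_apply)
  then have "\<phi> (pencil X k j) = \<zero>\<^bsub>F\<^esub>" for k using \<phi>.hom_zero by simp
  then show False using B(2)[of j j] B(1) skew_field by (simp add: skew_field_def)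
qed

text \<open>\<open>fa_subst P\<close> is onto, so \<open>F\<close> with the twisted map
  \<open>\<phi>\<close> after \<open>fa_subst P\<close> is again an epic field. Over it the pencil
  of \<open>X\<close> becomes the pencil of the mixed tuple; if that were invertible, specialization
  would make \<open>X\<close> nonsingular. This avoids extending the automorphism to
  \<open>F\<close>.\<close>

lemma NSING_linear_substitution:
  fixes X :: "complex^'n::finite^'n^'m"
  assumes P: "invertible P" and X: "X \<in> NSING F \<phi>"
  shows "(\<chi> k. \<Sum>l\<in>UNIV. mscale (P $ k $ l) (X $ l)) \<in> NSING F \<phi>"
proof (rule ccontr)
  assume *: "\<not> ?thesis"
  obtain Q where Q: "P ** Q = mat 1" using P unfolding invertible_def by blast
  have "epic_field free_algebra F (\<lambda>x. \<phi> (fa_subst P x))"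
  proof -
    have "(\<lambda>x. \<phi> (fa_subst P x)) \<in> ring_hom free_algebra F"
      using ring_hom_trans[OF fa_subst_hom hom] by (simp add: o_def)
    moreover have "fa_subst P ` carrier free_algebra = carrier free_algebra"
    proof (intro equalityI subsetI)
      fix f :: "'m list \<Rightarrow> complex" assume f: "f \<in> carrier free_algebra"
      show "f \<in> fa_subst P ` carrier free_algebra"
      proof (rule image_eqI)
        show "f = fa_subst P (fa_subst Q f)" by (simp add: fa_subst_compose Q fa_subst_mat)
        show "fa_subst Q f \<in> carrier free_algebra" using f fa_subst_closed by auto
      qed
    qed (auto simp: fa_subst_closed)
    then have "(\<lambda>x. \<phi> (fa_subst P x)) ` carrier free_algebra = \<phi> ` carrier free_algebra"
      by (metis image_image)
    ultimately show ?thesis using epic unfolding epic_field_def by simp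
  qed
  then have "X \<notin> NSING F \<phi>"
    by (rule not_NSING_specialize) (use * in \<open>simp add: fa_subst_pencil not_NSING_iff\<close>)
  then show False using X by simp
qed

text \<open>Reversal of words fixes the linear forms and reverses products, so composed with
  \<open>\<phi>\<close> it makes the opposite of \<open>F\<close> an epic field. Over that field the
  pencil of \<open>X\<close> is invertible as soon as the pencil of the transposed tuple is
  invertible over \<open>F\<close>.\<close>

lemma NSING_transpose:
  fixes X :: "complex^'n::finite^'n^'m"
  assumes X: "X \<in> NSING F \<phi>"
  shows "tuple_transpose X \<in> NSING F \<phi>"
proof (rule ccontr)
  assume *: "\<not> ?thesis"
  let ?\<rho> = "\<lambda>(f :: 'm list \<Rightarrow> complex) w. f (rev w)"
  have "?\<rho> ` carrier free_algebra = carrier free_algebra"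
  proof (intro equalityI subsetI)
    fix f :: "'m list \<Rightarrow> complex" assume f: "f \<in> carrier free_algebra"
    have "f = ?\<rho> (?\<rho> f)" by simp
    then show "f \<in> ?\<rho> ` carrier free_algebra"
      using f free_algebra_rev_closed[of f] by (intro image_eqI[of _ _ "?\<rho> f"]) auto
  qed (auto simp: free_algebra_rev_closed)
  moreover have "(\<lambda>x. \<phi> (?\<rho> x)) \<in> ring_hom free_algebra (opposite_ring F)"
  proof (rule ring_hom_memI)
    show "\<phi> (?\<rho> f) \<in> carrier (opposite_ring F)" if "f \<in> carrier free_algebra" for f
      using that by (simp add: free_algebra_rev_closed)
  next
    fix f g :: "'m list \<Rightarrow> complex" assume "f \<in> carrier free_algebra" "g \<in> carrier free_algebra"
    then have fg: "?\<rho> f \<in> carrier free_algebra" "?\<rho> g \<in> carrier free_algebra" by (auto simp: free_algebra_rev_closed)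
    show "\<phi> (?\<rho> (f \<otimes>\<^bsub>free_algebra\<^esub> g)) = \<phi> (?\<rho> f) \<otimes>\<^bsub>opposite_ring F\<^esub> \<phi> (?\<rho> g)"
      unfolding free_algebra_rev_mult using \<phi>.hom_mult[OF fg(2,1)] by simp
    show "\<phi> (?\<rho> (f \<oplus>\<^bsub>free_algebra\<^esub> g)) = \<phi> (?\<rho> f) \<oplus>\<^bsub>opposite_ring F\<^esub> \<phi> (?\<rho> g)"
      using \<phi>.hom_add[OF fg] by simp
  next
    have "?\<rho> (fa_const 1 :: 'm list \<Rightarrow> complex) = fa_const 1" by (auto simp: fa_const_def)
    then show "\<phi> (?\<rho> \<one>\<^bsub>free_algebra\<^esub>) = \<one>\<^bsub>opposite_ring F\<^esub>" using \<phi>.hom_one by simp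
  qed
  ultimately have "epic_field free_algebra (opposite_ring F) (\<lambda>x. \<phi> (?\<rho> x))"
    by (rule epic_field_opposite[OF epic])
  moreover have "matrix_invertible (opposite_ring F) (\<lambda>i j. \<phi> (?\<rho> (pencil X i j)))"
  proof (rule matrix_invertible_opposite)
    have "?\<rho> (pencil X j i) = pencil (tuple_transpose X) i j" for i j
      by (rule ext) (auto simp: pencil_apply tuple_transpose_def transpose_def length_Suc_conv)
    then show "matrix_invertible F (\<lambda>i j. \<phi> (?\<rho> (pencil X j i)))"
      using * by (simp add: not_NSING_iff)
  qed
  ultimately have "X \<notin> NSING F \<phi>" by (rule not_NSING_specialize)
  then show False using X by simp
qed

lemma const_hom: "(\<lambda>c. \<phi> (fa_const c)) \<in> ring_hom complex_ring F"
proof (rule ring_hom_memI)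
  fix x y
  have "fa_const (x * y) = fa_const x \<otimes>\<^bsub>free_algebra\<^esub> (fa_const y :: 'm list \<Rightarrow> complex)"
    unfolding mult_fa_const by (auto simp: fa_const_def)
  then show "\<phi> (fa_const (x \<otimes>\<^bsub>complex_ring\<^esub> y)) = \<phi> (fa_const x) \<otimes>\<^bsub>F\<^esub> \<phi> (fa_const y)"
    by (simp add: \<phi>.hom_mult)
  have "fa_const (x + y) = fa_const x \<oplus>\<^bsub>free_algebra\<^esub> (fa_const y :: 'm list \<Rightarrow> complex)"
    by (auto simp: fa_const_def)
  then have "\<phi> (fa_const (x + y)) = \<phi> (fa_const x) \<oplus>\<^bsub>F\<^esub> \<phi> (fa_const y)"
    by (simp only: \<phi>.hom_add free_algebra_simps(1) fa_const_closed)
  then show "\<phi> (fa_const (x \<oplus>\<^bsub>complex_ring\<^esub> y)) = \<phi> (fa_const x) \<oplus>\<^bsub>F\<^esub> \<phi> (fa_const y)" by simp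
qed (use \<phi>.hom_one in auto)

lemma const_matrix_Units:
  fixes Q :: "complex^'n::finite^'n"
  assumes "invertible Q"
  shows "(\<lambda>i j. \<phi> (fa_const (Q $ i $ j))) \<in> Units (mring F)"
proof -
  have "matrix_invertible F (\<lambda>i j. \<phi> (fa_const (Q $ i $ j)))"
    using matrix_invertible_hom[OF ring_complex_ring F.ring_axioms const_hom _ matrix_invertible_complex_ring[OF assms]]
    by simp
  then show ?thesis by (subst (asm) F.matrix_invertible_iff_Units) auto
qed

text \<open>Complex constants are central in the free algebra, so the new pencil is a product of the
  old one with two constant matrices, and \<open>\<phi>\<close> maps these to units.\<close>

lemma NSING_equivalence:
  fixes X :: "complex^'n::finite^'n^'m" and Q Q' :: "complex^'n^'n"
  assumes Q: "invertible Q" and Q': "invertible Q'"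
  shows "(\<chi> k. Q ** X $ k ** Q') \<in> NSING F \<phi> \<longleftrightarrow> X \<in> NSING F \<phi>"
proof -
  let ?c = "\<lambda>(Q::complex^'n^'n) i j. fa_const (Q $ i $ j) :: 'm list \<Rightarrow> complex"
  let ?M = "mring free_algebra :: ('n \<Rightarrow> 'n \<Rightarrow> 'm list \<Rightarrow> complex) ring"
  interpret M: ring ?M by (rule R.ring_mring)
  interpret N: ring "mring F :: ('n \<Rightarrow> 'n \<Rightarrow> 'f) ring" by (rule F.ring_mring)
  have carr: "?c Q \<in> carrier ?M" "?c Q' \<in> carrier ?M" "pencil X \<in> carrier ?M" for Q Q'
    by (auto simp: mring_def)
  have eq: "pencil (\<chi> k. Q ** X $ k ** Q') = ?c Q \<otimes>\<^bsub>?M\<^esub> pencil X \<otimes>\<^bsub>?M\<^esub> ?c Q'"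
  proof (intro ext)
    fix i j w
    have fin: "finite {w. f w * a \<noteq> 0}" if "finite {w. f w \<noteq> 0}" for f :: "'m list \<Rightarrow> complex" and a
      by (rule finite_subset[OF _ that]) auto
    have fin': "finite {w. a * f w \<noteq> 0}" if "finite {w. f w \<noteq> 0}" for f :: "'m list \<Rightarrow> complex" and a
      by (rule finite_subset[OF _ that]) auto
    have A: "(?c Q \<otimes>\<^bsub>?M\<^esub> pencil X) i a = (\<lambda>w. \<Sum>b\<in>UNIV. Q $ i $ b * pencil X b a w)" for a
      by (rule ext) (auto simp: mring_def fa_const_mult finsum_free_algebra fin')
    have "(?c Q \<otimes>\<^bsub>?M\<^esub> pencil X) i a \<in> carrier free_algebra" for a
      using carr by (intro R.mring_mult_closed)
    then have cl: "finite {w. (\<Sum>b\<in>UNIV. Q $ i $ b * pencil X b a w) \<noteq> 0}" for a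
      unfolding A by simp
    have "(?c Q \<otimes>\<^bsub>?M\<^esub> pencil X \<otimes>\<^bsub>?M\<^esub> ?c Q') i j =
        (\<Oplus>\<^bsub>free_algebra\<^esub>a\<in>UNIV. (?c Q \<otimes>\<^bsub>?M\<^esub> pencil X) i a \<otimes>\<^bsub>free_algebra\<^esub> ?c Q' a j)"
      by (simp add: mring_def)
    then have "(?c Q \<otimes>\<^bsub>?M\<^esub> pencil X \<otimes>\<^bsub>?M\<^esub> ?c Q') i j w =
        (\<Sum>a\<in>UNIV. (\<Sum>b\<in>UNIV. Q $ i $ b * pencil X b a w) * Q' $ a $ j)"
      by (simp add: A mult_fa_const finsum_free_algebra fin cl)
    then show "pencil (\<chi> k. Q ** X $ k ** Q') i j w = (?c Q \<otimes>\<^bsub>?M\<^esub> pencil X \<otimes>\<^bsub>?M\<^esub> ?c Q') i j w"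
      by (simp add: pencil_apply matrix_matrix_mult_def)
  qed
  have "(\<lambda>i j. \<phi> (pencil (\<chi> k. Q ** X $ k ** Q') i j)) =
      (\<lambda>i j. \<phi> (?c Q i j)) \<otimes>\<^bsub>mring F\<^esub> (\<lambda>i j. \<phi> (pencil X i j)) \<otimes>\<^bsub>mring F\<^esub> (\<lambda>i j. \<phi> (?c Q' i j))"
    unfolding eq
    using carr by (simp only: mring_hom_mult[OF R.ring_axioms F.ring_axioms hom] M.m_closed)
  moreover have "(\<lambda>i j. \<phi> (pencil X i j)) \<in> carrier (mring F)" by (simp add: mring_def)
  ultimately have "X \<notin> NSING F \<phi> \<longleftrightarrow> (\<chi> k. Q ** X $ k ** Q') \<notin> NSING F \<phi>"
    unfolding not_NSING_iff_Units
    using const_matrix_Units[OF Q] const_matrix_Units[OF Q'] N.Units_closed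
    by (simp add: N.Units_mult_left_iff N.Units_mult_right_iff)
  then show ?thesis by blast
qed

text \<open>If \<open>A\<close> is the pencil of \<open>X\<close>, then that of
  \<open>X + s Y\<close> is \<open>A + u (s \<eta>)\<close>, and \<open>rank_one_update\<close>
  reduces singularity to \<open>1 + s d = 0\<close> with \<open>d = \<eta> A^-1 u\<close>. Two
  solutions give \<open>s d = t d\<close> with \<open>d\<close> invertible, and
  \<open>\<phi>\<close> is injective on constants.\<close>

lemma rank_one_line:
  fixes X Y :: "complex^'n::finite^'n^'m"
  assumes X: "X \<notin> NSING F \<phi>" and Y: "\<And>k i j. Y $ k $ i $ j = u i * y k j"
    and s: "X + tscale s Y \<in> NSING F \<phi>" and t: "X + tscale t Y \<in> NSING F \<phi>"
  shows "s = t"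
proof -
  let ?A = "\<lambda>i j. \<phi> (pencil X i j)"
  let ?u = "\<lambda>i. \<phi> (fa_const (u i))"
  \<comment> \<open>The row of linear forms \<open>sum_k t_k y_kj\<close>, obtained from a pencil
    all of whose rows are equal; \<open>undefined\<close> selects any one of them.\<close>
  define \<eta> where "\<eta> = (\<lambda>j. \<phi> (pencil (\<chi> k i j. y k j :: complex^'n^'n^'m) undefined j))"
  have \<eta> [simp]: "\<eta> j \<in> carrier F" for j by (simp add: \<eta>_def)
  obtain B where B: "B \<in> carrier (mring F)" "?A \<otimes>\<^bsub>mring F\<^esub> B = \<one>\<^bsub>mring F\<^esub>" "B \<otimes>\<^bsub>mring F\<^esub> ?A = \<one>\<^bsub>mring F\<^esub>"
    using X unfolding not_NSING_iff_Units Units_def by blast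
  have A: "?A \<in> carrier (mring F)" by (simp add: mring_def)
  have Bc: "\<And>i j. B i j \<in> carrier F" using B by (simp add: mring_def)
  define d where "d = (\<Oplus>\<^bsub>F\<^esub>j\<in>UNIV. \<eta> j \<otimes>\<^bsub>F\<^esub> (\<Oplus>\<^bsub>F\<^esub>k\<in>UNIV. B j k \<otimes>\<^bsub>F\<^esub> ?u k))"
  have inner: "(\<Oplus>\<^bsub>F\<^esub>k\<in>UNIV. B j k \<otimes>\<^bsub>F\<^esub> ?u k) \<in> carrier F" for j
    using Bc by (auto intro!: F.finsum_closed)
  have d [simp]: "d \<in> carrier F" using inner by (auto simp: d_def intro!: F.finsum_closed)
  have key: "\<phi> (fa_const s) \<otimes>\<^bsub>F\<^esub> d = \<ominus>\<^bsub>F\<^esub> \<one>\<^bsub>F\<^esub>" if "X + tscale s Y \<in> NSING F \<phi>" for s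
  proof -
    let ?s = "\<phi> (fa_const s)"
    have "\<phi> (pencil (X + tscale s Y) i j) = ?A i j \<oplus>\<^bsub>F\<^esub> ?u i \<otimes>\<^bsub>F\<^esub> (?s \<otimes>\<^bsub>F\<^esub> \<eta> j)" for i j
    proof -
      let ?p = "pencil (\<chi> k i j. y k j :: complex^'n^'n^'m) undefined j"
      have p: "finite {w. s * ?p w \<noteq> 0}" "finite {w. u i * (s * ?p w) \<noteq> 0}"
        by (rule finite_subset[OF _ pencil_closed]; auto)+
      have "pencil (X + tscale s Y) i j = pencil X i j \<oplus>\<^bsub>free_algebra\<^esub>
          fa_const (u i) \<otimes>\<^bsub>free_algebra\<^esub> (fa_const s \<otimes>\<^bsub>free_algebra\<^esub> ?p)"
        by (auto simp: fa_const_mult pencil_apply tscale_def mscale_def Y)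
      moreover have "fa_const s \<otimes>\<^bsub>free_algebra\<^esub> ?p \<in> carrier free_algebra"
        "fa_const (u i) \<otimes>\<^bsub>free_algebra\<^esub> (fa_const s \<otimes>\<^bsub>free_algebra\<^esub> ?p) \<in> carrier free_algebra"
        using p by (simp_all add: fa_const_mult)
      ultimately show ?thesis
        by (simp only: \<phi>.hom_add \<phi>.hom_mult free_algebra_simps(1) pencil_closed fa_const_closed \<eta>_def)
    qed
    then have "(\<lambda>i j. ?A i j \<oplus>\<^bsub>F\<^esub> ?u i \<otimes>\<^bsub>F\<^esub> (?s \<otimes>\<^bsub>F\<^esub> \<eta> j)) \<notin> Units (mring F)"
      using that not_NSING_iff_Units[of "X + tscale s Y"] by simp
    moreover have "(\<Oplus>\<^bsub>F\<^esub>j\<in>UNIV. (?s \<otimes>\<^bsub>F\<^esub> \<eta> j) \<otimes>\<^bsub>F\<^esub> (\<Oplus>\<^bsub>F\<^esub>k\<in>UNIV. B j k \<otimes>\<^bsub>F\<^esub> ?u k)) = ?s \<otimes>\<^bsub>F\<^esub> d"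
    proof -
      have "(\<Oplus>\<^bsub>F\<^esub>j\<in>UNIV. (?s \<otimes>\<^bsub>F\<^esub> \<eta> j) \<otimes>\<^bsub>F\<^esub> (\<Oplus>\<^bsub>F\<^esub>k\<in>UNIV. B j k \<otimes>\<^bsub>F\<^esub> ?u k)) =
          (\<Oplus>\<^bsub>F\<^esub>j\<in>UNIV. ?s \<otimes>\<^bsub>F\<^esub> (\<eta> j \<otimes>\<^bsub>F\<^esub> (\<Oplus>\<^bsub>F\<^esub>k\<in>UNIV. B j k \<otimes>\<^bsub>F\<^esub> ?u k)))"
        using inner by (intro F.finsum_cong') (auto simp: F.m_assoc)
      then show ?thesis unfolding d_def using inner by (subst F.finsum_rdistr) auto
    qed
    ultimately have "\<one>\<^bsub>F\<^esub> \<oplus>\<^bsub>F\<^esub> ?s \<otimes>\<^bsub>F\<^esub> d \<notin> Units F"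
      using F.rank_one_update[OF A B, of ?u "\<lambda>j. ?s \<otimes>\<^bsub>F\<^esub> \<eta> j"] by simp
    then have "\<one>\<^bsub>F\<^esub> \<oplus>\<^bsub>F\<^esub> ?s \<otimes>\<^bsub>F\<^esub> d = \<zero>\<^bsub>F\<^esub>"
      using skew_field by (simp add: skew_field_def)
    then show ?thesis by (intro F.minus_equality[symmetric]) (auto simp: F.a_comm)
  qed
  have "d \<noteq> \<zero>\<^bsub>F\<^esub>"
  proof
    assume "d = \<zero>\<^bsub>F\<^esub>"
    then have "\<one>\<^bsub>F\<^esub> = \<zero>\<^bsub>F\<^esub>" using key[OF s] by (metis F.minus_minus F.minus_zero F.one_closed F.r_null fa_const_closed phi_closed)
    then show False using skew_field by (simp add: skew_field_def)
  qed
  then have dU: "d \<in> Units F" using skew_field by (simp add: skew_field_def)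
  have "\<phi> (fa_const s) \<otimes>\<^bsub>F\<^esub> d \<otimes>\<^bsub>F\<^esub> inv\<^bsub>F\<^esub> d = \<phi> (fa_const t) \<otimes>\<^bsub>F\<^esub> d \<otimes>\<^bsub>F\<^esub> inv\<^bsub>F\<^esub> d"
    using key[OF s] key[OF t] by simp
  then have "\<phi> (fa_const s) = \<phi> (fa_const t)"
    using dU by (simp add: F.m_assoc)
  then have "fa_const s = (fa_const t :: 'm list \<Rightarrow> complex)"
    using inj by (auto dest!: inj_onD)
  then show ?thesis by (metis fa_eval_const)
qed

end

section \<open>Spaces of tensors of rank at most one\<close>

definition rank_le_one :: "('a \<Rightarrow> 'b \<Rightarrow> complex) \<Rightarrow> bool" where
  "rank_le_one M \<longleftrightarrow> (\<exists>u y. \<forall>a b. M a b = u a * y b)"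

text \<open>The zero function is parallel to everything, hence the nonvanishing conditions in the
  lemmas that follow.\<close>

definition parallel :: "('a \<Rightarrow> complex) \<Rightarrow> ('a \<Rightarrow> complex) \<Rightarrow> bool" where
  "parallel u v \<longleftrightarrow> (\<forall>a b. u a * v b = u b * v a)"

lemma parallelE:
  assumes "parallel u v" "u \<noteq> (\<lambda>_. 0)"
  obtains c where "v = (\<lambda>a. c * u a)"
proof -
  obtain a where a: "u a \<noteq> 0" using assms(2) by auto
  have "v b = v a / u a * u b" for b
    using assms(1) a by (simp add: parallel_def field_simps)
  then show thesis using that by blast
qed

lemma parallel_sym: "parallel u v \<Longrightarrow> parallel v u"
  by (auto simp: parallel_def mult.commute)

lemma parallel_scale: "(\<And>a. v a = c * u a) \<Longrightarrow> parallel u v"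
  by (simp add: parallel_def)

lemma parallel_trans:
  assumes "parallel u v" "parallel v w" "v \<noteq> (\<lambda>_. 0)"
  shows "parallel u w"
proof -
  obtain c where "w = (\<lambda>a. c * v a)" using assms(2,3) by (rule parallelE)
  then show ?thesis using assms(1) by (simp add: parallel_def mult.left_commute)
qed

lemma rank_le_one_iff_minors:
  "rank_le_one M \<longleftrightarrow> (\<forall>a a' b b'. M a b * M a' b' = M a b' * M a' b)"
proof
  assume "\<forall>a a' b b'. M a b * M a' b' = M a b' * M a' b"
  then have minors: "M a b * M a' b' = M a b' * M a' b" for a a' b b' by blast
  show "rank_le_one M"
  proof (cases "\<exists>a b. M a b \<noteq> 0")
    case True
    then obtain a0 b0 where "M a0 b0 \<noteq> 0" by blast
    then have "M a b = M a b0 * (M a0 b / M a0 b0)" for a b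
      using minors[of a b a0 b0] by (simp add: field_simps)
    then show ?thesis unfolding rank_le_one_def
      by (intro exI[of _ "\<lambda>a. M a b0"] exI[of _ "\<lambda>b. M a0 b / M a0 b0"]) blast
  qed (auto simp: rank_le_one_def intro: exI[of _ "\<lambda>_. 0"])
qed (auto simp: rank_le_one_def)

text \<open>Every 2 x 2 minor of the sum is a minor of the pair \<open>(u, p)\<close> times a minor
  of the pair \<open>(v, q)\<close>.\<close>

lemma rank_le_one_sum:
  assumes "rank_le_one (\<lambda>a b. u a * v b + p a * q b)"
  shows "parallel u p \<or> parallel v q"
proof (rule ccontr)
  assume "\<not> ?thesis"
  then obtain a a' b b' where ne: "u a * p a' \<noteq> u a' * p a" "v b * q b' \<noteq> v b' * q b"
    unfolding parallel_def by blast
  have "(u a * v b + p a * q b) * (u a' * v b' + p a' * q b') = (u a * v b' + p a * q b') * (u a' * v b + p a' * q b)"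
    using assms unfolding rank_le_one_iff_minors by blast
  then have "(u a * p a' - u a' * p a) * (v b * q b' - v b' * q b) = 0"
    by (simp add: algebra_simps)
  then show False using ne by simp
qed

text \<open>By \<open>rank_le_one_sum\<close>, any two members have parallel left factors or
  parallel right factors. If two nonzero members have right factors that are not parallel, then they
  share the left factor, and so does every third member: its right factor cannot be parallel to both
  unless it vanishes.\<close>

lemma rank_le_one_space:
  assumes add: "\<And>M N. M \<in> W \<Longrightarrow> N \<in> W \<Longrightarrow> (\<lambda>a b. M a b + N a b) \<in> W"
    and rank: "\<And>M. M \<in> W \<Longrightarrow> rank_le_one M"
  shows "(\<exists>u. \<forall>M\<in>W. \<exists>y. \<forall>a b. M a b = u a * y b) \<or> (\<exists>y. \<forall>M\<in>W. \<exists>u. \<forall>a b. M a b = u a * y b)"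
proof (rule disjCI)
  assume noty: "\<not> (\<exists>y. \<forall>M\<in>W. \<exists>u. \<forall>a b. M a b = u a * y b)"
  have ex: "\<exists>u y. M = (\<lambda>a b. u a * y b)" if "M \<in> W" for M
    using rank[OF that] unfolding rank_le_one_def by (simp add: fun_eq_iff)
  have par: "parallel u p \<or> parallel v q"
    if "(\<lambda>a b. u a * v b) \<in> W" "(\<lambda>a b. p a * q b) \<in> W" for u v p q
    using rank[OF add[OF that]] by (rule rank_le_one_sum)
  have noty': "\<exists>M\<in>W. \<not> (\<exists>u. \<forall>a b. M a b = u a * y b)" for y using noty by blast
  \<comment> \<open>The instance \<open>y = 0\<close> of the negated alternative yields a nonzero
    member.\<close>
  obtain M0 where "M0 \<in> W" "\<not> (\<exists>u. \<forall>a b. M0 a b = u a * 0)" using noty'[of "\<lambda>_. 0"] by blast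
  with ex obtain u v where uv: "M0 = (\<lambda>a b. u a * v b)" by blast
  have u0: "u \<noteq> (\<lambda>_. 0)" and v0: "v \<noteq> (\<lambda>_. 0)"
    using \<open>\<not> (\<exists>u. \<forall>a b. M0 a b = u a * 0)\<close> by (auto simp: uv)
  have uvW: "(\<lambda>a b. u a * v b) \<in> W" using \<open>M0 \<in> W\<close> uv by simp
  obtain M where M: "M \<in> W" "\<not> (\<exists>u. \<forall>a b. M a b = u a * v b)" using noty by blast
  obtain r w where rw: "M = (\<lambda>a b. r a * w b)" using ex[OF M(1)] by blast
  have "\<not> parallel v w"
  proof
    assume "parallel v w"
    then obtain c where "w = (\<lambda>b. c * v b)" using v0 by (rule parallelE)
    then have "\<exists>u. \<forall>a b. M a b = u a * v b" by (intro exI[of _ "\<lambda>a. r a * c"]) (simp add: rw)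
    then show False using M(2) by blast
  qed
  then have "parallel u r" using par[OF uvW] M(1) rw by blast
  then obtain \<rho> where \<rho>: "r = (\<lambda>a. \<rho> * u a)" using u0 by (rule parallelE)
  have r0: "\<rho> \<noteq> 0" using M(2) by (auto simp: rw \<rho> intro: exI[of _ "\<lambda>_. 0"])
  show "\<exists>u. \<forall>M\<in>W. \<exists>y. \<forall>a b. M a b = u a * y b"
  proof (intro exI[of _ u] ballI)
    fix N assume N: "N \<in> W"
    obtain p q where pq: "N = (\<lambda>a b. p a * q b)" using ex[OF N] by blast
    show "\<exists>y. \<forall>a b. N a b = u a * y b"
    proof (cases "parallel u p")
      case True
      then obtain c where "p = (\<lambda>a. c * u a)" using u0 by (rule parallelE)
      then show ?thesis by (auto simp: pq intro!: exI[of _ "\<lambda>b. c * q b"])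
    next
      case False
      then have "parallel v q" using par[OF uvW] N pq by blast
      then obtain c where c: "q = (\<lambda>b. c * v b)" using v0 by (rule parallelE)
      have "\<not> parallel r p" using False r0 by (simp add: \<rho> parallel_def)
      then have "parallel w q" using par[of r w p q] M(1) N rw pq by blast
      then have "c = 0" using \<open>\<not> parallel v w\<close> by (auto simp: c parallel_def mult.commute)
      then show ?thesis by (auto simp: pq c intro!: exI[of _ "\<lambda>_. 0"])
    qed
  qed
qed

text \<open>The hypotheses give \<open>\<alpha>\<close> only up to a scalar for each
  \<open>u\<close>. At the parameter \<open>y0\<close> the values form a linear space of matrices of
  rank at most one, from which a linear representative \<open>A\<close> of \<open>\<alpha>\<close>
  is extracted; additivity in \<open>u\<close> then makes the second factor independent of
  \<open>i\<close>. The parameter \<open>y\<close> ranges over any type, as the lemma is applied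
  both to arbitrary second factors and to mere indices.\<close>

lemma bilinear_factorization:
  fixes K :: "'a::finite \<Rightarrow> 'y \<Rightarrow> 'a \<Rightarrow> 'b \<Rightarrow> complex"
  assumes \<alpha>: "\<And>u y. u \<noteq> (\<lambda>_. 0) \<Longrightarrow> \<exists>z. \<forall>a b. (\<Sum>i\<in>UNIV. u i * K i y a b) = \<alpha> u a * z b"
    and \<alpha>0: "\<And>u. u \<noteq> (\<lambda>_. 0) \<Longrightarrow> \<alpha> u \<noteq> (\<lambda>_. 0)"
    and \<alpha>inj: "\<And>u v. u \<noteq> (\<lambda>_. 0) \<Longrightarrow> v \<noteq> (\<lambda>_. 0) \<Longrightarrow> parallel (\<alpha> u) (\<alpha> v) \<Longrightarrow> parallel u v"
    and y0: "\<And>u. u \<noteq> (\<lambda>_. 0) \<Longrightarrow> \<exists>a b. (\<Sum>i\<in>UNIV. u i * K i y0 a b) \<noteq> 0"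
    and card: "p \<noteq> (q :: 'a)"
  shows "\<exists>A T. \<forall>i y a b. K i y a b = A i a * T y b"
proof -
  define \<Phi> where "\<Phi> u y a b = (\<Sum>i\<in>UNIV. u i * K i y a b)" for u y a b
  define \<delta> where "\<delta> i = (\<lambda>j. if j = i then 1 else 0 :: complex)" for i :: 'a
  have \<Phi>\<delta>: "\<Phi> (\<delta> i) y a b = K i y a b" for i y a b
    by (simp add: \<Phi>_def \<delta>_def if_distrib[of "\<lambda>x. x * _"] cong: if_cong)
  have \<Phi>add: "\<Phi> (\<lambda>i. u i + v i) y a b = \<Phi> u y a b + \<Phi> v y a b" for u v y a b
    by (simp add: \<Phi>_def distrib_right sum.distrib)
  have \<delta>0: "\<delta> i \<noteq> (\<lambda>_. 0)" for i by (auto simp: \<delta>_def fun_eq_iff)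
  have \<delta>par: "\<not> parallel (\<delta> i) (\<delta> j)" if "i \<noteq> j" for i j
  proof
    assume "parallel (\<delta> i) (\<delta> j)"
    then have "\<delta> i i * \<delta> j j = \<delta> i j * \<delta> j i" unfolding parallel_def by blast
    then show False using that by (simp add: \<delta>_def)
  qed
  let ?W = "{\<Phi> u y0 | u. True}"
  have "(\<exists>u. \<forall>M\<in>?W. \<exists>y. \<forall>a b. M a b = u a * y b) \<or> (\<exists>y. \<forall>M\<in>?W. \<exists>u. \<forall>a b. M a b = u a * y b)"
  proof (rule rank_le_one_space)
    fix M N assume "M \<in> ?W" "N \<in> ?W"
    then obtain u v where "M = \<Phi> u y0" "N = \<Phi> v y0" by blast
    then have "(\<lambda>a b. M a b + N a b) = \<Phi> (\<lambda>i. u i + v i) y0" by (simp add: fun_eq_iff \<Phi>add)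
    then show "(\<lambda>a b. M a b + N a b) \<in> ?W" by blast
  next
    fix M assume "M \<in> ?W"
    then obtain u where u: "M = \<Phi> u y0" by blast
    show "rank_le_one M"
    proof (cases "u = (\<lambda>_. 0)")
      case True
      then show ?thesis by (auto simp: u \<Phi>_def rank_le_one_def intro: exI[of _ "\<lambda>_. 0"])
    next
      case False
      then show ?thesis using \<alpha>[of u y0] unfolding rank_le_one_def u \<Phi>_def by blast
    qed
  qed
  then obtain t where "\<forall>M\<in>?W. \<exists>u. \<forall>a b. M a b = u a * t b"
  proof
    \<comment> \<open>A common left factor would make all \<open>\<alpha> u\<close> parallel,
      against the injectivity of \<open>\<alpha>\<close> on lines.\<close>
    assume "\<exists>u. \<forall>M\<in>?W. \<exists>y. \<forall>a b. M a b = u a * y b"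
    then obtain c where c: "\<And>u. \<exists>y. \<forall>a b. \<Phi> u y0 a b = c a * y b" by blast
    have "parallel c (\<alpha> u) \<and> c \<noteq> (\<lambda>_. 0)" if u: "u \<noteq> (\<lambda>_. 0)" for u
    proof -
      obtain a b where ab: "\<Phi> u y0 a b \<noteq> 0" using y0[OF u] unfolding \<Phi>_def by blast
      obtain y where y: "\<And>a b. \<Phi> u y0 a b = c a * y b" using c by blast
      obtain z where z: "\<And>a b. \<Phi> u y0 a b = \<alpha> u a * z b" using \<alpha>[OF u] unfolding \<Phi>_def by blast
      have "z b \<noteq> 0" using ab z by auto
      then have "\<alpha> u a' = (y b / z b) * c a'" for a'
        using y[of a' b] z[of a' b] by (simp add: field_simps)
      then have "parallel c (\<alpha> u)" by (rule parallel_scale)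
      then show ?thesis using ab y by auto
    qed
    note P = this[OF \<delta>0[of p]] this[OF \<delta>0[of q]]
    have "parallel (\<alpha> (\<delta> p)) (\<alpha> (\<delta> q))"
      by (rule parallel_trans[OF parallel_sym[OF conjunct1[OF P(1)]] conjunct1[OF P(2)] conjunct2[OF P(1)]])
    from \<alpha>inj[OF \<delta>0 \<delta>0 this] show ?thesis using \<delta>par[OF card] by blast
  qed blast
  then have t: "\<exists>w. \<forall>a b. \<Phi> u y0 a b = w a * t b" for u by blast
  obtain b0 where b0: "t b0 \<noteq> 0"
  proof -
    obtain a b where ab: "\<Phi> (\<delta> p) y0 a b \<noteq> 0" using y0[OF \<delta>0] unfolding \<Phi>_def by blast
    obtain w where "\<And>a b. \<Phi> (\<delta> p) y0 a b = w a * t b" using t by blast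
    then have "t b \<noteq> 0" using ab by auto
    then show thesis by (rule that)
  qed
  \<comment> \<open>A fixed column of the values at \<open>y0\<close>, up to a constant: additive in
    \<open>u\<close>, unlike \<open>\<alpha>\<close>, but parallel to it.\<close>
  define A where "A u a = \<Phi> u y0 a b0 / t b0" for u a
  have A: "\<Phi> u y0 a b = A u a * t b" for u a b
    using t[of u] b0 by (auto simp: A_def)
  have A0: "A u \<noteq> (\<lambda>_. 0)" if "u \<noteq> (\<lambda>_. 0)" for u
  proof -
    obtain a b where ab: "\<Phi> u y0 a b \<noteq> 0" using y0[OF \<open>u \<noteq> (\<lambda>_. 0)\<close>] unfolding \<Phi>_def by blast
    then show ?thesis by (auto simp: A)
  qed
  have \<alpha>A: "parallel (A u) (\<alpha> u)" if u: "u \<noteq> (\<lambda>_. 0)" for u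
  proof -
    obtain z where z: "\<And>a b. \<Phi> u y0 a b = \<alpha> u a * z b" using \<alpha>[OF u] unfolding \<Phi>_def by blast
    have "A u a = z b0 / t b0 * \<alpha> u a" for a by (simp add: A_def z)
    then show ?thesis by (intro parallel_sym[OF parallel_scale])
  qed
  have Aadd: "A (\<lambda>i. u i + v i) a = A u a + A v a" for u v a
    by (simp add: A_def \<Phi>add add_divide_distrib)
  have ex: "\<exists>z. \<forall>a b. \<Phi> u y a b = A u a * z b" if u: "u \<noteq> (\<lambda>_. 0)" for u y
  proof -
    obtain z where z: "\<And>a b. \<Phi> u y a b = \<alpha> u a * z b" using \<alpha>[OF u] unfolding \<Phi>_def by blast
    obtain c where "\<alpha> u = (\<lambda>a. c * A u a)" using \<alpha>A[OF u] A0[OF u] by (rule parallelE)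
    then show ?thesis using z by (intro exI[of _ "\<lambda>b. c * z b"]) simp
  qed
  have indep: "\<not> parallel (A (\<delta> i)) (A (\<delta> j))" if "i \<noteq> j" for i j
  proof
    assume "parallel (A (\<delta> i)) (A (\<delta> j))"
    then have "parallel (\<alpha> (\<delta> i)) (\<alpha> (\<delta> j))"
      by (rule parallel_trans[OF parallel_sym[OF \<alpha>A[OF \<delta>0]] parallel_trans[OF _ \<alpha>A[OF \<delta>0] A0[OF \<delta>0]] A0[OF \<delta>0]])
    from \<alpha>inj[OF \<delta>0 \<delta>0 this] show False using \<delta>par[OF that] by blast
  qed
  obtain T where T: "\<And>i y a b. \<Phi> (\<delta> i) y a b = A (\<delta> i) a * T i y b"
    using ex[OF \<delta>0] by metis
  \<comment> \<open>Expanding the value at \<open>\<delta> i + \<delta> j\<close> in two ways gives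
    a linear relation between \<open>A (\<delta> i)\<close> and \<open>A (\<delta> j)\<close>; these
    are independent, so both coefficients vanish.\<close>
  have same: "T i y b = T j y b" for i j y b
  proof (cases "i = j")
    case False
    have "(\<lambda>k. \<delta> i k + \<delta> j k) i \<noteq> 0" by (simp add: \<delta>_def)
    then have "(\<lambda>k. \<delta> i k + \<delta> j k) \<noteq> (\<lambda>_. 0)" by meson
    then obtain z where z: "\<And>a b. \<Phi> (\<lambda>k. \<delta> i k + \<delta> j k) y a b = A (\<lambda>k. \<delta> i k + \<delta> j k) a * z b"
      using ex by blast
    have eq: "A (\<delta> i) a * (T i y b - z b) = A (\<delta> j) a * (z b - T j y b)" for a
      using z[of a b] by (simp add: \<Phi>add Aadd T algebra_simps)
    have "T i y b - z b = 0"
    proof (rule ccontr)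
      assume ne: "T i y b - z b \<noteq> 0"
      then have "A (\<delta> i) a = (z b - T j y b) / (T i y b - z b) * A (\<delta> j) a" for a
        using eq[of a] by (simp add: field_simps)
      then have "parallel (A (\<delta> j)) (A (\<delta> i))" by (rule parallel_scale)
      then show False using indep[OF False] parallel_sym by blast
    qed
    moreover have "z b - T j y b = 0"
    proof (rule ccontr)
      assume ne: "z b - T j y b \<noteq> 0"
      then have "A (\<delta> j) a = (T i y b - z b) / (z b - T j y b) * A (\<delta> i) a" for a
        using eq[of a] by (simp add: field_simps)
      then have "parallel (A (\<delta> i)) (A (\<delta> j))" by (rule parallel_scale)
      then show False using indep[OF False] by blast
    qed
    ultimately show ?thesis by simp
  qed simp
  have "K i y a b = A (\<delta> i) a * T p y b" for i y a b
    using T[of i y a b] same[of i y b p] by (simp add: \<Phi>\<delta>)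
  then show ?thesis by (intro exI[of _ "\<lambda>i. A (\<delta> i)"] exI[of _ "T p"]) blast
qed

section \<open>Linear maps preserving the cone of rank-one tuples\<close>

definition tensor :: "('n \<Rightarrow> complex) \<Rightarrow> ('m \<Rightarrow> 'n \<Rightarrow> complex) \<Rightarrow> complex^'n^'n^'m" where
  "tensor u y = (\<chi> k i j. u i * y k j)"

definition column_space :: "('n \<Rightarrow> complex) \<Rightarrow> (complex^'n^'n^'m) set" where
  "column_space u = range (tensor u)"

definition row_space :: "('n \<Rightarrow> complex) \<Rightarrow> (complex^'n^'n^'m) set" where
  "row_space u = tuple_transpose ` column_space u"

text \<open>The critical tuples, as \<open>rank_one_cone_iff\<close> will show. These are not just
  the rank-one tensors in three factors: rank at most one is required in one of the two flattenings
  that split off a column or a row index, never in the one that splits off the position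
  \<open>k\<close>.\<close>

definition rank_one_cone :: "(complex^'n^'n^'m) set" where
  "rank_one_cone = (\<Union>u. column_space u \<union> row_space u)"

lemma tensor_nth [simp]: "tensor u y $ k $ i $ j = u i * y k j"
  by (simp add: tensor_def)

lemma tuple_transpose_nth [simp]: "tuple_transpose X $ k $ i $ j = X $ k $ j $ i"
  by (simp add: tuple_transpose_def transpose_def)

lemma tscale_nth [simp]: "tscale c X $ k $ i $ j = c * X $ k $ i $ j"
  by (simp add: tscale_def mscale_def)

lemma tuple_transpose_idem [simp]: "tuple_transpose (tuple_transpose X) = X"
  by (simp add: vec_eq_iff)

lemma mem_column_space_iff: "X \<in> column_space u \<longleftrightarrow> (\<exists>y. \<forall>k i j. X $ k $ i $ j = u i * y k j)"
  by (auto simp: column_space_def vec_eq_iff image_iff)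

lemma mem_row_space_iff: "X \<in> row_space u \<longleftrightarrow> tuple_transpose X \<in> column_space u"
  unfolding row_space_def by (metis (no_types, lifting) imageE imageI tuple_transpose_idem)

lemma transpose_row_space: "tuple_transpose ` row_space u = column_space u"
  by (simp add: row_space_def image_image)

lemma transpose_mem_rank_one_cone_iff: "tuple_transpose X \<in> rank_one_cone \<longleftrightarrow> X \<in> rank_one_cone"
  by (auto simp: rank_one_cone_def mem_row_space_iff)

lemma column_space_scale:
  assumes "c \<noteq> 0"
  shows "column_space (\<lambda>i. c * u i) = column_space u"
proof -
  have "tensor (\<lambda>i. c * u i) y \<in> range (tensor u)" for y
    by (rule range_eqI[of _ _ "\<lambda>k j. c * y k j"]) (simp add: vec_eq_iff)
  moreover have "tensor u y \<in> range (tensor (\<lambda>i. c * u i))" for y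
    by (rule range_eqI[of _ _ "\<lambda>k j. y k j / c"]) (use assms in \<open>simp add: vec_eq_iff\<close>)
  ultimately show ?thesis unfolding column_space_def by blast
qed

lemma column_space_parallel:
  assumes "parallel u v" "u \<noteq> (\<lambda>_. 0)" "v \<noteq> (\<lambda>_. 0)"
  shows "column_space u = column_space v"
proof -
  obtain c where c: "v = (\<lambda>a. c * u a)" using assms(1,2) by (rule parallelE)
  then have "c \<noteq> 0" using assms(3) by auto
  then show ?thesis by (simp add: c column_space_scale)
qed

lemma column_space_Int:
  assumes "X \<in> column_space u" "X \<in> column_space v" "X \<noteq> 0"
  shows "parallel u v"
proof -
  obtain y z where y: "\<And>k i j. X $ k $ i $ j = u i * y k j" and z: "\<And>k i j. X $ k $ i $ j = v i * z k j"
    using assms(1,2) unfolding mem_column_space_iff by blast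
  obtain k i j where "X $ k $ i $ j \<noteq> 0" using assms(3) by (auto simp: vec_eq_iff)
  then have "y k j \<noteq> 0" using y by auto
  then have "u a = z k j / y k j * v a" for a
    using y[of k a j] z[of k a j] by (simp add: field_simps)
  then show ?thesis by (intro parallel_sym[OF parallel_scale])
qed

lemma column_space_eq_iff:
  assumes "u \<noteq> (\<lambda>_. 0)" "v \<noteq> (\<lambda>_. 0)"
  shows "(column_space u :: (complex^'n^'n^'m) set) = column_space v \<longleftrightarrow> parallel u v"
proof
  assume eq: "(column_space u :: (complex^'n^'n^'m) set) = column_space v"
  let ?X = "tensor u (\<lambda>_ _. 1) :: complex^'n^'n^'m"
  have "?X \<in> column_space u" by (simp add: column_space_def)
  moreover have "?X \<noteq> 0" using assms(1) by (auto simp: vec_eq_iff)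
  ultimately show "parallel u v" using eq column_space_Int by blast
qed (use column_space_parallel assms in blast)

text \<open>This incidence tells the two kinds apart: column spaces of nonparallel vectors meet only
  in zero.\<close>

lemma column_Int_row:
  assumes "u \<noteq> (\<lambda>_. 0)" "v \<noteq> (\<lambda>_. 0)"
  obtains X :: "complex^'n^'n^'m" where "X \<in> column_space u" "X \<in> row_space v" "X \<noteq> 0"
proof
  let ?X = "tensor u (\<lambda>_. v) :: complex^'n^'n^'m"
  show "?X \<in> column_space u" by (simp add: column_space_def)
  have "tuple_transpose ?X = tensor v (\<lambda>_. u)" by (simp add: vec_eq_iff)
  then show "?X \<in> row_space v" by (simp add: mem_row_space_iff column_space_def)
  obtain i j where "u i \<noteq> 0" "v j \<noteq> 0" using assms by (metis ext)
  then have "?X $ k $ i $ j \<noteq> 0" for k by simp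
  then show "?X \<noteq> 0" by (metis zero_index)
qed

text \<open>The column space contains tuples built from \<open>u\<close> and an arbitrary row,
  whereas \<open>v\<close> prescribes the row up to a scalar; the indices \<open>p\<close> and
  \<open>q\<close> provide two independent rows.\<close>

lemma not_column_subset_row:
  assumes u: "u \<noteq> (\<lambda>_. 0)" and pq: "p \<noteq> (q :: 'n::finite)"
  shows "\<not> (column_space u :: (complex^'n^'n^'m) set) \<subseteq> row_space v"
proof
  assume sub: "(column_space u :: (complex^'n^'n^'m) set) \<subseteq> row_space v"
  have *: "parallel v y" if "y \<noteq> (\<lambda>_. 0)" for y
  proof -
    let ?X = "tensor u (\<lambda>_. y) :: complex^'n^'n^'m"
    have "?X \<in> column_space u" by (simp add: column_space_def)
    then have 1: "tuple_transpose ?X \<in> column_space v" using sub mem_row_space_iff by blast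
    have 2: "tuple_transpose ?X \<in> column_space y"
      by (auto simp: mem_column_space_iff intro!: exI[of _ "\<lambda>_. u"])
    obtain i j where "u i \<noteq> 0" "y j \<noteq> 0" using u \<open>y \<noteq> (\<lambda>_. 0)\<close> by (metis ext)
    then have "tuple_transpose ?X $ k $ j $ i \<noteq> 0" for k by simp
    then have "tuple_transpose ?X \<noteq> 0" by (metis zero_index)
    then show ?thesis using column_space_Int 1 2 by blast
  qed
  have v: "v \<noteq> (\<lambda>_. 0)"
  proof
    assume v0: "v = (\<lambda>_. 0)"
    let ?X = "tensor u (\<lambda>_ _. 1) :: complex^'n^'n^'m"
    have "?X \<in> column_space u" by (simp add: column_space_def)
    then have "?X \<in> row_space v" using sub by blast
    then have "u i = 0" for i by (simp add: v0 mem_row_space_iff mem_column_space_iff)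
    then show False using u by blast
  qed
  let ?d = "\<lambda>p i. if i = p then 1 else 0 :: complex"
  have "?d p \<noteq> (\<lambda>_. 0)" "?d q \<noteq> (\<lambda>_. 0)" by (auto simp: fun_eq_iff)
  then have "parallel (?d p) (?d q)" using * parallel_trans[OF parallel_sym _ v] by blast
  then have "?d p p * ?d q q = ?d p q * ?d q p" unfolding parallel_def by blast
  then show False using pq by simp
qed

lemma row_eq_column:
  assumes "u \<noteq> (\<lambda>_. 0)" "p \<noteq> (q :: 'n::finite)"
  shows "(column_space u :: (complex^'n^'n^'m) set) \<noteq> row_space v"
  using not_column_subset_row[OF assms] by blast

section \<open>Images of column spaces under cone-preserving bijections\<close>

locale cone_preserver =
  fixes g :: "complex^'n::finite^'n^'m::finite \<Rightarrow> complex^'n^'n^'m"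
  assumes linear: "Vector_Spaces.linear tscale tscale g" and bij: "bij g"
    and cone: "\<And>X. g X \<in> rank_one_cone \<longleftrightarrow> X \<in> rank_one_cone"
begin

sublocale linear: Vector_Spaces.linear tscale tscale g by (rule linear)

lemma g_eq_0_iff [simp]: "g X = 0 \<longleftrightarrow> X = 0"
  using bij linear.zero by (metis bij_pointE)

lemma cone_preserver_inv: "cone_preserver (inv_into UNIV g)"
proof
  have gi: "g (inv_into UNIV g X) = X" for X using bij by (simp add: bij_is_surj surj_f_inv_f)
  have ig: "inv_into UNIV g (g X) = X" for X using bij by (simp add: bij_is_inj)
  show "inv_into UNIV g (X + Y) = inv_into UNIV g X + inv_into UNIV g Y" for X Y by (metis gi ig linear.add)
  show "inv_into UNIV g (tscale c X) = tscale c (inv_into UNIV g X)" for c X by (metis gi ig linear.scale)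
  show "bij (inv_into UNIV g)" using bij by (rule bij_imp_bij_inv)
  show "inv_into UNIV g X \<in> rank_one_cone \<longleftrightarrow> X \<in> rank_one_cone" for X using cone[of "inv_into UNIV g X"] gi by simp
qed

text \<open>Composing with the transpose on either side exchanges the two kinds, so that results
  about column spaces yield their counterparts for row spaces.\<close>

lemma cone_preserver_transpose_left: "cone_preserver (\<lambda>X. tuple_transpose (g X))"
proof
  show "tuple_transpose (g (X + Y)) = tuple_transpose (g X) + tuple_transpose (g Y)" for X Y
    by (simp add: linear.add vec_eq_iff)
  show "tuple_transpose (g (tscale c X)) = tscale c (tuple_transpose (g X))" for c X
    by (simp add: linear.scale vec_eq_iff)
  have "bij tuple_transpose" by (rule involuntory_imp_bij) simp
  then show "bij (\<lambda>X. tuple_transpose (g X))" using bij_comp[OF bij] by (simp add: o_def)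
  show "tuple_transpose (g X) \<in> rank_one_cone \<longleftrightarrow> X \<in> rank_one_cone" for X
    by (simp add: transpose_mem_rank_one_cone_iff cone)
qed

lemma cone_preserver_transpose_right: "cone_preserver (\<lambda>X. g (tuple_transpose X))"
proof
  have "tuple_transpose (X + Y) = tuple_transpose X + tuple_transpose Y" for X Y :: "complex^'n^'n^'m"
    by (simp add: vec_eq_iff)
  then show "g (tuple_transpose (X + Y)) = g (tuple_transpose X) + g (tuple_transpose Y)" for X Y
    by (simp add: linear.add)
  have "tuple_transpose (tscale c X) = tscale c (tuple_transpose X)" for c and X :: "complex^'n^'n^'m"
    by (simp add: vec_eq_iff)
  then show "g (tuple_transpose (tscale c X)) = tscale c (g (tuple_transpose X))" for c X
    by (simp add: linear.scale)
  have "bij tuple_transpose" by (rule involuntory_imp_bij) simp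
  then show "bij (\<lambda>X. g (tuple_transpose X))" using bij_comp[OF _ bij] by (simp add: o_def)
  show "g (tuple_transpose X) \<in> rank_one_cone \<longleftrightarrow> X \<in> rank_one_cone" for X
    by (simp add: transpose_mem_rank_one_cone_iff cone)
qed

text \<open>The image is a linear space inside the union of two cones, each cut out by quadratic
  minors. If neither cone contained it, the line through a member outside the first in the direction
  of a member outside the second would leave both for some parameter, as a nonzero polynomial has a
  non-root.\<close>

lemma image_column_space_or:
  "g ` column_space u \<subseteq> (\<Union>v. column_space v) \<or> g ` column_space u \<subseteq> (\<Union>v. row_space v)"
proof (rule ccontr)
  let ?W = "g ` column_space u"
  assume "\<not> ?thesis"
  then obtain A B where A: "A \<in> ?W" "A \<notin> (\<Union>v. row_space v)" and B: "B \<in> ?W" "B \<notin> (\<Union>v. column_space v)"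
    by blast
  have col: "X \<in> (\<Union>v. column_space v) \<longleftrightarrow>
      (\<forall>i i' k k' j j'. X $ k $ i $ j * X $ k' $ i' $ j' = X $ k' $ i $ j' * X $ k $ i' $ j)" for X :: "complex^'n^'n^'m"
  proof -
    have "X \<in> (\<Union>v. column_space v) \<longleftrightarrow> rank_le_one (\<lambda>i (k, j). X $ k $ i $ j)"
    proof
      assume "X \<in> (\<Union>v. column_space v)"
      then obtain v where "X \<in> column_space v" by blast
      then obtain y where "\<And>k i j. X $ k $ i $ j = v i * y k j" unfolding mem_column_space_iff by blast
      then show "rank_le_one (\<lambda>i (k, j). X $ k $ i $ j)"
        unfolding rank_le_one_def by (intro exI[of _ v] exI[of _ "\<lambda>(k, j). y k j"]) auto
    next
      assume "rank_le_one (\<lambda>i (k, j). X $ k $ i $ j)"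
      then obtain v y where vy: "\<And>i b. (case b of (k, j) \<Rightarrow> X $ k $ i $ j) = v i * y b"
        unfolding rank_le_one_def by blast
      have "X $ k $ i $ j = v i * y (k, j)" for k i j using vy[of i "(k, j)"] by simp
      then have "X \<in> column_space v" unfolding mem_column_space_iff by (intro exI[of _ "\<lambda>k j. y (k, j)"]) blast
      then show "X \<in> (\<Union>v. column_space v)" by blast
    qed
    then show ?thesis by (auto simp: rank_le_one_iff_minors)
  qed
  have row: "X \<in> (\<Union>v. row_space v) \<longleftrightarrow>
      (\<forall>i i' k k' j j'. X $ k $ j $ i * X $ k' $ j' $ i' = X $ k' $ j' $ i * X $ k $ j $ i')" for X :: "complex^'n^'n^'m"
    using col[of "tuple_transpose X"] by (simp add: mem_row_space_iff)
  obtain a a' b b' c c' where A': "A $ b $ c $ a * A $ b' $ c' $ a' \<noteq> A $ b' $ c' $ a * A $ b $ c $ a'"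
    using A(2) unfolding row by blast
  obtain i i' k k' j j' where B': "B $ k $ i $ j * B $ k' $ i' $ j' \<noteq> B $ k' $ i $ j' * B $ k $ i' $ j"
    using B(2) unfolding col by blast
  \<comment> \<open>\<open>p\<close> and \<open>q\<close> are minors of \<open>A + s B\<close>, as polynomials in \<open>s\<close>, for the two kinds of tuples.\<close>
  define p where "p = [:A $ k $ i $ j, B $ k $ i $ j:] * [:A $ k' $ i' $ j', B $ k' $ i' $ j':]
    - [:A $ k' $ i $ j', B $ k' $ i $ j':] * [:A $ k $ i' $ j, B $ k $ i' $ j:]"
  define q where "q = [:A $ b $ c $ a, B $ b $ c $ a:] * [:A $ b' $ c' $ a', B $ b' $ c' $ a':]
    - [:A $ b' $ c' $ a, B $ b' $ c' $ a:] * [:A $ b $ c $ a', B $ b $ c $ a':]"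
  \<comment> \<open>The minor of \<open>B\<close> is the coefficient of \<open>s^2\<close> in
    \<open>p\<close>, and the minor of \<open>A\<close> is the constant coefficient of
    \<open>q\<close>.\<close>
  have "Polynomial.coeff p 2 \<noteq> 0" using B' by (simp add: p_def numeral_2_eq_2 mult.commute)
  moreover have "Polynomial.coeff q 0 \<noteq> 0" using A' by (simp add: q_def mult.commute)
  ultimately have "p * q \<noteq> 0" by auto
  then obtain s where "poly (p * q) s \<noteq> 0" using poly_all_0_iff_0 by blast
  then have s: "poly p s \<noteq> 0" "poly q s \<noteq> 0" by simp_all
  let ?X = "A + tscale s B"
  have "?X \<in> ?W"
  proof -
    obtain x y where "A = g (tensor u x)" "B = g (tensor u y)"
      using A(1) B(1) by (auto simp: column_space_def)
    then have "?X = g (tensor u x + tscale s (tensor u y))" by (simp add: linear.add linear.scale)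
    also have "tensor u x + tscale s (tensor u y) = tensor u (\<lambda>k j. x k j + s * y k j)"
      by (simp add: vec_eq_iff algebra_simps)
    finally show ?thesis by (simp add: column_space_def)
  qed
  then have "?X \<in> rank_one_cone" using cone by (auto simp: rank_one_cone_def)
  moreover have "?X \<notin> (\<Union>v. column_space v)"
  proof
    assume "?X \<in> (\<Union>v. column_space v)"
    then have "?X $ k $ i $ j * ?X $ k' $ i' $ j' = ?X $ k' $ i $ j' * ?X $ k $ i' $ j" unfolding col by blast
    then show False using s(1) by (simp add: p_def algebra_simps)
  qed
  moreover have "?X \<notin> (\<Union>v. row_space v)"
  proof
    assume "?X \<in> (\<Union>v. row_space v)"
    then have "?X $ b $ c $ a * ?X $ b' $ c' $ a' = ?X $ b' $ c' $ a * ?X $ b $ c $ a'" unfolding row by blast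
    then show False using s(2) by (simp add: q_def algebra_simps)
  qed
  ultimately show False by (auto simp: rank_one_cone_def)
qed

text \<open>Flattened with \<open>i\<close> as row index and \<open>(k, j)\<close> as column index,
  the image is a space of matrices of rank at most one. A common left factor gives a column space; a
  common right factor is possible only for one-element tuples, where it gives a row space.\<close>

lemma image_column_space_if_column:
  assumes u: "u \<noteq> (\<lambda>_. 0)" and sub: "g ` column_space u \<subseteq> (\<Union>v. column_space v)"
  shows "\<exists>v. g ` column_space u \<subseteq> column_space v \<or> g ` column_space u \<subseteq> row_space v"
proof -
  let ?f = "\<lambda>X i (k, j). X $ k $ i $ j :: complex"
  let ?W = "?f ` g ` column_space u"
  have "(\<exists>u. \<forall>M\<in>?W. \<exists>y. \<forall>a b. M a b = u a * y b) \<or> (\<exists>y. \<forall>M\<in>?W. \<exists>u. \<forall>a b. M a b = u a * y b)"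
  proof (rule rank_le_one_space)
    fix M N assume "M \<in> ?W" "N \<in> ?W"
    then obtain x y where "M = ?f (g (tensor u x))" "N = ?f (g (tensor u y))"
      unfolding column_space_def by blast
    then have "(\<lambda>a b. M a b + N a b) = ?f (g (tensor u x + tensor u y))"
      by (auto simp: linear.add fun_eq_iff)
    also have "tensor u x + tensor u y = tensor u (\<lambda>k j. x k j + y k j)"
      by (simp add: vec_eq_iff algebra_simps)
    finally show "(\<lambda>a b. M a b + N a b) \<in> ?W" unfolding column_space_def by blast
  next
    fix M assume "M \<in> ?W"
    then obtain X v where X: "M = ?f X" "X \<in> column_space v" using sub by blast
    then obtain y where "\<And>k i j. X $ k $ i $ j = v i * y k j" unfolding mem_column_space_iff by blast
    then show "rank_le_one M" unfolding rank_le_one_def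
      by (intro exI[of _ v] exI[of _ "\<lambda>(k, j). y k j"]) (auto simp: X)
  qed
  then consider (1) v where "\<forall>M\<in>?W. \<exists>y. \<forall>a b. M a b = v a * y b"
    | (2) y where "\<forall>M\<in>?W. \<exists>w. \<forall>a b. M a b = w a * y b"
    by blast
  then show ?thesis
  proof cases
    case 1
    have "g ` column_space u \<subseteq> column_space v"
    proof
      fix X assume X: "X \<in> g ` column_space u"
      obtain y where y: "\<And>a b. ?f X a b = v a * y b" using bspec[OF 1 imageI[OF X]] by blast
      have "X $ k $ i $ j = v i * y (k, j)" for k i j using y[of i "(k, j)"] by simp
      then show "X \<in> column_space v" unfolding mem_column_space_iff by (intro exI[of _ "\<lambda>k j. y (k, j)"]) blast
    qed
    then show ?thesis by blast
  next
    case 2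
    have w: "\<exists>w. \<forall>k i j. X $ k $ i $ j = w i * y (k, j)" if X: "X \<in> g ` column_space u" for X
    proof -
      obtain w where w: "\<And>a b. ?f X a b = w a * y b" using bspec[OF 2 imageI[OF X]] by blast
      have "X $ k $ i $ j = w i * y (k, j)" for k i j using w[of i "(k, j)"] by simp
      then show ?thesis by blast
    qed
    interpret h: cone_preserver "inv_into UNIV g" by (rule cone_preserver_inv)
    obtain i0 where i0: "u i0 \<noteq> 0" using u by auto
    \<comment> \<open>The image of the \<open>mn\<close>-dimensional column space has dimension at most \<open>n\<close>, so \<open>m = 1\<close>.\<close>
    define R :: "complex^'n \<Rightarrow> complex^'n^'n^'m" where "R w = (\<chi> k i j. w $ i * y (k, j))" for w
    \<comment> \<open>Dividing the entries in row \<open>i0\<close> by \<open>u i0\<close> recovers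
      \<open>y\<close> from \<open>tensor u y\<close>, so \<open>f\<close> reaches every
      \<open>T\<close>. The comparison is one of real dimensions, which doubles both sides.\<close>
    define f :: "complex^'n \<Rightarrow> complex^'n^'m" where
      "f w = (\<chi> k j. inv_into UNIV g (R w) $ k $ i0 $ j / u i0)" for w
    have f: "Real_Vector_Spaces.linear f"
    proof (rule linearI)
      fix w w' :: "complex^'n" and r :: real
      have R_add: "R (w + w') = R w + R w'"
        by (simp add: R_def vec_eq_iff algebra_simps)
      show "f (w + w') = f w + f w'"
        by (simp add: f_def R_add h.linear.add vec_eq_iff add_divide_distrib)
      have R_scale: "R (r *\<^sub>R w) = tscale (of_real r) (R w)"
        by (simp add: R_def vec_eq_iff) (simp add: scaleR_conv_of_real)
      show "f (r *\<^sub>R w) = r *\<^sub>R f w"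
        by (simp add: f_def R_scale h.linear.scale vec_eq_iff) (simp add: scaleR_conv_of_real)
    qed
    obtain \<omega> where \<omega>: "\<And>X k i j. X \<in> g ` column_space u \<Longrightarrow> X $ k $ i $ j = \<omega> X i * y (k, j)"
      using w by metis
    have "f (\<chi> i. \<omega> (g (tensor u (\<lambda>k j. T $ k $ j))) i) = T" for T
    proof -
      let ?X = "tensor u (\<lambda>k j. T $ k $ j)"
      have "g ?X \<in> g ` column_space u" by (simp add: column_space_def)
      from \<omega>[OF this] have "R (\<chi> i. \<omega> (g ?X) i) = g ?X"
        by (simp add: vec_eq_iff R_def)
      then have "inv_into UNIV g (R (\<chi> i. \<omega> (g ?X) i)) = ?X"
        using bij by (metis bij_is_inj inv_f_f)
      then show ?thesis
        using i0 by (simp add: f_def vec_eq_iff)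
    qed
    then have "surj f" by (rule surjI)
    with f have "DIM(complex^'n^'m) \<le> DIM(complex^'n)"
      using dim_image_le[of f UNIV] by simp
    then have "CARD('m) \<le> 1" by simp
    then have m1: "k = l" for k l :: 'm
      by (metis (full_types) One_nat_def UNIV_I card_le_Suc0_iff_eq finite)
    have "g ` column_space u \<subseteq> row_space (\<lambda>j. y (undefined, j))"
    proof
      fix X assume "X \<in> g ` column_space u"
      then obtain w' where "\<And>k i j. X $ k $ i $ j = w' i * y (k, j)" using w by blast
      then have "X $ k $ i $ j = y (undefined, j) * w' i" for k i j
        using m1[of k undefined] by (simp add: mult.commute)
      then show "X \<in> row_space (\<lambda>j. y (undefined, j))"
        unfolding mem_row_space_iff mem_column_space_iff by (intro exI[of _ "\<lambda>k. w'"]) simp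
    qed
    then show ?thesis by blast
  qed
qed

lemma image_column_space_subset:
  assumes u: "u \<noteq> (\<lambda>_. 0)"
  shows "\<exists>v. v \<noteq> (\<lambda>_. 0) \<and> (g ` column_space u \<subseteq> column_space v \<or> g ` column_space u \<subseteq> row_space v)"
proof -
  have "\<exists>v. g ` column_space u \<subseteq> column_space v \<or> g ` column_space u \<subseteq> row_space v"
  proof (cases "g ` column_space u \<subseteq> (\<Union>v. column_space v)")
    case True
    then show ?thesis using image_column_space_if_column u by blast
  next
    case False
    interpret t: cone_preserver "\<lambda>X. tuple_transpose (g X)" by (rule cone_preserver_transpose_left)
    have "g ` column_space u \<subseteq> (\<Union>v. row_space v)" using False image_column_space_or by blast
    then have "(\<lambda>X. tuple_transpose (g X)) ` column_space u \<subseteq> (\<Union>v. column_space v)"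
      by (fastforce simp: mem_row_space_iff)
    from t.image_column_space_if_column[OF u this] show ?thesis
      by (auto simp: image_subset_iff mem_row_space_iff)
  qed
  then obtain v where v: "g ` column_space u \<subseteq> column_space v \<or> g ` column_space u \<subseteq> row_space v" by blast
  have "v \<noteq> (\<lambda>_. 0)"
  proof
    assume v0: "v = (\<lambda>_. 0)"
    let ?X = "tensor u (\<lambda>_ _. 1) :: complex^'n^'n^'m"
    have "?X \<in> column_space u" by (simp add: column_space_def)
    then have "g ?X \<in> column_space v \<or> tuple_transpose (g ?X) \<in> column_space v"
      using v by (auto simp: mem_row_space_iff)
    then have "g ?X = 0" by (auto simp: v0 mem_column_space_iff vec_eq_iff)
    then have "?X = 0" by simp
    then show False using u by (auto simp: vec_eq_iff)
  qed
  with v show ?thesis by blast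
qed

text \<open>A maximality argument: the inverse of \<open>g\<close> maps
  \<open>column_space v\<close> into a single column or row space containing
  \<open>column_space u\<close>, and for \<open>n > 1\<close> this can only be
  \<open>column_space u\<close> itself.\<close>

lemma image_column_space_eq:
  assumes pq: "p \<noteq> (q :: 'n)" and u: "u \<noteq> (\<lambda>_. 0)"
    and sub: "g ` column_space u \<subseteq> column_space v" and v: "v \<noteq> (\<lambda>_. 0)"
  shows "g ` column_space u = column_space v"
proof -
  interpret h: cone_preserver "inv_into UNIV g" by (rule cone_preserver_inv)
  have gi: "g (inv_into UNIV g X) = X" for X using bij by (simp add: bij_is_surj surj_f_inv_f)
  have ig: "inv_into UNIV g (g X) = X" for X using bij by (simp add: bij_is_inj)
  obtain w where w: "w \<noteq> (\<lambda>_. 0)" "inv_into UNIV g ` column_space v \<subseteq> column_space w \<or> inv_into UNIV g ` column_space v \<subseteq> row_space w"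
    using h.image_column_space_subset[OF v] by blast
  have "column_space u \<subseteq> inv_into UNIV g ` column_space v"
  proof
    fix X :: "complex^'n^'n^'m" assume "X \<in> column_space u"
    then have "g X \<in> column_space v" using sub by blast
    then show "X \<in> inv_into UNIV g ` column_space v" using ig[of X] by (metis imageI)
  qed
  then have w': "inv_into UNIV g ` column_space v \<subseteq> column_space w" "column_space u \<subseteq> (column_space w :: (complex^'n^'n^'m) set)"
    using w(2) not_column_subset_row[OF u pq] by blast+
  let ?X = "tensor u (\<lambda>_ _. 1) :: complex^'n^'n^'m"
  have "?X \<in> column_space u" by (simp add: column_space_def)
  moreover have "?X \<noteq> 0" using u by (auto simp: vec_eq_iff)
  ultimately have "parallel u w" using column_space_Int w'(2) by blast
  then have "column_space w = (column_space u :: (complex^'n^'n^'m) set)" using column_space_parallel u w(1) by blast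
  then have *: "inv_into UNIV g ` column_space v \<subseteq> column_space u" using w'(1) by blast
  have "column_space v \<subseteq> g ` column_space u"
  proof
    fix X :: "complex^'n^'n^'m" assume "X \<in> column_space v"
    then have "inv_into UNIV g X \<in> column_space u" using * by blast
    then show "X \<in> g ` column_space u" using gi[of X] by (metis imageI)
  qed
  then show ?thesis using sub by blast
qed

lemma image_column_space:
  assumes pq: "p \<noteq> (q :: 'n)" and u: "u \<noteq> (\<lambda>_. 0)"
  shows "\<exists>v. v \<noteq> (\<lambda>_. 0) \<and> (g ` column_space u = column_space v \<or> g ` column_space u = row_space v)"
proof -
  obtain v where v: "v \<noteq> (\<lambda>_. 0)" "g ` column_space u \<subseteq> column_space v \<or> g ` column_space u \<subseteq> row_space v"
    using image_column_space_subset[OF u] by blast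
  from v(2) show ?thesis
  proof
    assume "g ` column_space u \<subseteq> column_space v"
    then show ?thesis using image_column_space_eq[OF pq u _ v(1)] v(1) by blast
  next
    assume sub: "g ` column_space u \<subseteq> row_space v"
    interpret t: cone_preserver "\<lambda>X. tuple_transpose (g X)" by (rule cone_preserver_transpose_left)
    have "(\<lambda>X. tuple_transpose (g X)) ` column_space u \<subseteq> column_space v"
      using sub by (auto simp: image_subset_iff mem_row_space_iff)
    from t.image_column_space_eq[OF pq u this v(1)]
    have "tuple_transpose ` (\<lambda>X. tuple_transpose (g X)) ` column_space u = row_space v"
      by (simp add: row_space_def)
    then have "g ` column_space u = row_space v" by (simp add: image_image)
    then show ?thesis using v(1) by blast
  qed
qed

end

section \<open>Coordinates with respect to the standard tensors\<close>

definition unit_fun :: "'a \<Rightarrow> 'a \<Rightarrow> complex" where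
  "unit_fun i = (\<lambda>j. if j = i then 1 else 0)"

definition slice :: "'m \<Rightarrow> ('n \<Rightarrow> complex) \<Rightarrow> 'm \<Rightarrow> 'n \<Rightarrow> complex" where
  "slice l v = (\<lambda>k j. if k = l then v j else 0)"

lemma unit_fun_neq_0: "unit_fun i \<noteq> (\<lambda>_. 0)"
  by (auto simp: unit_fun_def fun_eq_iff)

lemma sum_unit_fun [simp]:
  fixes f :: "'a::finite \<Rightarrow> complex"
  shows "(\<Sum>i\<in>UNIV. f i * unit_fun i j) = f j" "(\<Sum>i\<in>UNIV. unit_fun i j * f i) = f j"
proof -
  have "f i * unit_fun i j = (if j = i then f i else 0)" "unit_fun i j * f i = (if j = i then f i else 0)" for i
    by (simp_all add: unit_fun_def)
  then show "(\<Sum>i\<in>UNIV. f i * unit_fun i j) = f j" "(\<Sum>i\<in>UNIV. unit_fun i j * f i) = f j"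
    by simp_all
qed

lemma tensor_expand: "tensor u y = (\<Sum>i\<in>UNIV. tscale (u i) (tensor (unit_fun i) y))"
  by (simp add: vec_eq_iff flip: mult.assoc sum_distrib_right)

lemma tensor_slice_expand:
  "tensor u (slice l v) = (\<Sum>j\<in>UNIV. tscale (v j) (tensor u (slice l (unit_fun j))))"
proof -
  have "(\<Sum>j\<in>UNIV. v j * (u i * slice l (unit_fun j) k j')) = u i * slice l v k j'" for i k j'
  proof (cases "k = l")
    case True
    have "(\<Sum>j\<in>UNIV. v j * (u i * unit_fun j j')) = u i * (\<Sum>j\<in>UNIV. v j * unit_fun j j')"
      unfolding sum_distrib_left by (simp add: mult_ac)
    then show ?thesis using True by (simp add: slice_def)
  qed (simp add: slice_def)
  then show ?thesis by (simp add: vec_eq_iff)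
qed

lemma tuple_expand:
  "X = (\<Sum>l\<in>UNIV. \<Sum>i\<in>UNIV. \<Sum>j\<in>UNIV. tscale (X $ l $ i $ j) (tensor (unit_fun i) (slice l (unit_fun j))))"
proof -
  have "(\<Sum>l\<in>UNIV. \<Sum>i\<in>UNIV. \<Sum>j\<in>UNIV. X $ l $ i $ j * (unit_fun i i' * slice l (unit_fun j) k j')) = X $ k $ i' $ j'" for k i' j'
  proof -
    have "(\<Sum>l\<in>UNIV. \<Sum>i\<in>UNIV. \<Sum>j\<in>UNIV. X $ l $ i $ j * (unit_fun i i' * slice l (unit_fun j) k j')) =
        (\<Sum>l\<in>UNIV. unit_fun l k * (\<Sum>i\<in>UNIV. unit_fun i i' * (\<Sum>j\<in>UNIV. X $ l $ i $ j * unit_fun j j')))"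
      unfolding sum_distrib_left by (intro sum.cong) (auto simp: slice_def unit_fun_def)
    then show ?thesis by simp
  qed
  then show ?thesis by (simp add: vec_eq_iff)
qed

section \<open>Invertible complex matrices\<close>

lemma invertible_if_ker:
  fixes M :: "complex^'n^'n"
  assumes "\<And>x. M *v x = 0 \<Longrightarrow> x = 0"
  shows "invertible M"
  using assms by (simp add: invertible_left_inverse matrix_left_invertible_ker)

lemma invertible_if_invertible_transpose:
  fixes A :: "complex^'n^'n"
  assumes "invertible (transpose A)"
  shows "invertible A"
proof -
  obtain C where "transpose A ** C = mat 1" using assms unfolding invertible_def by blast
  from arg_cong[OF this, of transpose] have "transpose C ** A = mat 1"
    by (simp add: matrix_transpose_mul transpose_mat)
  then show ?thesis unfolding invertible_left_inverse by blast
qed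

lemma matrix_inv_eqI:
  fixes A B :: "complex^'n^'n"
  assumes "A ** B = mat 1" "B ** A = mat 1"
  shows "matrix_inv A = B"
proof -
  have *: "A ** matrix_inv A = mat 1 \<and> matrix_inv A ** A = mat 1"
    unfolding matrix_inv_def
    by (rule someI[of "\<lambda>A'. A ** A' = mat 1 \<and> A' ** A = mat 1"]) (use assms in blast)
  have "matrix_inv A = matrix_inv A ** (A ** B)" using assms by simp
  also have "\<dots> = B" using * by (simp add: matrix_mul_assoc)
  finally show ?thesis .
qed

lemma matrix_inv_right_left:
  fixes A :: "complex^'n^'n"
  assumes "invertible A"
  shows "A ** matrix_inv A = mat 1" "matrix_inv A ** A = mat 1"
proof -
  obtain B where "A ** B = mat 1" "B ** A = mat 1" using assms unfolding invertible_def by blast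
  with matrix_inv_eqI[OF this] show "A ** matrix_inv A = mat 1" "matrix_inv A ** A = mat 1" by simp_all
qed

lemma invertible_matrix_inv:
  fixes A :: "complex^'n^'n"
  assumes "invertible A" shows "invertible (matrix_inv A)" "matrix_inv (matrix_inv A) = A"
  using matrix_inv_right_left[OF assms] by (auto simp: invertible_def intro: matrix_inv_eqI)

lemma tuple_action_nth:
  "tuple_action P Q R X $ k $ a $ b =
     (\<Sum>l\<in>UNIV. P $ k $ l * (\<Sum>j\<in>UNIV. (\<Sum>i\<in>UNIV. Q $ a $ i * X $ l $ i $ j) * matrix_inv R $ j $ b))"
  by (simp add: tuple_action_def mscale_def matrix_matrix_mult_def)

text \<open>Linearity determines \<open>g\<close> by its values on the basis tensors, which have the
  form of a group action. A kernel vector of one of the three factors, spread constantly over the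
  other two indices, is a tuple killed by \<open>g\<close>; so injectivity of \<open>g\<close> makes
  all factors invertible.\<close>

lemma G_group_if_product_form:
  fixes g :: "complex^'n::finite^'n^'m::finite \<Rightarrow> complex^'n^'n^'m"
  assumes lin: "Vector_Spaces.linear tscale tscale g" and bij: "bij g"
    and form: "\<And>i l j k a b. g (tensor (unit_fun i) (slice l (unit_fun j))) $ k $ a $ b = A i a * (B j b * P l k)"
  shows "g \<in> G_group"
proof -
  interpret linear: Vector_Spaces.linear tscale tscale g by (rule lin)
  have g: "g X $ k $ a $ b = (\<Sum>l\<in>UNIV. P l k * (\<Sum>j\<in>UNIV. (\<Sum>i\<in>UNIV. A i a * X $ l $ i $ j) * B j b))" for X k a b
  proof -
    have "g X = (\<Sum>l\<in>UNIV. \<Sum>i\<in>UNIV. \<Sum>j\<in>UNIV. tscale (X $ l $ i $ j) (g (tensor (unit_fun i) (slice l (unit_fun j)))))"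
      by (subst tuple_expand[of X]) (simp add: linear.sum linear.scale)
    then have "g X $ k $ a $ b = (\<Sum>l\<in>UNIV. \<Sum>i\<in>UNIV. \<Sum>j\<in>UNIV. X $ l $ i $ j * (A i a * (B j b * P l k)))"
      by (simp add: form)
    also have "\<dots> = (\<Sum>l\<in>UNIV. \<Sum>j\<in>UNIV. \<Sum>i\<in>UNIV. X $ l $ i $ j * (A i a * (B j b * P l k)))"
      by (intro sum.cong refl sum.swap)
    also have "\<dots> = (\<Sum>l\<in>UNIV. P l k * (\<Sum>j\<in>UNIV. (\<Sum>i\<in>UNIV. A i a * X $ l $ i $ j) * B j b))"
      by (simp add: sum_distrib_left sum_distrib_right mult_ac)
    finally show ?thesis .
  qed
  have inj: "X = 0" if "\<And>k a b. g X $ k $ a $ b = 0" for X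
  proof -
    have "g X = g 0" using that by (simp add: vec_eq_iff linear.zero)
    then show ?thesis using bij by (metis bij_pointE)
  qed
  let ?P = "\<chi> k l. P l k" and ?Q = "\<chi> a i. A i a" and ?B = "\<chi> j b. B j b"
  have P: "invertible ?P"
  proof (rule invertible_if_ker)
    fix x assume "?P *v x = 0"
    then have x: "(\<Sum>l\<in>UNIV. P l k * x $ l) = 0" for k
      by (simp add: matrix_vector_mult_def vec_eq_iff)
    have "(\<chi> l i j. x $ l :: complex^'n^'n^'m) = 0"
    proof (rule inj)
      fix k a b
      let ?D = "\<Sum>j\<in>UNIV. (\<Sum>i\<in>UNIV. A i a) * B j b"
      have "(\<Sum>j\<in>UNIV. (\<Sum>i\<in>UNIV. A i a * x $ l) * B j b) = x $ l * ?D" for l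
        by (simp add: sum_distrib_left sum_distrib_right mult_ac)
      then have "g (\<chi> l i j. x $ l) $ k $ a $ b = (\<Sum>l\<in>UNIV. P l k * x $ l) * ?D"
        by (simp add: g sum_distrib_right mult_ac)
      then show "g (\<chi> l i j. x $ l) $ k $ a $ b = 0" by (simp add: x)
    qed
    then show "x = 0" by (simp add: vec_eq_iff)
  qed
  have Q: "invertible ?Q"
  proof (rule invertible_if_ker)
    fix x assume "?Q *v x = 0"
    then have x: "(\<Sum>i\<in>UNIV. A i a * x $ i) = 0" for a
      by (simp add: matrix_vector_mult_def vec_eq_iff)
    have "(\<chi> l i j. x $ i :: complex^'n^'n^'m) = 0"
      by (rule inj) (simp add: g x)
    then show "x = 0" by (simp add: vec_eq_iff)
  qed
  have "invertible (transpose ?B)"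
  proof (rule invertible_if_ker)
    fix x assume "transpose ?B *v x = 0"
    then have x: "(\<Sum>j\<in>UNIV. B j b * x $ j) = 0" for b
      by (simp add: matrix_vector_mult_def vec_eq_iff transpose_def)
    have "(\<chi> l i j. x $ j :: complex^'n^'n^'m) = 0"
    proof (rule inj)
      fix k a b
      have "(\<Sum>j\<in>UNIV. (\<Sum>i\<in>UNIV. A i a * x $ j) * B j b) = (\<Sum>i\<in>UNIV. A i a) * (\<Sum>j\<in>UNIV. B j b * x $ j)"
        by (simp add: sum_distrib_left sum_distrib_right mult_ac)
      then show "g (\<chi> l i j. x $ j) $ k $ a $ b = 0" by (simp add: g x)
    qed
    then show "x = 0" by (simp add: vec_eq_iff)
  qed
  then have B: "invertible ?B" by (rule invertible_if_invertible_transpose)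
  \<comment> \<open>The action multiplies by the inverse of its third argument, hence
    \<open>matrix_inv ?B\<close>.\<close>
  have "g = tuple_action ?P ?Q (matrix_inv ?B)"
    using B by (auto simp: fun_eq_iff vec_eq_iff g tuple_action_nth invertible_matrix_inv(2))
  then show ?thesis
    using P Q invertible_matrix_inv(1)[OF B] unfolding G_group_def by blast
qed

lemma row_space_eq_iff:
  assumes "u \<noteq> (\<lambda>_. 0)" "v \<noteq> (\<lambda>_. 0)"
  shows "(row_space u :: (complex^'n^'n^'m) set) = row_space v \<longleftrightarrow> parallel u v"
  using column_space_eq_iff[OF assms, where 'm = 'm] transpose_row_space[where 'a = 'n and 'b = 'm]
  unfolding row_space_def by metis

section \<open>From column and row spaces to a tensor product of three maps\<close>

context cone_preserver
begin

lemma inj_image: "g ` A = g ` B \<longleftrightarrow> A = B"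
  using bij by (simp add: bij_is_inj inj_image_eq_iff)

text \<open>If one column space went to a column space and another to a row space, the images would
  share a nonzero tuple. Its preimage lies in both column spaces, which therefore coincide, but
  their images are of different kinds.\<close>

lemma columns_to_columns:
  assumes pq: "p \<noteq> (q :: 'n)" and w: "w \<noteq> (\<lambda>_. 0)" "g ` column_space w = column_space a" and u: "u \<noteq> (\<lambda>_. 0)"
  shows "\<exists>v. v \<noteq> (\<lambda>_. 0) \<and> g ` column_space u = column_space v"
proof (rule ccontr)
  assume "\<not> ?thesis"
  then obtain b where b: "b \<noteq> (\<lambda>_. 0)" "g ` column_space u = row_space b"
    using image_column_space[OF pq u] by blast
  have a: "a \<noteq> (\<lambda>_. 0)"
  proof
    assume "a = (\<lambda>_. 0)"
    moreover have "g (tensor w (\<lambda>_ _. 1)) \<in> column_space a"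
      using w(2) by (auto simp: column_space_def)
    ultimately have "g (tensor w (\<lambda>_ _. 1)) = 0" by (auto simp: mem_column_space_iff vec_eq_iff)
    then have "tensor w (\<lambda>_ _. 1) = (0 :: complex^'n^'n^'m)" by simp
    then show False using w(1) by (auto simp: vec_eq_iff)
  qed
  obtain X :: "complex^'n^'n^'m" where X: "X \<in> column_space a" "X \<in> row_space b" "X \<noteq> 0"
    using column_Int_row[OF a b(1)] by blast
  obtain Y where Y: "Y \<in> column_space w" "X = g Y" using X(1) w(2) by blast
  obtain Z where Z: "Z \<in> column_space u" "X = g Z" using X(2) b(2) by blast
  have "Y = Z" using Y(2) Z(2) bij by (metis bij_pointE)
  moreover have "Y \<noteq> 0" using X(3) Y(2) by auto
  ultimately have "parallel w u" using column_space_Int Y(1) Z(1) by blast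
  then have "(column_space w :: (complex^'n^'n^'m) set) = column_space u"
    using column_space_parallel w(1) u by blast
  then show False using w(2) b(2) row_eq_column[OF a pq] by metis
qed

text \<open>Suppose a row space went to \<open>column_space v\<close>. Every column space meets that
  row space, so its image meets \<open>column_space v\<close> and must equal it; then all column
  spaces would have the same image.\<close>

lemma rows_to_rows:
  assumes pq: "p \<noteq> (q :: 'n)"
    and col: "\<And>u. u \<noteq> (\<lambda>_. 0) \<Longrightarrow> \<exists>v. v \<noteq> (\<lambda>_. 0) \<and> g ` column_space u = column_space v"
    and u: "u \<noteq> (\<lambda>_. 0)"
  shows "\<exists>v. v \<noteq> (\<lambda>_. 0) \<and> g ` row_space u = row_space v"
proof -
  interpret t: cone_preserver "\<lambda>X. g (tuple_transpose X)" by (rule cone_preserver_transpose_right)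
  have eq: "(\<lambda>X. g (tuple_transpose X)) ` column_space u = g ` row_space u"
    by (simp add: row_space_def image_image)
  obtain v where v: "v \<noteq> (\<lambda>_. 0)" "g ` row_space u = column_space v \<or> g ` row_space u = row_space v"
    using t.image_column_space[OF pq u] unfolding eq by blast
  have "g ` row_space u \<noteq> column_space v"
  proof
    assume cv: "g ` row_space u = column_space v"
    have "g ` column_space w = column_space v" if w: "w \<noteq> (\<lambda>_. 0)" for w
    proof -
      obtain w' where w': "w' \<noteq> (\<lambda>_. 0)" "g ` column_space w = column_space w'" using col[OF w] by blast
      obtain X :: "complex^'n^'n^'m" where X: "X \<in> column_space w" "X \<in> row_space u" "X \<noteq> 0"
        using column_Int_row[OF w u] by blast
      then have "g X \<in> column_space w'" "g X \<in> column_space v" "g X \<noteq> 0" using w'(2) cv by auto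
      then have "parallel w' v" using column_space_Int by blast
      then show ?thesis using column_space_parallel[OF _ w'(1) v(1)] w'(2) by simp
    qed
    from this[OF unit_fun_neq_0[of p]] this[OF unit_fun_neq_0[of q]]
    have "g ` column_space (unit_fun p) = g ` column_space (unit_fun q)" by simp
    then have "parallel (unit_fun p) (unit_fun q)"
      unfolding inj_image column_space_eq_iff[OF unit_fun_neq_0 unit_fun_neq_0] .
    then have "unit_fun p p * unit_fun q q = unit_fun p q * unit_fun q p" unfolding parallel_def by blast
    then show False using pq by (simp add: unit_fun_def)
  qed
  then show ?thesis using v by blast
qed

text \<open>\<open>bilinear_factorization\<close> is applied twice: column spaces split off the
  factor \<open>A\<close>, and row spaces then split the remaining map \<open>T\<close> into
  \<open>B\<close> and \<open>P\<close>.\<close>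

lemma product_form:
  assumes pq: "p \<noteq> (q :: 'n)"
    and col: "\<And>u. u \<noteq> (\<lambda>_. 0) \<Longrightarrow> \<exists>v. v \<noteq> (\<lambda>_. 0) \<and> g ` column_space u = column_space v"
  shows "\<exists>A B P. \<forall>i l j k a b. g (tensor (unit_fun i) (slice l (unit_fun j))) $ k $ a $ b = A i a * (B j b * P l k)"
proof -
  obtain \<alpha> where \<alpha>: "\<And>u. u \<noteq> (\<lambda>_. 0) \<Longrightarrow> \<alpha> u \<noteq> (\<lambda>_. 0) \<and> g ` column_space u = column_space (\<alpha> u)"
    using col by metis
  obtain \<beta> where \<beta>: "\<And>u. u \<noteq> (\<lambda>_. 0) \<Longrightarrow> \<beta> u \<noteq> (\<lambda>_. 0) \<and> g ` row_space u = row_space (\<beta> u)"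
    using rows_to_rows[OF pq col] by metis
  define K where "K i y a = (\<lambda>(k, j). g (tensor (unit_fun i) y) $ k $ a $ j)" for i y a
  have K: "(\<Sum>i\<in>UNIV. u i * K i y a (k, j)) = g (tensor u y) $ k $ a $ j" for u y a k j
  proof -
    have "g (tensor u y) = (\<Sum>i\<in>UNIV. tscale (u i) (g (tensor (unit_fun i) y)))"
      by (subst tensor_expand) (simp add: linear.sum linear.scale)
    then show ?thesis by (simp add: K_def)
  qed
  have nz: "\<exists>k a b. g X $ k $ a $ b \<noteq> 0" if "X \<noteq> 0" for X
  proof -
    have "g X \<noteq> 0" using that by simp
    then show ?thesis by (auto simp: vec_eq_iff)
  qed
  have "\<exists>A T. \<forall>i y a b. K i y a b = A i a * T y b"
  proof (rule bilinear_factorization[OF _ _ _ _ pq])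
    fix u y assume u: "u \<noteq> (\<lambda>_ :: 'n. 0 :: complex)"
    have "g (tensor u y) \<in> column_space (\<alpha> u)" using \<alpha>[OF u] by (auto simp: column_space_def)
    then obtain z where "\<And>k i j. g (tensor u y) $ k $ i $ j = \<alpha> u i * z k j" unfolding mem_column_space_iff by blast
    then show "\<exists>z. \<forall>a b. (\<Sum>i\<in>UNIV. u i * K i y a b) = \<alpha> u a * z b"
      by (intro exI[of _ "\<lambda>(k, j). z k j"]) (auto simp: K)
  next
    fix u assume u: "u \<noteq> (\<lambda>_ :: 'n. 0 :: complex)"
    then show "\<alpha> u \<noteq> (\<lambda>_. 0)" using \<alpha> by blast
    have "tensor u (\<lambda>_ _. 1) \<noteq> (0 :: complex^'n^'n^'m)" using u by (auto simp: vec_eq_iff)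
    from nz[OF this] obtain k a b where "g (tensor u (\<lambda>_ _. 1)) $ k $ a $ b \<noteq> 0" by blast
    then show "\<exists>a b. (\<Sum>i\<in>UNIV. u i * K i (\<lambda>_ _. 1) a b) \<noteq> 0" by (intro exI[of _ a] exI[of _ "(k, b)"]) (simp add: K)
  next
    fix u v assume uv: "u \<noteq> (\<lambda>_ :: 'n. 0 :: complex)" "v \<noteq> (\<lambda>_. 0)" "parallel (\<alpha> u) (\<alpha> v)"
    then have "g ` column_space u = g ` column_space v"
      using \<alpha> column_space_parallel by metis
    then show "parallel u v" unfolding inj_image column_space_eq_iff[OF uv(1,2)] .
  qed
  then obtain A T where "\<And>i y a b. K i y a b = A i a * T y b" by blast
  then have AT: "g (tensor (unit_fun i) y) $ k $ a $ j = A i a * T y (k, j)" for i y a k j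
    by (metis K_def case_prod_conv)
  \<comment> \<open>Now the row index \<open>j\<close> is the linear variable and the position
    \<open>l\<close> the parameter.\<close>
  define K' where "K' j l b k = T (slice l (unit_fun j)) (k, b)" for j l b k
  have K': "A p a * (\<Sum>j\<in>UNIV. v j * K' j l b k) = g (tensor (unit_fun p) (slice l v)) $ k $ a $ b" for v l b k a
    by (subst tensor_slice_expand) (simp add: linear.sum linear.scale K'_def AT sum_distrib_left mult_ac)
  \<comment> \<open>Dividing by a nonzero entry of the first factor makes \<open>T\<close> visible
    in the values of \<open>g\<close>.\<close>
  obtain a0 where a0: "A p a0 \<noteq> 0"
  proof -
    have "tensor (unit_fun p) (\<lambda>_ _. 1) \<noteq> (0 :: complex^'n^'n^'m)"
      using unit_fun_neq_0[of p] by (auto simp: vec_eq_iff)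
    from nz[OF this] obtain k a b where "g (tensor (unit_fun p) (\<lambda>_ _. 1)) $ k $ a $ b \<noteq> 0" by blast
    then show thesis using that by (auto simp: AT)
  qed
  have "\<exists>B P. \<forall>j l b k. K' j l b k = B j b * P l k"
  proof (rule bilinear_factorization[OF _ _ _ _ pq])
    fix v l assume v: "v \<noteq> (\<lambda>_ :: 'n. 0 :: complex)"
    let ?X = "tensor (unit_fun p) (slice l v) :: complex^'n^'n^'m"
    have "?X \<in> row_space v"
      unfolding mem_row_space_iff mem_column_space_iff
      by (intro exI[of _ "\<lambda>k i. if k = l then unit_fun p i else 0"]) (simp add: slice_def)
    then have "g ?X \<in> row_space (\<beta> v)" using \<beta>[OF v] by blast
    then obtain z where z: "\<And>k i j. g ?X $ k $ j $ i = \<beta> v i * z k j"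
      unfolding mem_row_space_iff mem_column_space_iff tuple_transpose_nth by blast
    have "(\<Sum>j\<in>UNIV. v j * K' j l b k) = \<beta> v b * (z k a0 / A p a0)" for b k
      using K'[of a0 v l b k] z[of k a0 b] a0 by (simp add: field_simps)
    then show "\<exists>z. \<forall>b k. (\<Sum>j\<in>UNIV. v j * K' j l b k) = \<beta> v b * z k"
      by (intro exI[of _ "\<lambda>k. z k a0 / A p a0"]) blast
  next
    fix v assume v: "v \<noteq> (\<lambda>_ :: 'n. 0 :: complex)"
    then show "\<beta> v \<noteq> (\<lambda>_. 0)" using \<beta> by blast
    obtain j where "v j \<noteq> 0" using v by auto
    then have "(tensor (unit_fun p) (slice undefined v) :: complex^'n^'n^'m) $ undefined $ p $ j \<noteq> 0"
      by (simp add: slice_def unit_fun_def)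
    then have "tensor (unit_fun p) (slice undefined v) \<noteq> (0 :: complex^'n^'n^'m)" by (metis zero_index)
    from nz[OF this] obtain k a b where "g (tensor (unit_fun p) (slice undefined v)) $ k $ a $ b \<noteq> 0" by blast
    then have "(\<Sum>j\<in>UNIV. v j * K' j undefined b k) \<noteq> 0" unfolding K'[symmetric] by auto
    then show "\<exists>b k. (\<Sum>j\<in>UNIV. v j * K' j undefined b k) \<noteq> 0" by blast
  next
    fix u v assume uv: "u \<noteq> (\<lambda>_ :: 'n. 0 :: complex)" "v \<noteq> (\<lambda>_. 0)" "parallel (\<beta> u) (\<beta> v)"
    then have "g ` row_space u = g ` row_space v"
      using \<beta> row_space_eq_iff by metis
    then show "parallel u v" unfolding inj_image row_space_eq_iff[OF uv(1,2)] .
  qed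
  then obtain B P where "\<And>j l b k. K' j l b k = B j b * P l k" by blast
  then have "g (tensor (unit_fun i) (slice l (unit_fun j))) $ k $ a $ b = A i a * (B j b * P l k)" for i l j k a b
    by (simp add: AT flip: K'_def)
  then show ?thesis by blast
qed

lemma G_group_if_columns_to_columns:
  assumes "p \<noteq> (q :: 'n)"
    and "\<And>u. u \<noteq> (\<lambda>_. 0) \<Longrightarrow> \<exists>v. v \<noteq> (\<lambda>_. 0) \<and> g ` column_space u = column_space v"
  shows "g \<in> G_group"
  using product_form[OF assms] G_group_if_product_form[OF linear bij] by blast

theorem G_group_or_transpose: "g \<in> G_group \<union> {h \<circ> tuple_transpose | h. h \<in> G_group}"
proof (cases "\<exists>p q :: 'n. p \<noteq> q")
  case False
  \<comment> \<open>For \<open>n = 1\<close> every tuple lies in the cone, so the cone carries no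
    information; here all of \<open>g\<close> is absorbed into the factor that acts on
    positions.\<close>
  then have eq: "i = undefined" for i :: 'n by blast
  have "g \<in> G_group"
  proof (rule G_group_if_product_form[OF linear bij])
    show "g (tensor (unit_fun i) (slice l (unit_fun j))) $ k $ a $ b =
        (\<lambda>_ _. 1) i a * ((\<lambda>_ _. 1) j b * g (tensor (unit_fun undefined) (slice l (unit_fun undefined))) $ k $ undefined $ undefined)"
      for i l j k a b
      using eq[of i] eq[of j] eq[of a] eq[of b] by simp
  qed
  then show ?thesis by blast
next
  case True
  then obtain p q :: 'n where pq: "p \<noteq> q" by blast
  obtain v where v: "g ` column_space (unit_fun p) = column_space v \<or> g ` column_space (unit_fun p) = row_space v"
    using image_column_space[OF pq unit_fun_neq_0] by blast
  from v show ?thesis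
  proof
    assume "g ` column_space (unit_fun p) = column_space v"
    then have "g \<in> G_group"
      by (intro G_group_if_columns_to_columns[OF pq] columns_to_columns[OF pq unit_fun_neq_0])
    then show ?thesis by blast
  next
    assume row: "g ` column_space (unit_fun p) = row_space v"
    interpret l: cone_preserver "\<lambda>X. tuple_transpose (g X)" by (rule cone_preserver_transpose_left)
    interpret r: cone_preserver "\<lambda>X. g (tuple_transpose X)" by (rule cone_preserver_transpose_right)
    have "tuple_transpose ` g ` column_space (unit_fun p) = column_space v"
      unfolding row by (rule transpose_row_space)
    then have "(\<lambda>X. tuple_transpose (g X)) ` column_space (unit_fun p) = column_space v"
      by (simp add: image_image)
    note col = l.columns_to_columns[OF pq unit_fun_neq_0 this]
    \<comment> \<open>The transpose after \<open>g\<close> preserves the kind of column spaces,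
      whereas the claim has the transpose before \<open>g\<close>. The former map also preserves the
      kind of row spaces, and conjugating it by the transpose gives the latter map on column
      spaces.\<close>
    have "\<exists>w. w \<noteq> (\<lambda>_. 0) \<and> (\<lambda>X. g (tuple_transpose X)) ` column_space u = column_space w" if u: "u \<noteq> (\<lambda>_. 0)" for u
    proof -
      obtain w where w: "w \<noteq> (\<lambda>_. 0)" "(\<lambda>X. tuple_transpose (g X)) ` row_space u = row_space w"
        using l.rows_to_rows[OF pq col u] by blast
      have "(\<lambda>X. g (tuple_transpose X)) ` column_space u = tuple_transpose ` (\<lambda>X. tuple_transpose (g X)) ` row_space u"
        by (simp add: row_space_def image_image)
      then show ?thesis using w transpose_row_space by metis
    qed
    then have "(\<lambda>X. g (tuple_transpose X)) \<in> G_group" by (rule r.G_group_if_columns_to_columns[OF pq])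
    moreover have "g = (\<lambda>X. g (tuple_transpose X)) \<circ> tuple_transpose" by (simp add: fun_eq_iff)
    ultimately show ?thesis by blast
  qed
qed

end

section \<open>The group of symmetries\<close>

lemma unit_fun_commute: "unit_fun i j = unit_fun j i"
  by (simp add: unit_fun_def)

lemma bij_mapping_two_points:
  assumes "b \<noteq> b'" "a \<noteq> a'"
  obtains \<sigma> :: "'n \<Rightarrow> 'n" where "bij \<sigma>" "\<sigma> b = a" "\<sigma> b' = a'"
proof
  let ?\<tau> = "Transposition.transpose b a"
  let ?\<sigma> = "Transposition.transpose (?\<tau> b') a' \<circ> ?\<tau>"
  show "bij ?\<sigma>" by (intro bij_comp) simp_all
  have "?\<tau> b' \<noteq> a" using assms(1) by (auto simp: Transposition.transpose_def)
  then show "?\<sigma> b = a" using assms(2) by (simp add: Transposition.transpose_def)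
  show "?\<sigma> b' = a'" by simp
qed

text \<open>The two given columns are independent in the rows \<open>a\<close> and
  \<open>a'\<close>. The other columns are distinct unit vectors supported in the remaining rows,
  which the bijection \<open>\<sigma>\<close> distributes among them.\<close>

lemma exists_invertible_with_columns:
  fixes M :: "'n::finite \<Rightarrow> 'n \<Rightarrow> complex"
  assumes minor: "M a b * M a' b' \<noteq> M a b' * M a' b" and c: "c \<noteq> 0"
  obtains D :: "complex^'n^'n" where "invertible D" "\<And>i. D $ i $ b = M i b" "\<And>i. D $ i $ b' = c * M i b'"
proof -
  have ne: "b \<noteq> b'" "a \<noteq> a'" using minor by (auto simp: mult.commute)
  obtain \<sigma> :: "'n \<Rightarrow> 'n" where \<sigma>: "bij \<sigma>" "\<sigma> b = a" "\<sigma> b' = a'" using ne by (rule bij_mapping_two_points)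
  define D :: "complex^'n^'n" where
    "D = (\<chi> i j. if j = b then M i b else if j = b' then c * M i b' else if i = \<sigma> j then 1 else 0)"
  have "invertible D"
  proof (rule invertible_if_ker)
    fix x assume "D *v x = 0"
    then have x: "(\<Sum>j\<in>UNIV. D $ i $ j * x $ j) = 0" for i
      by (simp add: matrix_vector_mult_def vec_eq_iff)
    \<comment> \<open>Row \<open>\<sigma> k\<close> involves only the columns \<open>b\<close>,
      \<open>b'\<close> and \<open>k\<close>. For \<open>k = b\<close> and \<open>k = b'\<close>
      this is a 2 x 2 system with nonzero determinant; the other rows then give
      \<open>x $ k = 0\<close>.\<close>
    have eq: "M (\<sigma> k) b * x $ b + c * M (\<sigma> k) b' * x $ b' + (if k = b \<or> k = b' then 0 else x $ k) = 0" for k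
    proof -
      have "D $ \<sigma> k $ j * x $ j = (if j = b then M (\<sigma> k) b * x $ b else 0) +
          (if j = b' then c * M (\<sigma> k) b' * x $ b' else 0) +
          (if j = k then if k = b \<or> k = b' then 0 else x $ k else 0)" for j
        using ne \<sigma>(1) by (auto simp: D_def bij_is_inj inj_eq)
      then have "(\<Sum>j\<in>UNIV. D $ \<sigma> k $ j * x $ j) =
          M (\<sigma> k) b * x $ b + c * M (\<sigma> k) b' * x $ b' + (if k = b \<or> k = b' then 0 else x $ k)"
        by (simp add: sum.distrib)
      then show ?thesis using x by simp
    qed
    have e1: "M a b * x $ b + c * M a b' * x $ b' = 0" and e2: "M a' b * x $ b + c * M a' b' * x $ b' = 0"
      using eq[of b] eq[of b'] by (simp_all add: \<sigma>)
    have "(M a b * M a' b' - M a b' * M a' b) * x $ b =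
        M a' b' * (M a b * x $ b + c * M a b' * x $ b') - M a b' * (M a' b * x $ b + c * M a' b' * x $ b')"
      by (simp add: algebra_simps)
    then have xb: "x $ b = 0" using minor unfolding e1 e2 by simp
    have "(M a b * M a' b' - M a b' * M a' b) * (c * x $ b') =
        M a b * (M a' b * x $ b + c * M a' b' * x $ b') - M a' b * (M a b * x $ b + c * M a b' * x $ b')"
      by (simp add: algebra_simps)
    then have xb': "x $ b' = 0" using minor c unfolding e1 e2 by simp
    have "x $ k = 0" for k using eq[of k] xb xb' by (auto split: if_splits)
    then show "x = 0" by (simp add: vec_eq_iff)
  qed
  then show thesis using that[of D] ne by (simp add: D_def)
qed

section \<open>The action as a product of two commuting actions\<close>

definition row_mix :: "complex^'m^'m \<Rightarrow> complex^'n^'n^'m \<Rightarrow> complex^'n^'n^'m" where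
  "row_mix P X = (\<chi> k. \<Sum>l\<in>UNIV. mscale (P $ k $ l) (X $ l))"

definition two_sided :: "complex^'n^'n \<Rightarrow> complex^'n^'n \<Rightarrow> complex^'n^'n^'m \<Rightarrow> complex^'n^'n^'m" where
  "two_sided Q T X = (\<chi> k. Q ** X $ k ** T)"

lemma row_mix_nth: "row_mix P X $ k $ i $ j = (\<Sum>l\<in>UNIV. P $ k $ l * X $ l $ i $ j)"
  by (simp add: row_mix_def mscale_def)

lemma two_sided_nth:
  "two_sided Q T X $ k $ a $ b = (\<Sum>j\<in>UNIV. (\<Sum>i\<in>UNIV. Q $ a $ i * X $ k $ i $ j) * T $ j $ b)"
  by (simp add: two_sided_def matrix_matrix_mult_def)

lemma tuple_action_eq: "tuple_action P Q R X = row_mix P (two_sided Q (matrix_inv R) X)"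
  by (simp add: tuple_action_def row_mix_def two_sided_def)

lemma row_mix_compose: "row_mix P (row_mix P' X) = row_mix (P ** P') X"
proof -
  have "(\<Sum>l\<in>UNIV. P $ k $ l * (\<Sum>l'\<in>UNIV. P' $ l $ l' * X $ l' $ i $ j)) =
      (\<Sum>l'\<in>UNIV. (\<Sum>l\<in>UNIV. P $ k $ l * P' $ l $ l') * X $ l' $ i $ j)" for k i j
    unfolding sum_distrib_left sum_distrib_right by (subst sum.swap) (simp add: mult_ac)
  then show ?thesis by (simp add: vec_eq_iff row_mix_nth matrix_matrix_mult_def)
qed

lemma row_mix_mat:
  fixes X :: "complex^'n^'n^'m"
  shows "row_mix (mat 1) X = X"
proof -
  have "(\<Sum>l\<in>UNIV. (mat 1 :: complex^'m^'m) $ k $ l * X $ l $ i $ j) = X $ k $ i $ j" for k i j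
    by (simp add: mat_def if_distrib[of "\<lambda>x. x * _"] cong: if_cong)
  then show ?thesis by (simp add: vec_eq_iff row_mix_nth)
qed

lemma two_sided_compose: "two_sided Q T (two_sided Q' T' X) = two_sided (Q ** Q') (T' ** T) X"
  by (simp add: two_sided_def matrix_mul_assoc)

lemma two_sided_mat: "two_sided (mat 1) (mat 1) X = X"
  by (simp add: two_sided_def)

lemma two_sided_row_mix: "two_sided Q T (row_mix P X) = row_mix P (two_sided Q T X)"
proof -
  have "(\<Sum>j\<in>UNIV. (\<Sum>i\<in>UNIV. Q $ a $ i * (\<Sum>l\<in>UNIV. P $ k $ l * X $ l $ i $ j)) * T $ j $ b) =
      (\<Sum>l\<in>UNIV. P $ k $ l * (\<Sum>j\<in>UNIV. (\<Sum>i\<in>UNIV. Q $ a $ i * X $ l $ i $ j) * T $ j $ b))" (is "?L = ?R") for k a b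
  proof -
    have "?L = (\<Sum>j\<in>UNIV. \<Sum>i\<in>UNIV. \<Sum>l\<in>UNIV. P $ k $ l * Q $ a $ i * X $ l $ i $ j * T $ j $ b)"
      by (simp add: sum_distrib_left sum_distrib_right mult_ac)
    also have "\<dots> = (\<Sum>j\<in>UNIV. \<Sum>l\<in>UNIV. \<Sum>i\<in>UNIV. P $ k $ l * Q $ a $ i * X $ l $ i $ j * T $ j $ b)"
      by (intro sum.cong refl sum.swap)
    also have "\<dots> = (\<Sum>l\<in>UNIV. \<Sum>j\<in>UNIV. \<Sum>i\<in>UNIV. P $ k $ l * Q $ a $ i * X $ l $ i $ j * T $ j $ b)"
      by (rule sum.swap)
    also have "\<dots> = ?R"
      by (simp add: sum_distrib_left sum_distrib_right mult_ac)
    finally show ?thesis .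
  qed
  then show ?thesis by (simp add: vec_eq_iff row_mix_nth two_sided_nth)
qed

lemma tuple_action_inverse:
  assumes "invertible P" "invertible Q" "invertible R"
  shows "tuple_action P Q R (tuple_action (matrix_inv P) (matrix_inv Q) (matrix_inv R) X) = X"
  using assms
  by (simp add: tuple_action_eq two_sided_row_mix row_mix_compose two_sided_compose matrix_inv_right_left
      row_mix_mat two_sided_mat invertible_matrix_inv)

lemma tuple_action_inverse':
  assumes "invertible P" "invertible Q" "invertible R"
  shows "tuple_action (matrix_inv P) (matrix_inv Q) (matrix_inv R) (tuple_action P Q R X) = X"
  using tuple_action_inverse[of "matrix_inv P" "matrix_inv Q" "matrix_inv R" X] assms
  by (simp add: invertible_matrix_inv)

lemma linear_tscaleI:
  assumes "\<And>X Y. g (X + Y) = g X + g Y" "\<And>c X. g (tscale c X) = tscale c (g X)"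
  shows "Vector_Spaces.linear tscale tscale g"
  unfolding Vector_Spaces.linear_iff by (intro conjI allI vector_space_tscale assms)

lemma linear_tuple_action: "Vector_Spaces.linear tscale tscale (tuple_action P Q R)"
proof (rule linear_tscaleI)
  show "tuple_action P Q R (X + Y) = tuple_action P Q R X + tuple_action P Q R Y" for X Y
    by (simp add: vec_eq_iff tuple_action_nth distrib_left distrib_right sum.distrib)
  show "tuple_action P Q R (tscale c X) = tscale c (tuple_action P Q R X)" for c X
    by (simp add: vec_eq_iff tuple_action_nth sum_distrib_left sum_distrib_right mult_ac)
qed

lemma symmetriesI:
  assumes lin: "Vector_Spaces.linear tscale tscale g"
    and inverse: "\<And>X. g (h X) = X" "\<And>X. h (g X) = X"
    and S: "\<And>X. X \<in> S \<Longrightarrow> g X \<in> S" "\<And>X. X \<in> S \<Longrightarrow> h X \<in> S"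
  shows "g \<in> symmetries S"
proof -
  have "bij g" using inverse by (intro o_bij[of h]) (auto simp: fun_eq_iff)
  moreover have "S \<subseteq> g ` S"
  proof
    fix X assume "X \<in> S"
    then show "X \<in> g ` S" using inverse(1)[of X] S(2) by (metis imageI)
  qed
  ultimately show ?thesis using lin S(1) by (auto simp: symmetries_def GL_tuples_def)
qed

section \<open>Critical tuples of the singular locus and its symmetries\<close>

context free_field
begin

lemma NSING_transpose_iff: "tuple_transpose X \<in> NSING F \<phi> \<longleftrightarrow> X \<in> NSING F \<phi>"
  using NSING_transpose[of X] NSING_transpose[of "tuple_transpose X"] by auto

lemma NSING_tuple_action:
  assumes "invertible P" "invertible Q" "invertible R" "X \<in> NSING F \<phi>"
  shows "tuple_action P Q R X \<in> NSING F \<phi>"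
proof -
  have "two_sided Q (matrix_inv R) X \<in> NSING F \<phi>"
    unfolding two_sided_def using assms NSING_equivalence invertible_matrix_inv by blast
  then show ?thesis
    unfolding tuple_action_eq row_mix_def using assms(1) by (rule NSING_linear_substitution[rotated])
qed

lemma rank_one_cone_iff:
  fixes Y :: "complex^'n::finite^'n^'m"
  shows "Y \<in> rank_one_cone \<longleftrightarrow>
    (\<forall>X s t. X \<notin> NSING F \<phi> \<longrightarrow> X + tscale s Y \<in> NSING F \<phi> \<longrightarrow> X + tscale t Y \<in> NSING F \<phi> \<longrightarrow> s = t)"
proof (intro iffI allI impI)
  fix X s t
  assume Y: "Y \<in> rank_one_cone" and X: "X \<notin> NSING F \<phi>"
    and st: "X + tscale s Y \<in> NSING F \<phi>" "X + tscale t Y \<in> NSING F \<phi>"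
  obtain u where "Y \<in> column_space u \<or> tuple_transpose Y \<in> column_space u"
    using Y by (auto simp: rank_one_cone_def mem_row_space_iff)
  then show "s = t"
  proof
    assume "Y \<in> column_space u"
    then obtain y where "\<And>k i j. Y $ k $ i $ j = u i * y k j" unfolding mem_column_space_iff by blast
    then show ?thesis by (rule rank_one_line[OF X _ st])
  next
    assume "tuple_transpose Y \<in> column_space u"
    then obtain y where y: "\<And>k i j. tuple_transpose Y $ k $ i $ j = u i * y k j"
      unfolding mem_column_space_iff by blast
    have tr: "tuple_transpose X + tscale s (tuple_transpose Y) = tuple_transpose (X + tscale s Y)" for s
      by (simp add: vec_eq_iff)
    show ?thesis
    proof (rule rank_one_line[OF _ y])
      show "tuple_transpose X \<notin> NSING F \<phi>" using X by (simp add: NSING_transpose_iff)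
      show "tuple_transpose X + tscale s (tuple_transpose Y) \<in> NSING F \<phi>"
        "tuple_transpose X + tscale t (tuple_transpose Y) \<in> NSING F \<phi>"
        unfolding tr using st by (simp_all add: NSING_transpose_iff)
    qed
  qed
next
  assume line: "\<forall>X s t. X \<notin> NSING F \<phi> \<longrightarrow> X + tscale s Y \<in> NSING F \<phi> \<longrightarrow> X + tscale t Y \<in> NSING F \<phi> \<longrightarrow> s = t"
  \<comment> \<open>All linear combinations have to be controlled: the matrices \<open>Y $ k\<close>
    may each have rank one without sharing a column or a row.\<close>
  define M where "M c i j = (\<Sum>k\<in>UNIV. c k * Y $ k $ i $ j)" for c i j
  have rank: "rank_le_one (M c)" for c
  proof (rule ccontr)
    assume "\<not> rank_le_one (M c)"
    then obtain a a' b b' where minor: "M c a b * M c a' b' \<noteq> M c a b' * M c a' b"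
      unfolding rank_le_one_iff_minors by blast
    obtain k0 where k0: "c k0 \<noteq> 0"
    proof (rule ccontr)
      assume "\<not> thesis"
      then have "c k = 0" for k using that by blast
      then have "M c i j = 0" for i j by (simp add: M_def)
      then show False using minor by simp
    qed
    \<comment> \<open>The factor \<open>2\<close> makes the two columns vanish at different
      parameters of the line, \<open>-1\<close> and \<open>-2\<close>.\<close>
    obtain D :: "complex^'n^'n" where D: "invertible D" "\<And>i. D $ i $ b = M c i b" "\<And>i. D $ i $ b' = 2 * M c i b'"
      using exists_invertible_with_columns[OF minor, of 2] by auto
    have bb': "b \<noteq> b'" using minor by auto
    \<comment> \<open>The columns \<open>b\<close> and \<open>b'\<close> are dictated by
      \<open>Y\<close>. The remaining ones are placed in the single matrix at \<open>k0\<close>,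
      divided by \<open>c k0\<close>, so that the combination with coefficients \<open>c\<close> is
      exactly \<open>D\<close>.\<close>
    define X :: "complex^'n^'n^'m" where
      "X = (\<chi> k i j. if j = b then Y $ k $ i $ b else if j = b' then 2 * Y $ k $ i $ b'
             else if k = k0 then D $ i $ j / c k0 else 0)"
    have "(\<Sum>k\<in>UNIV. c k * X $ k $ i $ j) = D $ i $ j" for i j
    proof -
      consider "j = b" | "j = b'" | "j \<noteq> b" "j \<noteq> b'" by blast
      then show ?thesis
      proof cases
        case 1
        then show ?thesis by (simp add: X_def D(2) M_def)
      next
        case 2
        then show ?thesis using bb' by (simp add: X_def D(3) M_def sum_distrib_left mult_ac)
      next
        case 3
        then have "(\<Sum>k\<in>UNIV. c k * X $ k $ i $ j) = (\<Sum>k\<in>UNIV. if k = k0 then D $ i $ j else 0)"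
          using k0 by (intro sum.cong) (auto simp: X_def)
        then show ?thesis by simp
      qed
    qed
    then have "(\<chi> i j. \<Sum>k\<in>UNIV. c k * X $ k $ i $ j) = D" by (simp add: vec_eq_iff)
    then have "X \<notin> NSING F \<phi>" using D(1) by (intro not_NSING_if_invertible_combination[of c]) simp
    moreover have "X + tscale (-1) Y \<in> NSING F \<phi>" by (rule NSING_if_zero_column[of _ b]) (simp add: X_def)
    moreover have "X + tscale (-2) Y \<in> NSING F \<phi>"
      using bb' by (intro NSING_if_zero_column[of _ b']) (simp add: X_def)
    ultimately have "-1 = (-2 :: complex)" using line by blast
    then show False by simp
  qed
  have unit: "M (unit_fun k) i j = Y $ k $ i $ j" for k i j
    by (simp add: M_def unit_fun_commute[of k])
  have "(\<exists>u. \<forall>N\<in>range M. \<exists>y. \<forall>a b. N a b = u a * y b) \<or> (\<exists>y. \<forall>N\<in>range M. \<exists>u. \<forall>a b. N a b = u a * y b)"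
  proof (rule rank_le_one_space)
    fix N N' assume "N \<in> range M" "N' \<in> range M"
    then obtain c c' where "N = M c" "N' = M c'" by blast
    then have "(\<lambda>a b. N a b + N' a b) = M (\<lambda>k. c k + c' k)"
      by (simp add: M_def fun_eq_iff distrib_right sum.distrib)
    then show "(\<lambda>a b. N a b + N' a b) \<in> range M" by blast
  qed (use rank in auto)
  then show "Y \<in> rank_one_cone"
  proof
    assume "\<exists>u. \<forall>N\<in>range M. \<exists>y. \<forall>a b. N a b = u a * y b"
    then obtain u where "\<And>c. \<exists>y. \<forall>a b. M c a b = u a * y b" by blast
    then have "\<exists>y. \<forall>a b. Y $ k $ a $ b = u a * y b" for k unfolding unit[symmetric] by blast
    then have "\<exists>y. \<forall>k a b. Y $ k $ a $ b = u a * y k b" by metis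
    then have "Y \<in> column_space u" unfolding mem_column_space_iff .
    then show ?thesis by (auto simp: rank_one_cone_def)
  next
    assume "\<exists>y. \<forall>N\<in>range M. \<exists>u. \<forall>a b. N a b = u a * y b"
    then obtain u where "\<And>c. \<exists>y. \<forall>a b. M c a b = y a * u b" by blast
    then have "\<exists>y. \<forall>a b. Y $ k $ a $ b = y a * u b" for k unfolding unit[symmetric] by blast
    then have "\<exists>y. \<forall>k a b. Y $ k $ a $ b = y k a * u b" by metis
    then have "\<exists>y. \<forall>k a b. tuple_transpose Y $ k $ a $ b = u a * y k b" unfolding tuple_transpose_nth by (metis mult.commute)
    then have "Y \<in> row_space u" unfolding mem_row_space_iff mem_column_space_iff .
    then show ?thesis by (auto simp: rank_one_cone_def)
  qed
qed

text \<open>The right-hand side of \<open>rank_one_cone_iff\<close> mentions only sums, scalars and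
  the singular locus, all of which \<open>g\<close> transports; surjectivity of \<open>g\<close>
  provides the base points for the converse direction.\<close>

lemma cone_preserver_if_symmetry:
  assumes g: "g \<in> symmetries (NSING F \<phi> :: (complex^'n::finite^'n^'m) set)"
  shows "cone_preserver g"
proof -
  have lin: "Vector_Spaces.linear tscale tscale g" and bij: "bij g" and S: "g ` NSING F \<phi> = NSING F \<phi>"
    using g by (auto simp: symmetries_def GL_tuples_def)
  interpret linear: Vector_Spaces.linear tscale tscale g by (rule lin)
  have mem: "g X \<in> NSING F \<phi> \<longleftrightarrow> X \<in> NSING F \<phi>" for X
    using S bij by (metis bij_is_inj inj_image_mem_iff)
  have gl: "g (X + tscale s Y) = g X + tscale s (g Y)" for X Y s
    by (simp add: linear.add linear.scale)
  have "g Y \<in> rank_one_cone \<longleftrightarrow> Y \<in> rank_one_cone" for Y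
  proof
    assume gY: "g Y \<in> rank_one_cone"
    show "Y \<in> rank_one_cone"
      unfolding rank_one_cone_iff
    proof (intro allI impI)
      fix X s t
      assume "X \<notin> NSING F \<phi>" "X + tscale s Y \<in> NSING F \<phi>" "X + tscale t Y \<in> NSING F \<phi>"
      then have "g X \<notin> NSING F \<phi>" "g X + tscale s (g Y) \<in> NSING F \<phi>" "g X + tscale t (g Y) \<in> NSING F \<phi>"
        by (simp_all add: mem flip: gl)
      then show "s = t" using gY unfolding rank_one_cone_iff by blast
    qed
  next
    assume Y: "Y \<in> rank_one_cone"
    show "g Y \<in> rank_one_cone"
      unfolding rank_one_cone_iff
    proof (intro allI impI)
      fix X s t
      assume *: "X \<notin> NSING F \<phi>" "X + tscale s (g Y) \<in> NSING F \<phi>" "X + tscale t (g Y) \<in> NSING F \<phi>"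
      obtain X' where "X = g X'" using bij by (metis bij_pointE)
      then have "X' \<notin> NSING F \<phi>" "X' + tscale s Y \<in> NSING F \<phi>" "X' + tscale t Y \<in> NSING F \<phi>"
        using * by (simp_all add: mem flip: gl)
      then show "s = t" using Y unfolding rank_one_cone_iff by blast
    qed
  qed
  with lin bij show ?thesis by (simp add: cone_preserver_def)
qed

lemma G_group_symmetries: "G_group \<subseteq> symmetries (NSING F \<phi> :: (complex^'n::finite^'n^'m) set)"
proof
  fix g :: "complex^'n^'n^'m \<Rightarrow> complex^'n^'n^'m" assume "g \<in> G_group"
  then obtain P Q R where g: "g = tuple_action P Q R" and inv: "invertible P" "invertible Q" "invertible R"
    unfolding G_group_def by blast
  show "g \<in> symmetries (NSING F \<phi>)"
    unfolding g using inv
    by (intro symmetriesI[where h = "tuple_action (matrix_inv P) (matrix_inv Q) (matrix_inv R)"]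
        linear_tuple_action tuple_action_inverse tuple_action_inverse' NSING_tuple_action invertible_matrix_inv(1))
qed

lemma tuple_transpose_symmetry: "tuple_transpose \<in> symmetries (NSING F \<phi> :: (complex^'n::finite^'n^'m) set)"
proof (rule symmetriesI[where h = tuple_transpose])
  show "Vector_Spaces.linear tscale tscale (tuple_transpose :: complex^'n^'n^'m \<Rightarrow> _)"
    by (rule linear_tscaleI) (simp_all add: vec_eq_iff)
qed (auto intro: NSING_transpose)

end

lemma symmetries_comp:
  assumes "g \<in> symmetries S" "h \<in> symmetries S"
  shows "g \<circ> h \<in> symmetries S"
proof -
  have "g ` h ` S = S" using assms by (simp add: symmetries_def)
  then have "(g \<circ> h) ` S = S" by (simp only: image_comp)
  moreover have "Vector_Spaces.linear tscale tscale (g \<circ> h)" "bij (g \<circ> h)"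
    using assms by (auto simp: symmetries_def GL_tuples_def intro: Vector_Spaces.linear_compose bij_comp)
  ultimately show ?thesis by (simp add: symmetries_def GL_tuples_def)
qed

theorem theorem1p14:
  fixes F :: "'f ring" and \<phi> :: "('m::finite list \<Rightarrow> complex) \<Rightarrow> 'f"
    and S :: "(complex^'n::finite^'n^'m) set"
  assumes "free_skew_field F \<phi>"
    and "S = NSING F \<phi>"
  shows "symmetries S = G_group \<union> {g \<circ> tuple_transpose | g. g \<in> G_group}"
proof
  interpret free_field F \<phi> using assms(1) by (rule free_field.intro)
  show "symmetries S \<subseteq> G_group \<union> {g \<circ> tuple_transpose | g. g \<in> G_group}"
    unfolding assms(2) using cone_preserver.G_group_or_transpose[OF cone_preserver_if_symmetry] by blast
  show "G_group \<union> {g \<circ> tuple_transpose | g. g \<in> G_group} \<subseteq> symmetries S"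
    unfolding assms(2) using G_group_symmetries symmetries_comp[OF _ tuple_transpose_symmetry] by blast
qed

end
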